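(* Let $\mu\ge1$ be an integer and let $\mathcal{M}_{2\mu}$ be the set of real skew symmetric orthogonal matrices of order $2\mu$, which is a submanifold of the vector space $\mathcal{A}_{2\mu}$ of real skew symmetric matrices of order $2\mu$. Then $\mathcal{M}_{2\mu}$ is compact of dimension $\mu(\mu-1)$, and its connected components are $\mathcal{M}_{2\mu}^+$ and $\mathcal{M}_{2\mu}^-$, the sets of real skew symmetric orthogonal matrices of order $2\mu$ with Pfaffian equal to $1$ and to $-1$ respectively. These components are simply connected manifolds, both diffeomorphic to the homogeneous space $SO_{2\mu}/U_\mu$. In particular, if $\mu=1$ each of them is a single point, and if $\mu=2$ they are both diffeomorphic to a $2$-sphere.
   Context: Let $E_0=\begin{pmatrix}0&1\\-1&0\end{pmatrix}$ and let $J=\operatorname{diag}(E_0,\dots,E_0)$ ($\mu$ blocks). The Pfaffian is normalized so that the Pfaffian of $J$ is $1$. The unitary group $U_\mu$ of complex matrices of order $\mu$ is identified with the subgroup $Sp_{2\mu}(\mathbb{R})\cap O_{2\mu}=\{Q\in O_{2\mu}: QJQ^T=J\}$ of $SO_{2\mu}$, where $Sp_{2\mu}(\mathbb{R})$ is the real symplectic group and $O_{2\mu}$, $SO_{2\mu}$ are the real orthogonal and special orthogonal groups. *)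

theory Defs
  imports "HOL-Analysis.Analysis"
begin

section \<open>Smooth functions on subsets of Euclidean spaces\<close>

text \<open>\<open>Ck_on k U f\<close> is only meant for open \<open>U\<close>: all iterated directional derivatives of \<open>f\<close> up to
  order \<open>k\<close> exist on \<open>U\<close> as Frechet derivatives and are continuous.\<close>

fun Ck_on :: "nat \<Rightarrow> 'a::euclidean_space set \<Rightarrow> ('a \<Rightarrow> 'b::euclidean_space) \<Rightarrow> bool" where
  "Ck_on 0 U f \<longleftrightarrow> continuous_on U f"
| "Ck_on (Suc k) U f \<longleftrightarrow>
     (\<forall>x\<in>U. f differentiable (at x)) \<and> (\<forall>v. Ck_on k U (\<lambda>x. frechet_derivative f (at x) v))"

text \<open>Smoothness on an arbitrary subset \<open>X\<close>, as usual for subsets of Euclidean spaces: local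
  extendability to a \<open>C\<^sup>\<infinity>\<close> function on an open set. If \<open>X\<close> is open in a linear subspace, this is
  ordinary smoothness on that subspace.\<close>

definition smooth_on :: "'a::euclidean_space set \<Rightarrow> ('a \<Rightarrow> 'b::euclidean_space) \<Rightarrow> bool" where
  "smooth_on X f \<longleftrightarrow>
     (\<forall>x\<in>X. \<exists>U g. open U \<and> x \<in> U \<and> (\<forall>k. Ck_on k U g) \<and> (\<forall>y\<in>X \<inter> U. g y = f y))"


section \<open>Smooth manifolds\<close>

text \<open>A chart \<open>(U, S, \<phi>)\<close> maps the open set \<open>U\<close> homeomorphically onto an open subset of the
  finite-dimensional vector space \<open>S\<close>, a linear subspace of the Euclidean space \<open>'e\<close>. Using
  subspaces instead of whole types allows the dimension to be an arbitrary natural number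
  (including \<open>0\<close>); every chart brings its own copy \<open>S\<close> of \<open>\<real>\<^sup>d\<close>. Values of \<open>\<phi>\<close> outside \<open>U\<close> are
  irrelevant.\<close>

record ('a, 'e) smooth_mfd =
  mtop :: "'a topology"
  charts :: "('a set \<times> 'e set \<times> ('a \<Rightarrow> 'e)) set"

definition smooth_manifold :: "nat \<Rightarrow> ('a, 'e::euclidean_space) smooth_mfd \<Rightarrow> bool" where
  "smooth_manifold d M \<longleftrightarrow>
     Hausdorff_space (mtop M) \<and> second_countable (mtop M) \<and>
     (\<forall>(U, S, \<phi>)\<in>charts M.
        openin (mtop M) U \<and> subspace S \<and> dim S = d \<and> openin (top_of_set S) (\<phi> ` U) \<and>
        homeomorphic_map (subtopology (mtop M) U) (top_of_set (\<phi> ` U)) \<phi>) \<and>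
     (\<Union>(U, S, \<phi>)\<in>charts M. U) = topspace (mtop M) \<and>
     (\<forall>(U, S, \<phi>)\<in>charts M. \<forall>(V, T, \<psi>)\<in>charts M.
        smooth_on (\<phi> ` (U \<inter> V)) (\<psi> \<circ> inv_into U \<phi>))"

definition smooth_map ::
  "('a, 'e::euclidean_space) smooth_mfd \<Rightarrow> ('b, 'f::euclidean_space) smooth_mfd \<Rightarrow> ('a \<Rightarrow> 'b) \<Rightarrow> bool"
  where
  "smooth_map M N f \<longleftrightarrow>
     continuous_map (mtop M) (mtop N) f \<and>
     (\<forall>(U, S, \<phi>)\<in>charts M. \<forall>(V, T, \<psi>)\<in>charts N.
        smooth_on (\<phi> ` (U \<inter> f -` V)) (\<psi> \<circ> f \<circ> inv_into U \<phi>))"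

definition diffeomorphic ::
  "('a, 'e::euclidean_space) smooth_mfd \<Rightarrow> ('b, 'f::euclidean_space) smooth_mfd \<Rightarrow> bool" where
  "diffeomorphic M N \<longleftrightarrow>
     (\<exists>d. smooth_manifold d M \<and> smooth_manifold d N) \<and>
     (\<exists>f g. smooth_map M N f \<and> smooth_map N M g \<and>
        (\<forall>x\<in>topspace (mtop M). g (f x) = x) \<and> (\<forall>y\<in>topspace (mtop N). f (g y) = y))"

text \<open>The set \<open>\<phi> ` (U \<inter> f -` V)\<close> is open in \<open>S\<close>, so \<open>D\<close> is determined on \<open>S\<close>.\<close>

definition submersion ::
  "('a, 'e::euclidean_space) smooth_mfd \<Rightarrow> ('b, 'f::euclidean_space) smooth_mfd \<Rightarrow> ('a \<Rightarrow> 'b) \<Rightarrow> bool"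
  where
  "submersion M N f \<longleftrightarrow>
     smooth_map M N f \<and>
     (\<forall>(U, S, \<phi>)\<in>charts M. \<forall>(V, T, \<psi>)\<in>charts N. \<forall>x\<in>U \<inter> f -` V.
        \<exists>D. ((\<psi> \<circ> f \<circ> inv_into U \<phi>) has_derivative D) (at (\<phi> x) within \<phi> ` (U \<inter> f -` V)) \<and>
            D ` S = T)"


section \<open>Submanifolds of Euclidean spaces\<close>

text \<open>The smooth structure which a submanifold \<open>M\<close> inherits from the ambient space: all
  diffeomorphisms from relatively open subsets of \<open>M\<close> onto open subsets of vector spaces.
  Nonemptiness of \<open>U\<close> makes \<open>U\<close> determine the dimension of \<open>S\<close>.\<close>

definition submanifold_structure :: "'a::euclidean_space set \<Rightarrow> ('a, 'a) smooth_mfd" where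
  "submanifold_structure M =
     \<lparr>mtop = top_of_set M,
      charts = {(U, S, \<phi>). U \<noteq> {} \<and> openin (top_of_set M) U \<and> subspace S \<and>
                  openin (top_of_set S) (\<phi> ` U) \<and> inj_on \<phi> U \<and>
                  smooth_on U \<phi> \<and> smooth_on (\<phi> ` U) (inv_into U \<phi>)}\<rparr>"

text \<open>\<open>M\<close> is an embedded \<open>d\<close>-dimensional submanifold of the vector space \<open>V\<close>: around each point of
  \<open>M\<close> there is a chart of \<open>V\<close> with values in \<open>V\<close> that maps \<open>M\<close> to a \<open>d\<close>-dimensional slice.\<close>

definition submanifold :: "'a::euclidean_space set \<Rightarrow> nat \<Rightarrow> 'a set \<Rightarrow> bool" where
  "submanifold V d M \<longleftrightarrow>
     subspace V \<and> M \<subseteq> V \<and>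
     (\<forall>p\<in>M. \<exists>U \<phi> S. (U, V, \<phi>) \<in> charts (submanifold_structure V) \<and> p \<in> U \<and>
        subspace S \<and> S \<subseteq> V \<and> dim S = d \<and> \<phi> ` (U \<inter> M) = \<phi> ` U \<inter> S)"


section \<open>Homogeneous spaces of matrix groups\<close>

definition left_coset :: "(real^'n^'n) set \<Rightarrow> real^'n^'n \<Rightarrow> (real^'n^'n) set" where
  "left_coset H g = (\<lambda>h. g ** h) ` H"

definition coset_topology :: "(real^'n^'n) set \<Rightarrow> (real^'n^'n) set \<Rightarrow> (real^'n^'n) set topology" where
  "coset_topology G H =
     topology (\<lambda>W. W \<subseteq> left_coset H ` G \<and> openin (top_of_set G) {g\<in>G. left_coset H g \<in> W})"

lemma openin_coset_topology:
  "openin (coset_topology G H) W \<longleftrightarrow>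
     W \<subseteq> left_coset H ` G \<and> openin (top_of_set G) {g\<in>G. left_coset H g \<in> W}" (is "_ \<longleftrightarrow> ?P W")
proof -
  have "?P (A \<inter> B)" if "?P A" "?P B" for A B
  proof -
    have "{g\<in>G. left_coset H g \<in> A \<inter> B} =
          {g\<in>G. left_coset H g \<in> A} \<inter> {g\<in>G. left_coset H g \<in> B}" by auto
    then show ?thesis using that by (auto intro: openin_Int)
  qed
  moreover have "?P (\<Union>\<K>)" if "\<forall>K\<in>\<K>. ?P K" for \<K>
  proof -
    have "{g\<in>G. left_coset H g \<in> \<Union>\<K>} = (\<Union>K\<in>\<K>. {g\<in>G. left_coset H g \<in> K})" by auto
    then show ?thesis using that by (auto intro: openin_Union)
  qed
  ultimately have "istopology ?P" unfolding istopology_def by blast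
  then show ?thesis unfolding coset_topology_def by (simp add: topology_inverse')
qed

lemma topspace_coset_topology: "topspace (coset_topology G H) = left_coset H ` G"
proof -
  have "{g\<in>G. left_coset H g \<in> left_coset H ` G} = G" by auto
  then have "openin (coset_topology G H) (left_coset H ` G)"
    by (simp add: openin_coset_topology)
  then show ?thesis
    by (metis openin_coset_topology openin_subset openin_topspace subset_antisym)
qed

lemma quotient_map_left_coset:
  "quotient_map (top_of_set G) (coset_topology G H) (left_coset H)"
  unfolding quotient_map_def by (simp add: topspace_coset_topology openin_coset_topology)

text \<open>\<open>G/H\<close> with the quotient topology and the unique smooth structure for which the projection
  \<open>g \<mapsto> gH\<close> is a smooth submersion. Its maximal atlas consists of those topological charts \<open>\<phi>\<close> whose
  composition with the projection is a submersion from the (open) preimage of \<open>U\<close> in \<open>G\<close> onto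
  \<open>\<phi> ` U\<close>. Here \<open>G\<close> is a closed matrix group and \<open>H\<close> a closed subgroup.\<close>

definition homogeneous_space ::
  "(real^'n^'n) set \<Rightarrow> (real^'n^'n) set \<Rightarrow> ((real^'n^'n) set, 'e::euclidean_space) smooth_mfd" where
  "homogeneous_space G H =
     \<lparr>mtop = coset_topology G H,
      charts = {(U, S, \<phi>). U \<noteq> {} \<and> openin (coset_topology G H) U \<and> subspace S \<and>
                  openin (top_of_set S) (\<phi> ` U) \<and>
                  homeomorphic_map (subtopology (coset_topology G H) U) (top_of_set (\<phi> ` U)) \<phi> \<and>
                  submersion (submanifold_structure {g\<in>G. left_coset H g \<in> U})
                    (submanifold_structure (\<phi> ` U)) (\<phi> \<circ> left_coset H)}\<rparr>"


section \<open>Matrices of order \<open>2\<mu>\<close>\<close>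

text \<open>With \<open>\<mu> = CARD('m)\<close>, rows and columns are indexed by pairs (block, position in the block).
  An enumeration of the blocks is not needed: renumbering blocks is an even permutation
  of the \<open>2\<mu>\<close> indices, so the Pfaffian does not depend on it.\<close>

type_synonym 'm block_matrix = "real^('m \<times> 2)^('m \<times> 2)"

definition skew_matrices :: "(real^'n^'n) set" where
  "skew_matrices = {A. transpose A = - A}"

definition E0 :: "real^2^2" where
  "E0 = vector [vector [0, 1], vector [-1, 0]]"

definition J :: "'m::finite block_matrix" where
  "J = (\<chi> r c. if fst r = fst c then E0 $ snd r $ snd c else 0)"

text \<open>The usual expansion over all permutations of the indices. Each perfect matching is counted
  \<open>2\<^sup>\<mu> \<mu>!\<close> times with the same sign; the identity matching gives the normalization \<open>pfaffian J = 1\<close>.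
  In the index type \<open>2\<close>, the second position is \<open>2 = 0\<close>.\<close>

definition pfaffian :: "'m::finite block_matrix \<Rightarrow> real" where
  "pfaffian A =
     (\<Sum>p | p permutes (UNIV :: ('m \<times> 2) set).
        of_int (sign p) * (\<Prod>i\<in>UNIV. A $ p (i, 1) $ p (i, 2))) / (2 ^ CARD('m) * fact CARD('m))"

definition special_orthogonal_group :: "(real^'n^'n) set" where
  "special_orthogonal_group = {Q. rotation_matrix Q}"

definition symplectic_group :: "'m::finite block_matrix set" where
  "symplectic_group = {Q. Q ** J ** transpose Q = J}"

text \<open>The unitary group of order \<open>\<mu>\<close>, identified with a group of real matrices of order \<open>2\<mu>\<close>.\<close>

definition unitary_group :: "'m::finite block_matrix set" where
  "unitary_group = symplectic_group \<inter> {Q. orthogonal_matrix Q}"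

end

theory Submission
  imports Defs
begin

text \<open>A skew orthogonal matrix \<open>A\<close> satisfies \<open>A\<^sup>2 = -1\<close>, so it has the normal form \<open>Q J Q\<^sup>T\<close> with \<open>Q\<close>
  orthogonal, and its Pfaffian is \<open>det Q = \<plusminus>1\<close>. Near \<open>A0\<close> the rational map
  \<open>B \<mapsto> A0 + 2 (B + A0)\<^sup>-\<^sup>1\<close> of the skew matrices straightens \<open>\<M>\<close> to the linear space of skew
  matrices anticommuting with \<open>A0\<close>, of dimension \<open>\<mu>(\<mu>-1)\<close>.

  Fix a unit vector \<open>e\<close>. The map \<open>A \<mapsto> A e\<close> goes to the unit sphere of the complement of \<open>e\<close>, and away
  from \<open>w\<close> it is trivialised by conjugation with the reflection that exchanges \<open>A e\<close> and \<open>w\<close>; the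
  fibre consists of the complex structures on the complement of \<open>e\<close> and \<open>w\<close>. By induction on the dimension and van
  Kampen's theorem for the two sets \<open>A e \<noteq> w\<close>, \<open>A e \<noteq> -w\<close>, there are two pieces, open and simply
  connected, which the Pfaffian separates.

  The map \<open>g \<mapsto> g J g\<^sup>T\<close> has smooth local sections, obtained from a smooth square root near \<open>1\<close>.
  Therefore it identifies the charts of \<open>SO/U\<close> with those of a component. For \<open>\<mu> = 1\<close> the straightened
  neighbourhoods are points; for \<open>\<mu> = 2\<close> they lie in the unit sphere spanned by a quaternionic triple,
  which is therefore open and closed in the component.\<close>

section \<open>Calculus of smooth functions\<close>

text \<open>Two obstacles shape the proof. The first is the passage from a chart of
  \<open>SO/U\<close> to a chart of a component: a chart of the quotient is only a homeomorphism
  whose composite with the projection is a submersion, so smoothness of its inverse has to be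
  recovered. Local sections make the chart smooth on the component, surjectivity of the derivative
  and equality of dimensions make the derivative bijective, and an inverse function theorem between
  linear subspaces finishes. The second is that the reflections used over the sphere do not tell
  which piece of one trivialisation continues which piece of the other. The induction therefore
  carries two unnamed pieces, and connectedness of the overlaps decides the matching; this requires
  the sphere without two poles to be nonempty and path connected, which fails in the lowest
  dimension, where the structures are listed by hand. The square root near \<open>mat 1\<close> is
  used together with its uniqueness in a ball: a root inherits each symmetry of its square that
  preserves the ball, and so becomes symmetric and commutes with \<open>A0\<close>.\<close>

abbreviation Cinf_on :: "'a::euclidean_space set \<Rightarrow> ('a \<Rightarrow> 'b::euclidean_space) \<Rightarrow> bool" where
  "Cinf_on U f \<equiv> \<forall>k. Ck_on k U f"

text \<open>At a point of an open set the derivative depends only on the values in that set, so the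
  equality passes to all iterated derivatives.\<close>

lemma Ck_on_cong:
  assumes "open U" "\<And>x. x \<in> U \<Longrightarrow> f x = g x" "Ck_on k U f"
  shows "Ck_on k U g"
  using assms(2,3)
proof (induction k arbitrary: f g)
  case 0
  then show ?case by (simp cong: continuous_on_cong)
next
  case (Suc k)
  have "(g has_derivative frechet_derivative f (at x)) (at x)" if "x \<in> U" for x
    using has_derivative_transform_within_open[OF _ \<open>open U\<close> that Suc.prems(1)] Suc.prems(2) that
    by (simp add: frechet_derivative_works)
  note der = this
  have "Ck_on k U (\<lambda>x. frechet_derivative g (at x) v)" for v
  proof (rule Suc.IH)
    show "frechet_derivative f (at x) v = frechet_derivative g (at x) v" if "x \<in> U" for x
      using frechet_derivative_at[OF der[OF that]] by simp
  qed (use Suc.prems in simp)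
  moreover have "\<forall>x\<in>U. g differentiable at x"
    using der differentiable_def by blast
  ultimately show ?case by simp
qed

lemma Ck_on_subset: "Ck_on k U f \<Longrightarrow> V \<subseteq> U \<Longrightarrow> Ck_on k V f"
  by (induction k arbitrary: f) (auto intro: continuous_on_subset)

text \<open>\<open>Ck_on\<close> refers to the chosen derivative \<open>frechet_derivative\<close>.
  Derivatives at a point are unique, so any explicit formula may stand in for it; the closure rules
  below enter through this one.\<close>

lemma Ck_on_SucI:
  assumes "open U" "\<And>x. x \<in> U \<Longrightarrow> (f has_derivative f' x) (at x)" "\<And>v. Ck_on k U (\<lambda>x. f' x v)"
  shows "Ck_on (Suc k) U f"
proof -
  have "f' x = frechet_derivative f (at x)" if "x \<in> U" for x
    using assms(2) that frechet_derivative_at by blast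
  then have "Ck_on k U (\<lambda>x. frechet_derivative f (at x) v)" for v
    by (intro Ck_on_cong[OF \<open>open U\<close> _ assms(3)[of v]]) simp
  moreover have "\<forall>x\<in>U. f differentiable at x"
    using assms(2) differentiable_def by blast
  ultimately show ?thesis by simp
qed

lemma Ck_on_SucD: "Ck_on (Suc k) U f \<Longrightarrow> Ck_on k U f"
proof (induction k arbitrary: f)
  case 0
  then show ?case
    by (auto intro!: continuous_at_imp_continuous_on differentiable_imp_continuous_within)
qed auto

lemma Ck_on_imp_continuous_on: "Ck_on k U f \<Longrightarrow> continuous_on U f"
  by (induction k) (auto dest: Ck_on_SucD simp del: Ck_on.simps(2))

lemma Ck_on_has_derivative:
  "Ck_on (Suc k) U f \<Longrightarrow> x \<in> U \<Longrightarrow> (f has_derivative frechet_derivative f (at x)) (at x)"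
  by (simp add: frechet_derivative_works)

lemma Ck_on_const: "Ck_on k U (\<lambda>x. c)"
  by (induction k arbitrary: c) auto

lemma Ck_on_linear:
  assumes "linear h" shows "Ck_on k U h"
proof (cases k)
  case 0
  then show ?thesis using assms by (simp add: linear_continuous_on linear_conv_bounded_linear)
next
  case (Suc j)
  have "(h has_derivative h) (at x)" for x
    using assms by (simp add: bounded_linear_imp_has_derivative linear_conv_bounded_linear)
  then have "frechet_derivative h (at x) = h" for x
    by (metis frechet_derivative_at)
  then show ?thesis using Suc \<open>\<And>x. (h has_derivative h) (at x)\<close>
    by (auto simp: differentiable_def Ck_on_const)
qed

lemma Ck_on_linear_compose:
  assumes "open U" "linear h" "Ck_on k U f"
  shows "Ck_on k U (\<lambda>x. h (f x))"
  using assms(3)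
proof (induction k arbitrary: f)
  case 0
  then have "continuous_on U f" by simp
  then have "continuous_on U (\<lambda>x. h (f x))"
    using assms(2) unfolding linear_conv_bounded_linear by (rule bounded_linear.continuous_on[rotated])
  then show ?case by simp
next
  case (Suc k)
  show ?case
  proof (rule Ck_on_SucI[OF \<open>open U\<close>])
    show "((\<lambda>x. h (f x)) has_derivative (\<lambda>v. h (frechet_derivative f (at x) v))) (at x)"
      if "x \<in> U" for x
      using assms(2) Ck_on_has_derivative[OF Suc.prems that]
      unfolding linear_conv_bounded_linear by (rule bounded_linear.has_derivative)
    show "Ck_on k U (\<lambda>x. h (frechet_derivative f (at x) v))" for v
      using Suc by auto
  qed
qed

lemma Ck_on_add:
  assumes "open U" "Ck_on k U f" "Ck_on k U g"
  shows "Ck_on k U (\<lambda>x. f x + g x)"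
  using assms(2,3)
proof (induction k arbitrary: f g)
  case 0
  then show ?case by (auto intro!: continuous_intros)
next
  case (Suc k)
  show ?case
  proof (rule Ck_on_SucI[OF \<open>open U\<close>])
    show "((\<lambda>x. f x + g x) has_derivative
        (\<lambda>v. frechet_derivative f (at x) v + frechet_derivative g (at x) v)) (at x)"
      if "x \<in> U" for x
      using Ck_on_has_derivative[OF Suc.prems(1) that] Ck_on_has_derivative[OF Suc.prems(2) that]
      by (rule has_derivative_add)
    show "Ck_on k U (\<lambda>x. frechet_derivative f (at x) v + frechet_derivative g (at x) v)" for v
      using Suc by auto
  qed
qed

lemma Ck_on_sum:
  assumes "open U" "\<And>i. i \<in> I \<Longrightarrow> Ck_on k U (f i)"
  shows "Ck_on k U (\<lambda>x. \<Sum>i\<in>I. f i x)"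
  using assms(2)
  by (induction I rule: infinite_finite_induct) (auto simp: Ck_on_const intro!: Ck_on_add \<open>open U\<close>)

lemma Ck_on_bilinear:
  assumes "open U" "bounded_bilinear p" "Ck_on k U f" "Ck_on k U g"
  shows "Ck_on k U (\<lambda>x. p (f x) (g x))"
  using assms(3,4)
proof (induction k arbitrary: f g)
  case 0
  then have "continuous_on U (\<lambda>x. p (f x) (g x))"
    by (auto intro!: bounded_bilinear.continuous_on[OF assms(2), of U f g])
  then show ?case by simp
next
  case (Suc k)
  show ?case
  proof (rule Ck_on_SucI[OF \<open>open U\<close>])
    show "((\<lambda>x. p (f x) (g x)) has_derivative
        (\<lambda>v. p (f x) (frechet_derivative g (at x) v) + p (frechet_derivative f (at x) v) (g x))) (at x)"
      if "x \<in> U" for x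
      using Ck_on_has_derivative[OF Suc.prems(1) that] Ck_on_has_derivative[OF Suc.prems(2) that]
      by (rule bounded_bilinear.FDERIV[OF assms(2)])
    show "Ck_on k U (\<lambda>x. p (f x) (frechet_derivative g (at x) v) + p (frechet_derivative f (at x) v) (g x))" for v
      using Suc.prems Suc.prems[THEN Ck_on_SucD] by (intro Ck_on_add Suc.IH \<open>open U\<close>) auto
  qed
qed

lemmas Ck_on_scaleR = Ck_on_bilinear[OF _ bounded_bilinear_scaleR]

lemma linear_basis_expansion:
  assumes "linear h"
  shows "h z = (\<Sum>b\<in>Basis. (z \<bullet> b) *\<^sub>R h b)"
  by (metis (no_types, lifting) assms euclidean_representation linear_scale linear_sum sum.cong)

text \<open>\<open>Ck_on\<close> differentiates only in fixed directions, while the chain rule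
  evaluates the derivative of \<open>g\<close> in a direction that moves with \<open>x\<close>.
  Expanding this direction in the basis leaves products of functions that are covered by the
  induction hypothesis.\<close>

lemma Ck_on_compose:
  assumes "open U" "open V" "f ` U \<subseteq> V" "Ck_on k U f" "Ck_on k V g"
  shows "Ck_on k U (\<lambda>x. g (f x))"
  using assms(4,5)
proof (induction k arbitrary: g)
  case 0
  then show ?case using assms(3) by (auto intro: continuous_on_compose2)
next
  case (Suc k)
  have lin: "linear (frechet_derivative g (at (f x)))" if "x \<in> U" for x
    using Ck_on_has_derivative[OF Suc.prems(2)] assms(3) that has_derivative_linear by blast
  show ?case
  proof (rule Ck_on_SucI[OF \<open>open U\<close>])
    show "((\<lambda>x. g (f x)) has_derivative
        (\<lambda>v. \<Sum>b\<in>Basis. (frechet_derivative f (at x) v \<bullet> b) *\<^sub>R frechet_derivative g (at (f x)) b)) (at x)"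
      if "x \<in> U" for x
    proof -
      have "f x \<in> V" using that assms(3) by auto
      show ?thesis
        using has_derivative_compose[OF Ck_on_has_derivative[OF Suc.prems(1) that]
            Ck_on_has_derivative[OF Suc.prems(2) \<open>f x \<in> V\<close>]]
        by (simp add: linear_basis_expansion[OF lin[OF that], symmetric])
    qed
    fix v
    have "Ck_on k U (\<lambda>x. frechet_derivative g (at (f x)) b)" for b
      using Suc.IH[OF Ck_on_SucD[OF Suc.prems(1)], of "\<lambda>z. frechet_derivative g (at z) b"] Suc.prems(2)
      by simp
    moreover have "Ck_on k U (\<lambda>x. frechet_derivative f (at x) v \<bullet> b)" for b
      using Suc.prems(1) Ck_on_linear_compose[OF \<open>open U\<close>, of "\<lambda>z. z \<bullet> b"]
      by (auto simp: linear_iff inner_add_left)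
    ultimately show "Ck_on k U (\<lambda>x. \<Sum>b\<in>Basis. (frechet_derivative f (at x) v \<bullet> b) *\<^sub>R frechet_derivative g (at (f x)) b)"
      by (intro Ck_on_sum Ck_on_scaleR \<open>open U\<close>)
  qed
qed

text \<open>A product rule with a factor \<open>c\<close> that is merely continuous: the term
  containing its derivative would be multiplied by \<open>h y = 0\<close>. It serves to
  differentiate a solution whose own differentiability is still to be shown.\<close>

lemma has_derivative_scaleR_null:
  fixes h :: "'a::real_normed_vector \<Rightarrow> 'b::real_normed_vector"
  assumes "isCont c y" "(h has_derivative h') (at y)" "h y = 0"
  shows "((\<lambda>x. c x *\<^sub>R h x) has_derivative (\<lambda>w. c y *\<^sub>R h' w)) (at y)"
proof -
  have bl: "bounded_linear h'" using assms(2) by (rule has_derivative_bounded_linear)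
  then obtain B where B: "\<And>w. norm (h' w) \<le> norm w * B"
    using bounded_linear.bounded by blast
  have 1: "((\<lambda>x. norm (h x - h' (x - y)) / norm (x - y)) \<longlongrightarrow> 0) (at y)"
    using assms(2,3) by (simp add: has_derivative_iff_norm)
  have c: "(c \<longlongrightarrow> c y) (at y)" using assms(1) by (simp add: isCont_def)
  have 2: "((\<lambda>x. \<bar>c x\<bar> * (norm (h x - h' (x - y)) / norm (x - y)) + \<bar>c x - c y\<bar> * B) \<longlongrightarrow> \<bar>c y\<bar> * 0 + \<bar>c y - c y\<bar> * B) (at y)"
    by (intro tendsto_intros 1 c)
  have "((\<lambda>x. norm (c x *\<^sub>R h x - c y *\<^sub>R h' (x - y)) / norm (x - y)) \<longlongrightarrow> 0) (at y)"
  proof (rule Lim_null_comparison[OF _ 2[simplified]], rule always_eventually, rule allI)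
    fix x
    have "c x *\<^sub>R h x - c y *\<^sub>R h' (x - y) = c x *\<^sub>R (h x - h' (x - y)) + (c x - c y) *\<^sub>R h' (x - y)"
      by (simp add: algebra_simps)
    then have "norm (c x *\<^sub>R h x - c y *\<^sub>R h' (x - y)) \<le> \<bar>c x\<bar> * norm (h x - h' (x - y)) + \<bar>c x - c y\<bar> * (norm (x - y) * B)"
      by (metis B norm_scaleR norm_triangle_mono mult_left_mono abs_ge_zero order_refl)
    then show "norm (norm (c x *\<^sub>R h x - c y *\<^sub>R h' (x - y)) / norm (x - y))
      \<le> \<bar>c x\<bar> * norm (h x - h' (x - y)) / norm (x - y) + \<bar>c x - c y\<bar> * B"
      by (cases "x = y") (simp_all add: assms(3) field_simps)
  qed
  then show ?thesis
    unfolding has_derivative_iff_norm assms(3) scaleR_zero_right diff_zero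
    using bounded_linear_compose[OF bounded_linear_scaleR_right bl] by blast
qed

text \<open>The resolvent identity for \<open>K y - K y0\<close> gives continuity first, then
  differentiability with derivative \<open>K\<close> applied to minus the derivative of
  \<open>L\<close> at the solution. This is built from \<open>K\<close> and the derivative of
  \<open>L\<close> again, so the order of smoothness can be raised by induction.\<close>

lemma Ck_on_linear_solve:
  fixes L :: "'y::euclidean_space \<Rightarrow> 'a::euclidean_space \<Rightarrow> 'b::euclidean_space"
  assumes V: "open V" and lin: "\<And>y. y \<in> V \<Longrightarrow> linear (L y)" and L: "\<And>b. Ck_on k V (\<lambda>y. L y b)"
    and LK: "\<And>y v. y \<in> V \<Longrightarrow> L y (K y v) = v" and KL: "\<And>y w. y \<in> V \<Longrightarrow> K y (L y w) = w"
  shows "Ck_on k V (\<lambda>y. K y v)"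
proof -
  have linK: "linear (K y)" if "y \<in> V" for y
  proof (rule linearI)
    show "K y (a + b) = K y a + K y b" for a b
      using KL[OF that, of "K y a + K y b"] LK[OF that] by (simp add: linear_add[OF lin[OF that]])
    show "K y (r *\<^sub>R a) = r *\<^sub>R K y a" for r a
      using KL[OF that, of "r *\<^sub>R K y a"] LK[OF that] by (simp add: linear_scale[OF lin[OF that]])
  qed
  \<comment> \<open>The resolvent identity, with \<open>L y - L y0\<close> expanded on the basis,
    because the hypothesis gives smoothness of \<open>L\<close> only at fixed vectors.\<close>
  have ident: "K y v = K y0 v - K y0 (\<Sum>b\<in>Basis. (K y v \<bullet> b) *\<^sub>R (L y b - L y0 b))"
    if "y \<in> V" "y0 \<in> V" for y y0 v
  proof -
    have "(\<Sum>b\<in>Basis. (K y v \<bullet> b) *\<^sub>R (L y b - L y0 b)) = L y (K y v) - L y0 (K y v)"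
      unfolding linear_basis_expansion[OF lin[OF that(1)], of "K y v"] linear_basis_expansion[OF lin[OF that(2)], of "K y v"]
        scaleR_diff_right sum_subtractf ..
    then show ?thesis using that LK KL
      by (simp add: linear_diff[OF linK])
  qed
  have cont: "isCont (\<lambda>y. K y v) y0" if "y0 \<in> V" for y0 v
  proof -
    obtain C where C: "C > 0" "\<And>w. norm (K y0 w) \<le> C * norm w"
      using linK[OF \<open>y0 \<in> V\<close>] linear_bounded_pos by blast
    define e where "e y = (\<Sum>b\<in>Basis. norm (L y b - L y0 b))" for y
    have "isCont (\<lambda>y. L y b) y0" for b
      using Ck_on_imp_continuous_on[OF L] V that continuous_on_eq_continuous_at by blast
    then have "(e \<longlongrightarrow> (\<Sum>b\<in>(Basis::'a set). norm (L y0 b - L y0 b))) (at y0)"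
      unfolding e_def isCont_def by (intro tendsto_intros) auto
    then have e0: "(e \<longlongrightarrow> 0) (at y0)" by simp
    have main: "norm (K y v - K y0 v) \<le> C * norm (K y v) * e y" if "y \<in> V" for y
    proof -
      define z where "z = (\<Sum>b\<in>Basis. (K y v \<bullet> b) *\<^sub>R (L y b - L y0 b))"
      have "K y v = K y0 v - K y0 z"
        unfolding z_def by (rule ident[OF that \<open>y0 \<in> V\<close>])
      then have "norm (K y v - K y0 v) = norm (K y0 z)"
        by simp
      also have "\<dots> \<le> C * norm z"
        by (rule C)
      also have "\<dots> \<le> C * (\<Sum>b\<in>Basis. norm (K y v) * norm (L y b - L y0 b))"
        unfolding z_def using C
        by (intro mult_left_mono order_trans[OF norm_sum] sum_mono) (auto intro!: mult_right_mono Basis_le_norm)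
      finally show ?thesis by (simp add: e_def sum_distrib_left mult.assoc)
    qed
    \<comment> \<open>With \<open>C * e y\<close> below 1/2 the bound \<open>main\<close> can be
      solved for \<open>norm (K y v)\<close>, which is then at most twice
      \<open>norm (K y0 v)\<close>. Inserted back into \<open>main\<close>, this gives an estimate
      that tends to zero with \<open>e\<close>.\<close>
    have "\<forall>\<^sub>F y in at y0. C * e y < 1/2"
      using tendsto_mult_left[OF e0, of C] order_tendstoD(2)[of _ "C * 0" _ "1/2"] by auto
    moreover have "\<forall>\<^sub>F y in at y0. y \<in> V"
      using V that eventually_at_topological by blast
    ultimately have ev: "\<forall>\<^sub>F y in at y0. norm (K y v - K y0 v) \<le> (C * (2 * norm (K y0 v))) * e y"
    proof eventually_elim
      case (elim y)
      have e: "0 \<le> e y" by (simp add: e_def sum_nonneg)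
      have "norm (K y v - K y0 v) \<le> (C * e y) * norm (K y v)"
        using main[OF elim(2)] by (simp add: mult_ac)
      also have "\<dots> \<le> 1/2 * norm (K y v)"
        using elim(1) by (intro mult_right_mono) auto
      finally have "norm (K y v) \<le> 2 * norm (K y0 v)"
        using norm_triangle_ineq2[of "K y v" "K y0 v"] by simp
      then show ?case
        using main[OF elim(2)] C(1) e
        by (meson mult_left_mono mult_right_mono order_trans less_imp_le)
    qed
    have "((\<lambda>y. (C * (2 * norm (K y0 v))) * e y) \<longlongrightarrow> 0) (at y0)"
      using tendsto_mult_left[OF e0] by fastforce
    then have "((\<lambda>y. K y v - K y0 v) \<longlongrightarrow> 0) (at y0)"
      using ev by (rule Lim_null_comparison[rotated])
    then show ?thesis by (simp add: isCont_def LIM_zero_iff)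
  qed
  show ?thesis
    using L
  proof (induction k arbitrary: v)
    case 0
    then show ?case using cont by (auto intro!: continuous_at_imp_continuous_on)
  next
    case (Suc k)
    define DL where "DL b y = frechet_derivative (\<lambda>y. L y b) (at y)" for b y
    have DL: "((\<lambda>y. L y b) has_derivative DL b y) (at y)" if "y \<in> V" for y b
      unfolding DL_def using Ck_on_has_derivative[OF Suc.prems that] .
    have IH: "Ck_on k V (\<lambda>y. K y w)" for w
      by (rule Suc.IH) (rule Ck_on_SucD[OF Suc.prems])
    show ?case
    proof (rule Ck_on_SucI[OF V])
      fix y0 assume y0: "y0 \<in> V"
      \<comment> \<open>The second factor vanishes at \<open>y0\<close>, so continuity of the
        solution suffices here.\<close>
      have "((\<lambda>y. (K y v \<bullet> b) *\<^sub>R (L y b - L y0 b)) has_derivative (\<lambda>w. (K y0 v \<bullet> b) *\<^sub>R DL b y0 w)) (at y0)" for b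
        using cont[OF y0, of v] DL[OF y0, of b]
        by (intro has_derivative_scaleR_null continuous_intros) (auto intro!: derivative_eq_intros)
      then have "((\<lambda>y. \<Sum>b\<in>Basis. (K y v \<bullet> b) *\<^sub>R (L y b - L y0 b)) has_derivative
             (\<lambda>w. \<Sum>b\<in>Basis. (K y0 v \<bullet> b) *\<^sub>R DL b y0 w)) (at y0)"
        by (intro has_derivative_sum) auto
      then have "((\<lambda>y. K y0 v - K y0 (\<Sum>b\<in>Basis. (K y v \<bullet> b) *\<^sub>R (L y b - L y0 b))) has_derivative
             (\<lambda>w. 0 - K y0 (\<Sum>b\<in>Basis. (K y0 v \<bullet> b) *\<^sub>R DL b y0 w))) (at y0)"
        using linK[OF y0]
        unfolding linear_conv_bounded_linear
        by (intro has_derivative_diff has_derivative_const bounded_linear.has_derivative[of "K y0"])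
      then have "((\<lambda>y. K y v) has_derivative
             (\<lambda>w. 0 - K y0 (\<Sum>b\<in>Basis. (K y0 v \<bullet> b) *\<^sub>R DL b y0 w))) (at y0)"
        by (rule has_derivative_transform_within_open[OF _ V y0]) (rule ident[OF _ y0, symmetric])
      note D = this
      \<comment> \<open>The derivative applies \<open>K y0\<close> to a vector depending on
        \<open>y0\<close>; a second basis expansion brings it back to values of \<open>K\<close> at
        fixed vectors, as the induction hypothesis requires.\<close>
      have E: "0 - K y0 (\<Sum>b\<in>Basis. (K y0 v \<bullet> b) *\<^sub>R DL b y0 w) =
         (\<Sum>c\<in>Basis. ((- (\<Sum>b\<in>Basis. (K y0 v \<bullet> b) *\<^sub>R DL b y0 w)) \<bullet> c) *\<^sub>R K y0 c)" for w
        using linear_basis_expansion[OF linK[OF y0]] linear_neg[OF linK[OF y0]] by (metis diff_0)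
      show "((\<lambda>y. K y v) has_derivative
         (\<lambda>w. \<Sum>c\<in>Basis. ((- (\<Sum>b\<in>Basis. (K y0 v \<bullet> b) *\<^sub>R DL b y0 w)) \<bullet> c) *\<^sub>R K y0 c)) (at y0)"
        by (rule has_derivative_eq_rhs[OF D]) (rule ext, rule E)
    next
      fix w
      have "Ck_on k V (\<lambda>y. DL b y w)" for b
        using Suc.prems by (simp add: DL_def)
      moreover have "linear (\<lambda>x. x \<bullet> b)" for b :: 'a
        by (simp add: linear_iff inner_add_left)
      ultimately have S: "Ck_on k V (\<lambda>y. \<Sum>b\<in>Basis. (K y v \<bullet> b) *\<^sub>R DL b y w)"
        by (intro Ck_on_sum Ck_on_scaleR Ck_on_linear_compose[where h = "\<lambda>x. x \<bullet> _"] IH V)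
      have "linear (\<lambda>x. (- x) \<bullet> c)" for c :: 'b
        by (simp add: linear_iff inner_add_left)
      from Ck_on_linear_compose[OF V this S]
      show "Ck_on k V (\<lambda>y. \<Sum>c\<in>Basis. ((- (\<Sum>b\<in>Basis. (K y v \<bullet> b) *\<^sub>R DL b y w)) \<bullet> c) *\<^sub>R K y c)"
        by (intro Ck_on_sum Ck_on_scaleR IH V)
    qed
  qed
qed

section \<open>Smoothness of matrix operations and the inverse function theorem\<close>

lemma bounded_bilinear_matrix_mult:
  "bounded_bilinear ((**) :: real^'n^'m \<Rightarrow> real^'p^'n \<Rightarrow> real^'p^'m)"
proof -
  have "bilinear ((**) :: real^'n^'m \<Rightarrow> real^'p^'n \<Rightarrow> real^'p^'m)"
    by (simp add: bilinear_def linear_iff vec_eq_iff matrix_matrix_mult_def algebra_simps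
        sum.distrib sum_distrib_left)
  then show ?thesis by (simp add: bilinear_conv_bounded_bilinear)
qed

lemma linear_matrix_mult_right: "linear (\<lambda>X. A ** X)" for A :: "real^'n^'m"
  using bounded_bilinear.bounded_linear_right[OF bounded_bilinear_matrix_mult]
  by (simp add: linear_conv_bounded_linear)

lemma linear_matrix_mult_left: "linear (\<lambda>X. X ** A)" for A :: "real^'n^'m"
  using bounded_bilinear.bounded_linear_left[OF bounded_bilinear_matrix_mult]
  by (simp add: linear_conv_bounded_linear)

lemma linear_transpose: "linear (transpose :: real^'n^'m \<Rightarrow> real^'m^'n)"
  by (simp add: linear_iff transpose_def vec_eq_iff)

lemma matrix_inv_right: "invertible A \<Longrightarrow> A ** matrix_inv A = mat 1"
  and matrix_inv_left: "invertible A \<Longrightarrow> matrix_inv A ** A = mat 1" for A :: "real^'n^'n"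
  unfolding invertible_def matrix_inv_def by (metis (mono_tags, lifting) someI_ex)+

lemma matrix_inv_unique:
  fixes A :: "real^'n^'n"
  assumes "A ** B = mat 1" shows "invertible A" "matrix_inv A = B"
proof -
  show i: "invertible A" using assms matrix_left_right_inverse by (auto simp: invertible_def)
  show "matrix_inv A = B"
    by (metis assms i matrix_inv_left matrix_mul_assoc matrix_mul_lid matrix_mul_rid)
qed

lemma continuous_on_det: "continuous_on S (det :: real^'n^'n \<Rightarrow> real)"
  unfolding det_def by (intro continuous_intros)

lemma open_invertible: "open {A :: real^'n^'n. invertible A}"
proof -
  have "{A :: real^'n^'n. invertible A} = det -` (- {0})"
    by (auto simp: invertible_det_nz)
  moreover have "open (det -` (- {0}) :: (real^'n^'n) set)"
    by (intro open_vimage continuous_on_det) auto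
  ultimately show ?thesis by simp
qed

text \<open>The inverse solves the equation \<open>A ** X = mat 1\<close>, which is linear in
  \<open>X\<close> with coefficients linear in \<open>A\<close>; this is an instance of
  \<open>Ck_on_linear_solve\<close>.\<close>

lemma Cinf_on_matrix_inv: "Cinf_on {A :: real^'n^'n. invertible A} matrix_inv"
proof
  fix k
  have "Ck_on k {A :: real^'n^'n. invertible A} (\<lambda>A. matrix_inv A ** mat 1)"
  proof (rule Ck_on_linear_solve[where L = "\<lambda>A X. A ** X" and K = "\<lambda>A X. matrix_inv A ** X", OF open_invertible])
    show "linear ((**) y)" for y :: "real^'n^'n" by (rule linear_matrix_mult_right)
    show "Ck_on k {A. invertible A} (\<lambda>y::real^'n^'n. y ** b)" for b :: "real^'n^'n"
      by (rule Ck_on_linear[OF linear_matrix_mult_left])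
  qed (auto simp: matrix_mul_assoc matrix_inv_right matrix_inv_left)
  then show "Ck_on k {A :: real^'n^'n. invertible A} matrix_inv" by simp
qed

lemma Cinf_on_differentiable:
  assumes "Cinf_on U f" "x \<in> U"
  shows "(f has_derivative frechet_derivative f (at x)) (at x)"
  using assms Ck_on_has_derivative by blast

text \<open>The inverse function theorem yields a differentiable \<open>g\<close>. Its derivative
  solves a linear equation whose coefficients are the derivative of \<open>f\<close> at
  \<open>g y\<close>; if \<open>g\<close> is of class k, so are these, and
  \<open>Ck_on_linear_solve\<close> gives class k + 1.\<close>

lemma Cinf_local_inverse:
  fixes f :: "'a::euclidean_space \<Rightarrow> 'a"
  assumes S: "open S" "Cinf_on S f" "x0 \<in> S" and D: "(f has_derivative D) (at x0)" "inj D"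
  obtains U V g where "open U" "U \<subseteq> S" "x0 \<in> U" "open V" "homeomorphism U V f g" "Cinf_on V g"
proof -
  define f' where "f' x = Blinfun (frechet_derivative f (at x))" for x
  have der: "(f has_derivative frechet_derivative f (at x)) (at x)" if "x \<in> S" for x
    using Cinf_on_differentiable[OF S(2) that] .
  have f'[simp]: "blinfun_apply (f' x) = frechet_derivative f (at x)" if "x \<in> S" for x
    using has_derivative_bounded_linear[OF der[OF that]] unfolding f'_def
    by (rule bounded_linear_Blinfun_apply)
  have DC: "Cinf_on S (\<lambda>x. frechet_derivative f (at x) v)" for v
  proof
    fix k from S(2) have "Ck_on (Suc k) S f" by blast
    then show "Ck_on k S (\<lambda>x. frechet_derivative f (at x) v)" by simp
  qed
  have contf: "continuous_on S f'"
  proof (rule continuous_on_blinfun_componentwise)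
    fix i :: 'a
    have "continuous_on S (\<lambda>x. frechet_derivative f (at x) i)"
      using DC Ck_on_imp_continuous_on by blast
    then show "continuous_on S (\<lambda>x. blinfun_apply (f' x) i)"
      by (simp cong: continuous_on_cong)
  qed
  have "linear D" using D(1) has_derivative_linear by blast
  then obtain E where E: "linear E" "E \<circ> D = id"
    using linear_injective_left_inverse D(2) by blast
  have "D = frechet_derivative f (at x0)" using D(1) frechet_derivative_at by blast
  then have inv: "Blinfun E o\<^sub>L f' x0 = id_blinfun"
    using E S(3) by (intro blinfun_eqI)
      (simp add: bounded_linear_Blinfun_apply linear_conv_bounded_linear pointfree_idE)
  obtain U V g g' where UV: "open U" "U \<subseteq> S" "x0 \<in> U" "open V" "f x0 \<in> V" and hom: "homeomorphism U V f g"
    and g: "\<And>y. y \<in> V \<Longrightarrow> (g has_derivative (g' y)) (at y)"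
    "\<And>y. y \<in> V \<Longrightarrow> g' y = inv (blinfun_apply (f'(g y)))"
    "\<And>y. y \<in> V \<Longrightarrow> bij (blinfun_apply (f'(g y)))"
    using inverse_function_theorem[OF S(1) _ contf S(3) inv] der f' by metis
  have gV: "g ` V \<subseteq> S" using hom UV(2) by (auto simp: homeomorphism_def)
  have "Ck_on k V g" for k
  proof (induction k)
    case 0
    then show ?case using hom by (simp add: homeomorphism_def)
  next
    case (Suc k)
    show ?case
    proof (rule Ck_on_SucI[OF UV(4) g(1)])
      fix v
      show "Ck_on k V (\<lambda>y. g' y v)"
      proof (rule Ck_on_linear_solve[where L = "\<lambda>y. frechet_derivative f (at (g y))", OF UV(4)])
        fix y assume y: "y \<in> V"
        then have gy: "g y \<in> S" using gV by auto
        have b: "bij (frechet_derivative f (at (g y)))" "g' y = inv (frechet_derivative f (at (g y)))"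
          using g(2,3)[OF y] gy by auto
        show "linear (frechet_derivative f (at (g y)))" using der gy has_derivative_linear by blast
        show "frechet_derivative f (at (g y)) (g' y w) = w" for w
          using b by (simp add: bij_is_surj surj_f_inv_f)
        show "g' y (frechet_derivative f (at (g y)) w) = w" for w
          using b by (simp add: bij_is_inj inv_f_f)
      next
        show "Ck_on k V (\<lambda>y. frechet_derivative f (at (g y)) b)" for b
          using Ck_on_compose[OF UV(4) S(1) gV Suc.IH, of "\<lambda>x. frechet_derivative f (at x) b"] DC by blast
      qed
    qed
  qed
  then show ?thesis using that[OF UV(1-4) hom] by blast
qed

lemma Cinf_imp_smooth_on: "open U \<Longrightarrow> Cinf_on U f \<Longrightarrow> X \<subseteq> U \<Longrightarrow> smooth_on X f"
  unfolding smooth_on_def by blast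

section \<open>Smoothness on arbitrary subsets\<close>

lemma smooth_onE:
  assumes "smooth_on X f" "x \<in> X"
  obtains U g where "open U" "x \<in> U" "Cinf_on U g" "\<And>y. y \<in> X \<Longrightarrow> y \<in> U \<Longrightarrow> g y = f y"
  using assms unfolding smooth_on_def by (metis Int_iff)

lemma smooth_on_cong:
  assumes "smooth_on X f" "\<And>x. x \<in> X \<Longrightarrow> f x = g x"
  shows "smooth_on X g"
  using assms(1) unfolding smooth_on_def by (simp add: assms(2))

lemma smooth_on_subset:
  assumes "smooth_on X f" "Y \<subseteq> X" shows "smooth_on Y f"
  unfolding smooth_on_def
proof
  fix x assume "x \<in> Y"
  then obtain U g where "open U" "x \<in> U" "Cinf_on U g" "\<And>y. y \<in> X \<Longrightarrow> y \<in> U \<Longrightarrow> g y = f y"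
    using smooth_onE[OF assms(1), of x] assms(2) by (metis subsetD)
  then show "\<exists>U g. open U \<and> x \<in> U \<and> Cinf_on U g \<and> (\<forall>y\<in>Y \<inter> U. g y = f y)"
    using assms(2) by (intro exI[of _ U] exI[of _ g]) auto
qed

lemma smooth_on_local:
  assumes "\<And>x. x \<in> X \<Longrightarrow> \<exists>W. open W \<and> x \<in> W \<and> smooth_on (X \<inter> W) f"
  shows "smooth_on X f"
  unfolding smooth_on_def
proof
  fix x assume x: "x \<in> X"
  then obtain W where W: "open W" "x \<in> W" "smooth_on (X \<inter> W) f" using assms by blast
  then obtain U g where U: "open U" "x \<in> U" "Cinf_on U g" "\<And>y. y \<in> X \<inter> W \<Longrightarrow> y \<in> U \<Longrightarrow> g y = f y"
    using smooth_onE[OF W(3), of x] x by (metis IntI)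
  then show "\<exists>U g. open U \<and> x \<in> U \<and> Cinf_on U g \<and> (\<forall>y\<in>X \<inter> U. g y = f y)"
    using W by (intro exI[of _ "U \<inter> W"] exI[of _ g]) (auto intro: Ck_on_subset)
qed

lemma smooth_on_imp_continuous_on:
  assumes "smooth_on X f" shows "continuous_on X f"
  unfolding continuous_on_eq_continuous_within
proof
  fix x assume x: "x \<in> X"
  obtain U g where U: "open U" "x \<in> U" "Cinf_on U g" and eq: "\<And>y. y \<in> X \<Longrightarrow> y \<in> U \<Longrightarrow> g y = f y"
    using smooth_onE[OF assms x] by metis
  have "isCont g x"
    using Ck_on_imp_continuous_on U continuous_on_eq_continuous_at by blast
  then have "continuous (at x within X) g" using continuous_at_imp_continuous_within by blast
  moreover obtain d where "0 < d" "ball x d \<subseteq> U" using U(1,2) openE by blast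
  ultimately show "continuous (at x within X) f"
    using eq x by (intro continuous_transform_within[of x X g d f]) (auto simp: dist_commute subset_iff)
qed

lemma smooth_on_has_derivative:
  assumes "smooth_on X f" "x \<in> X"
  obtains D where "(f has_derivative D) (at x within X)"
proof -
  obtain U g where U: "open U" "x \<in> U" "Cinf_on U g" and eq: "\<And>y. y \<in> X \<Longrightarrow> y \<in> U \<Longrightarrow> g y = f y"
    using smooth_onE[OF assms] by metis
  have "(g has_derivative frechet_derivative g (at x)) (at x within X)"
    using Cinf_on_differentiable[OF U(3,2)] has_derivative_at_withinI by blast
  moreover obtain d where "0 < d" "ball x d \<subseteq> U" using U(1,2) openE by blast
  ultimately have "(f has_derivative frechet_derivative g (at x)) (at x within X)"
    using eq assms(2) by (intro has_derivative_transform_within[of g _ x X d f]) (auto simp: dist_commute subset_iff)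
  then show ?thesis using that by blast
qed

lemma smooth_on_compose:
  assumes "smooth_on X f" "smooth_on Y g" "f ` X \<subseteq> Y"
  shows "smooth_on X (\<lambda>x. g (f x))"
  unfolding smooth_on_def
proof
  fix x assume x: "x \<in> X"
  obtain U f' where U: "open U" "x \<in> U" "Cinf_on U f'" "\<And>y. y \<in> X \<Longrightarrow> y \<in> U \<Longrightarrow> f' y = f y"
    using smooth_onE[OF assms(1) x] by metis
  obtain V g' where V: "open V" "f x \<in> V" "Cinf_on V g'" "\<And>y. y \<in> Y \<Longrightarrow> y \<in> V \<Longrightarrow> g' y = g y"
    using smooth_onE[OF assms(2), of "f x"] assms(3) x by (metis image_subset_iff)
  define W where "W = U \<inter> f' -` V"
  have "continuous_on U f'" using U(3) Ck_on_imp_continuous_on by blast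
  then have W: "open W" using U(1) V(1) by (simp add: W_def continuous_on_open_vimage Int_commute)
  have "Cinf_on W (\<lambda>x. g' (f' x))"
  proof
    fix k show "Ck_on k W (\<lambda>x. g' (f' x))"
    proof (rule Ck_on_compose[OF W V(1)])
      show "Ck_on k W f'" using U(3) Ck_on_subset[of k U f' W] by (auto simp: W_def)
    qed (use V in \<open>auto simp: W_def\<close>)
  qed
  then show "\<exists>U h. open U \<and> x \<in> U \<and> Cinf_on U h \<and> (\<forall>y\<in>X \<inter> U. h y = g (f y))"
    using W U V x assms(3) by (intro exI[of _ W] exI[of _ "\<lambda>x. g' (f' x)"]) (auto simp: W_def image_subset_iff)
qed

lemma smooth_on_linear: "linear h \<Longrightarrow> smooth_on X h"
  by (rule Cinf_imp_smooth_on[of UNIV]) (auto intro: Ck_on_linear)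

lemma smooth_on_id: "smooth_on X (\<lambda>x. x)"
  using smooth_on_linear[of "\<lambda>x. x" X] by (simp add: linear_iff)

lemma smooth_on_const: "smooth_on X (\<lambda>x. c)"
  by (rule Cinf_imp_smooth_on[of UNIV]) (auto intro: Ck_on_const)

lemma smooth_on_bilinear:
  assumes "bounded_bilinear p" "smooth_on X f" "smooth_on X g"
  shows "smooth_on X (\<lambda>x. p (f x) (g x))"
  unfolding smooth_on_def
proof
  fix x assume x: "x \<in> X"
  obtain U f' where U: "open U" "x \<in> U" "Cinf_on U f'" "\<And>y. y \<in> X \<Longrightarrow> y \<in> U \<Longrightarrow> f' y = f y"
    using smooth_onE[OF assms(2) x] by metis
  obtain V g' where V: "open V" "x \<in> V" "Cinf_on V g'" "\<And>y. y \<in> X \<Longrightarrow> y \<in> V \<Longrightarrow> g' y = g y"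
    using smooth_onE[OF assms(3) x] by metis
  have "Cinf_on (U \<inter> V) (\<lambda>x. p (f' x) (g' x))"
  proof
    fix k
    have "Ck_on k (U \<inter> V) f'" "Ck_on k (U \<inter> V) g'"
      using U(3) V(3) Ck_on_subset by (metis Int_lower1, metis Int_lower2)
    then show "Ck_on k (U \<inter> V) (\<lambda>x. p (f' x) (g' x))"
      by (rule Ck_on_bilinear[OF open_Int[OF U(1) V(1)] assms(1)])
  qed
  then show "\<exists>U h. open U \<and> x \<in> U \<and> Cinf_on U h \<and> (\<forall>y\<in>X \<inter> U. h y = p (f y) (g y))"
    using U V by (intro exI[of _ "U \<inter> V"] exI[of _ "\<lambda>x. p (f' x) (g' x)"]) auto
qed

lemma smooth_on_add:
  assumes "smooth_on X f" "smooth_on X g"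
  shows "smooth_on X (\<lambda>x. f x + g x)"
  unfolding smooth_on_def
proof
  fix x assume x: "x \<in> X"
  obtain U f' where U: "open U" "x \<in> U" "Cinf_on U f'" "\<And>y. y \<in> X \<Longrightarrow> y \<in> U \<Longrightarrow> f' y = f y"
    using smooth_onE[OF assms(1) x] by metis
  obtain V g' where V: "open V" "x \<in> V" "Cinf_on V g'" "\<And>y. y \<in> X \<Longrightarrow> y \<in> V \<Longrightarrow> g' y = g y"
    using smooth_onE[OF assms(2) x] by metis
  have "Cinf_on (U \<inter> V) (\<lambda>x. f' x + g' x)"
  proof
    fix k
    have "Ck_on k (U \<inter> V) f'" "Ck_on k (U \<inter> V) g'"
      using U(3) V(3) Ck_on_subset by (metis Int_lower1, metis Int_lower2)
    then show "Ck_on k (U \<inter> V) (\<lambda>x. f' x + g' x)"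
      by (rule Ck_on_add[OF open_Int[OF U(1) V(1)]])
  qed
  then show "\<exists>U h. open U \<and> x \<in> U \<and> Cinf_on U h \<and> (\<forall>y\<in>X \<inter> U. h y = f y + g y)"
    using U V by (intro exI[of _ "U \<inter> V"] exI[of _ "\<lambda>x. f' x + g' x"]) auto
qed

lemma smooth_on_linear_compose:
  assumes "linear h" "smooth_on X f" shows "smooth_on X (\<lambda>x. h (f x))"
  by (rule smooth_on_compose[OF assms(2) smooth_on_linear[OF assms(1), of UNIV]]) simp

lemma smooth_on_minus: "smooth_on X f \<Longrightarrow> smooth_on X (\<lambda>x. - f x)"
  using smooth_on_linear_compose[of uminus] by (simp add: linear_iff)

lemma smooth_on_diff: "smooth_on X f \<Longrightarrow> smooth_on X g \<Longrightarrow> smooth_on X (\<lambda>x. f x - g x)"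
  using smooth_on_add[OF _ smooth_on_minus] by fastforce

lemma smooth_on_scaleR_const: "smooth_on X f \<Longrightarrow> smooth_on X (\<lambda>x. c *\<^sub>R f x)"
  using smooth_on_linear_compose[of "\<lambda>x. c *\<^sub>R x"] by (simp add: linear_iff algebra_simps)

lemmas smooth_on_matrix_mult = smooth_on_bilinear[OF bounded_bilinear_matrix_mult]

lemma smooth_on_transpose: "smooth_on X f \<Longrightarrow> smooth_on X (\<lambda>x. transpose (f x) :: real^'n^'m)"
  by (rule smooth_on_linear_compose[OF linear_transpose])

lemma smooth_on_matrix_inv:
  assumes "smooth_on X f" "\<And>x. x \<in> X \<Longrightarrow> invertible (f x)"
  shows "smooth_on X (\<lambda>x. matrix_inv (f x :: real^'n^'n))"
  by (rule smooth_on_compose[OF assms(1) Cinf_imp_smooth_on[OF open_invertible Cinf_on_matrix_inv order_refl]])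
    (use assms(2) in auto)

lemmas smooth_on_intros = smooth_on_id smooth_on_const smooth_on_add smooth_on_diff smooth_on_minus
  smooth_on_scaleR_const smooth_on_matrix_mult smooth_on_transpose smooth_on_matrix_inv

text \<open>\<open>D s\<close> is the limit of difference quotients along
  \<open>x + h *\<^sub>R s\<close>, which stays in \<open>X\<close> for small \<open>h\<close>; the
  quotients lie in \<open>T\<close>, and subspaces are closed. Applied to a difference of maps with
  \<open>T = {0}\<close>, this is the uniqueness, on \<open>S\<close>, of derivatives within a
  relatively open set.\<close>

lemma derivative_into_subspace:
  fixes f :: "'a::euclidean_space \<Rightarrow> 'b::euclidean_space"
  assumes D: "(f has_derivative D) (at x within X)" and X: "openin (top_of_set S) X" "subspace S" "x \<in> X"
    and T: "f ` X \<subseteq> T" "subspace T" and s: "s \<in> S"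
  shows "D s \<in> T"
proof -
  obtain W where W: "open W" "X = S \<inter> W" using X(1) by (auto simp: openin_open)
  define H where "H = (\<lambda>h::real. x + h *\<^sub>R s) -` W"
  have H: "open H" "0 \<in> H"
    using W X(3) by (auto simp: H_def intro!: open_vimage continuous_intros)
  have HX: "x + h *\<^sub>R s \<in> X" if "h \<in> H" for h
    using that W X s by (auto simp: H_def intro: subspace_add subspace_scale)
  have 1: "((\<lambda>h. x + h *\<^sub>R s) has_derivative (\<lambda>h. h *\<^sub>R s)) (at 0 within H)"
    by (auto intro!: derivative_eq_intros)
  have "((\<lambda>h. f (x + h *\<^sub>R s)) has_derivative (\<lambda>h. D (h *\<^sub>R s))) (at 0 within H)"
  proof (rule has_derivative_in_compose[OF 1])
    have "(\<lambda>h. x + h *\<^sub>R s) ` H \<subseteq> X" using HX by blast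
    from has_derivative_subset[OF D this]
    show "(f has_derivative D) (at (x + 0 *\<^sub>R s) within (\<lambda>h. x + h *\<^sub>R s) ` H)"
      by simp
  qed
  then have "((\<lambda>h. norm (f (x + h *\<^sub>R s) - f x - D (h *\<^sub>R s)) / norm h) \<longlongrightarrow> 0) (at 0 within H)"
    by (simp add: has_derivative_iff_norm)
  then have L: "((\<lambda>h. norm (f (x + h *\<^sub>R s) - f x - D (h *\<^sub>R s)) / norm h) \<longlongrightarrow> 0) (at 0)"
    unfolding at_within_open[OF H(2,1)] .
  have lin: "linear D" using D has_derivative_linear by blast
  have ev: "\<forall>\<^sub>F h in at 0. norm (f (x + h *\<^sub>R s) - f x - D (h *\<^sub>R s)) / norm h
         = norm ((f (x + h *\<^sub>R s) - f x) /\<^sub>R h - D s)"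
    unfolding eventually_at_filter
  proof (rule always_eventually, intro allI impI)
    fix h :: real assume h: "h \<noteq> 0"
    have "(f (x + h *\<^sub>R s) - f x) /\<^sub>R h - D s = (f (x + h *\<^sub>R s) - f x - D (h *\<^sub>R s)) /\<^sub>R h"
      using h by (simp add: linear_scale[OF lin] scaleR_diff_right)
    then show "norm (f (x + h *\<^sub>R s) - f x - D (h *\<^sub>R s)) / norm h = norm ((f (x + h *\<^sub>R s) - f x) /\<^sub>R h - D s)"
      by (simp add: divide_inverse_commute)
  qed
  have lim: "((\<lambda>h. (f (x + h *\<^sub>R s) - f x) /\<^sub>R h) \<longlongrightarrow> D s) (at 0)"
    using L tendsto_cong[OF ev, of 0] tendsto_norm_zero_iff LIM_zero_iff by metis
  have "\<forall>\<^sub>F h in at 0. (f (x + h *\<^sub>R s) - f x) /\<^sub>R h \<in> T"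
  proof -
    have "\<forall>\<^sub>F h in at 0. h \<in> H" using H eventually_at_topological by blast
    then show ?thesis
    proof eventually_elim
      case (elim h)
      then show ?case using HX T X(3) by (auto intro!: subspace_scale subspace_diff)
    qed
  qed
  from Lim_in_closed_set[OF closed_subspace[OF T(2)] this at_neq_bot lim] show ?thesis .
qed

section \<open>Charts of subsets of Euclidean space\<close>

abbreviation chart_of :: "'a::euclidean_space set \<Rightarrow> 'a set \<Rightarrow> 'a set \<Rightarrow> ('a \<Rightarrow> 'a) \<Rightarrow> bool" where
  "chart_of M U S \<phi> \<equiv> (U, S, \<phi>) \<in> charts (submanifold_structure M)"

lemma chart_of_iff: "chart_of M U S \<phi> \<longleftrightarrow>
    U \<noteq> {} \<and> openin (top_of_set M) U \<and> subspace S \<and> openin (top_of_set S) (\<phi> ` U) \<and>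
    inj_on \<phi> U \<and> smooth_on U \<phi> \<and> smooth_on (\<phi> ` U) (inv_into U \<phi>)"
  by (simp add: submanifold_structure_def)

lemma mtop_submanifold_structure: "mtop (submanifold_structure M) = top_of_set M"
  by (simp add: submanifold_structure_def)

lemma chart_of_homeomorphism:
  assumes "chart_of M U S \<phi>" shows "homeomorphism U (\<phi> ` U) \<phi> (inv_into U \<phi>)"
  using assms smooth_on_imp_continuous_on unfolding chart_of_iff homeomorphism_def
  by (auto simp: inv_into_f_f f_inv_into_f inj_on_def image_iff)

lemma chart_of_restrict:
  assumes c: "chart_of M U S \<phi>" and N: "openin (top_of_set M) N" and ne: "U \<inter> N \<noteq> {}"
  shows "chart_of N (U \<inter> N) S \<phi>"
proof -
  have U: "openin (top_of_set M) U" "inj_on \<phi> U" "openin (top_of_set S) (\<phi> ` U)" "subspace S"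
    "smooth_on U \<phi>" "smooth_on (\<phi> ` U) (inv_into U \<phi>)"
    using c by (auto simp: chart_of_iff)
  have NM: "N \<subseteq> M" using N openin_imp_subset by blast
  have 1: "openin (top_of_set M) (U \<inter> N)" using U(1) N by blast
  have "openin (top_of_set U) (U \<inter> N)"
    using openin_subset_trans[OF 1, of U] U(1) openin_imp_subset by (metis inf_le1)
  then have "openin (top_of_set (\<phi> ` U)) (\<phi> ` (U \<inter> N))"
    using homeomorphism_imp_open_map chart_of_homeomorphism[OF c] by blast
  then have 2: "openin (top_of_set S) (\<phi> ` (U \<inter> N))" using U(3) openin_trans by blast
  have inj: "inj_on \<phi> (U \<inter> N)" using U(2) by (meson inf_le1 inj_on_subset)
  have "smooth_on (\<phi> ` (U \<inter> N)) (inv_into U \<phi>)"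
    by (rule smooth_on_subset[OF U(6)]) auto
  then have "smooth_on (\<phi> ` (U \<inter> N)) (inv_into (U \<inter> N) \<phi>)"
  proof (rule smooth_on_cong)
    fix z assume "z \<in> \<phi> ` (U \<inter> N)"
    then obtain x where "x \<in> U \<inter> N" "z = \<phi> x" by blast
    then show "inv_into U \<phi> z = inv_into (U \<inter> N) \<phi> z"
      using U(2) inj by (simp add: inv_into_f_f)
  qed
  moreover have "openin (top_of_set N) (U \<inter> N)"
    using openin_subset_trans[OF 1 _ NM] by simp
  moreover have "smooth_on (U \<inter> N) \<phi>" by (rule smooth_on_subset[OF U(5)]) auto
  ultimately show ?thesis
    using ne 2 inj U(4) by (simp add: chart_of_iff)
qed

lemma chart_of_open_subset:
  assumes "chart_of N U S \<phi>" "openin (top_of_set M) N" shows "chart_of M U S \<phi>"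
  using assms openin_trans unfolding chart_of_iff by blast

lemma chart_of_restrict':
  assumes "chart_of M U S \<phi>" "openin (top_of_set M) N" "U \<inter> N \<noteq> {}"
  shows "chart_of M (U \<inter> N) S \<phi>"
  by (rule chart_of_open_subset[OF chart_of_restrict[OF assms] assms(2)])

text \<open>The coordinate change is a continuous injection of a nonempty open subset of
  \<open>S\<close> into \<open>T\<close>, so this is invariance of dimension.\<close>

lemma chart_dim_le:
  assumes c: "chart_of M U S \<phi>" and d: "chart_of M V T \<psi>" and p: "p \<in> U" "p \<in> V"
  shows "dim S \<le> dim T"
proof -
  have "openin (top_of_set M) V" using d by (simp add: chart_of_iff)
  then have c': "chart_of M (U \<inter> V) S \<phi>" using chart_of_restrict'[OF c] p by blast
  note h = chart_of_homeomorphism[OF c'] and h2 = chart_of_homeomorphism[OF d]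
  let ?g = "inv_into (U \<inter> V) \<phi>" and ?W = "\<phi> ` (U \<inter> V)"
  have gW: "?g ` ?W = U \<inter> V" using h by (simp add: homeomorphism_def)
  show ?thesis
  proof (rule invariance_of_dimension_subspaces[where f = "\<psi> \<circ> ?g"])
    show "openin (top_of_set S) ?W" "subspace S" using c' by (simp_all add: chart_of_iff)
    show "subspace T" using d by (simp add: chart_of_iff)
    show "continuous_on ?W (\<psi> \<circ> ?g)"
    proof (rule continuous_on_compose)
      show "continuous_on ?W ?g" using h by (simp add: homeomorphism_def)
      have "continuous_on V \<psi>" using h2 by (simp add: homeomorphism_def)
      then show "continuous_on (?g ` ?W) \<psi>" unfolding gW by (rule continuous_on_subset) simp
    qed
    show "\<psi> \<circ> ?g \<in> ?W \<rightarrow> T"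
    proof -
      have "\<psi> ` V \<subseteq> T" using d openin_imp_subset unfolding chart_of_iff by blast
      moreover have "?g z \<in> V" if "z \<in> ?W" for z using gW that by blast
      ultimately show ?thesis by (metis Pi_I comp_apply image_subset_iff)
    qed
    show "inj_on (\<psi> \<circ> ?g) ?W"
    proof (rule comp_inj_on)
      show "inj_on ?g ?W" by (rule inj_on_inv_into) simp
      have "inj_on \<psi> V" using d by (simp add: chart_of_iff)
      then show "inj_on \<psi> (?g ` ?W)" unfolding gW by (rule inj_on_subset) simp
    qed
    show "?W \<noteq> {}" using p by blast
  qed
qed

text \<open>Charts alone, without the ambient slice of \<open>submanifold\<close>. For the rotation
  group such charts come directly from the Cayley transform.\<close>

definition charted :: "nat \<Rightarrow> 'a::euclidean_space set \<Rightarrow> bool" where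
  "charted d M \<longleftrightarrow> (\<forall>p\<in>M. \<exists>U S \<phi>. chart_of M U S \<phi> \<and> p \<in> U \<and> dim S = d)"

lemma charted_open_subset:
  assumes "charted d M" "openin (top_of_set M) N" shows "charted d N"
  unfolding charted_def
proof
  fix p assume p: "p \<in> N"
  then have "p \<in> M" using assms(2) openin_imp_subset by blast
  then obtain U S \<phi> where c: "chart_of M U S \<phi>" "p \<in> U" "dim S = d"
    using assms(1) unfolding charted_def by blast
  then show "\<exists>U S \<phi>. chart_of N U S \<phi> \<and> p \<in> U \<and> dim S = d"
    using chart_of_restrict[OF c(1) assms(2)] p by blast
qed

lemma second_countable_top_of_set:
  "second_countable (top_of_set (M :: 'a::second_countable_topology set))"
proof -
  obtain \<B> :: "'a set set" where B: "countable \<B>" "\<And>C. C \<in> \<B> \<Longrightarrow> open C"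
    "\<And>S. open S \<Longrightarrow> \<exists>U. U \<subseteq> \<B> \<and> S = \<Union>U"
    using univ_second_countable by metis
  have "\<exists>V\<in>\<B>. x \<in> V \<and> V \<subseteq> U" if "open U" "x \<in> U" for U x
    using B(3)[OF that(1)] that(2) by blast
  then have "second_countable (euclidean :: 'a topology)"
    unfolding second_countable_def using B(1,2) by (intro exI[of _ \<B>]) auto
  then show ?thesis by (rule second_countable_subtopology)
qed

text \<open>\<open>submanifold_structure\<close> prescribes no dimension for its charts. Each has a
  nonempty domain, and comparison at one of its points with a chart of dimension \<open>d\<close>
  fixes the dimension.\<close>

lemma smooth_manifold_of_charted:
  assumes "charted d M"
  shows "smooth_manifold d (submanifold_structure M)"
  unfolding smooth_manifold_def mtop_submanifold_structure
proof (intro conjI)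
  show "Hausdorff_space (top_of_set M)" by (intro Hausdorff_space_subtopology Hausdorff_space_euclidean)
  show "second_countable (top_of_set M)" by (rule second_countable_top_of_set)
  show "(\<Union>(U, S, \<phi>)\<in>charts (submanifold_structure M). U) = topspace (top_of_set M)"
  proof -
    have "U \<subseteq> M" if "chart_of M U S \<phi>" for U S \<phi>
      using that openin_imp_subset by (auto simp: chart_of_iff)
    then show ?thesis using assms unfolding charted_def by fastforce
  qed
  have "openin (top_of_set M) U \<and> subspace S \<and> dim S = d \<and> openin (top_of_set S) (\<phi> ` U) \<and>
        homeomorphic_map (subtopology (top_of_set M) U) (top_of_set (\<phi> ` U)) \<phi>"
    if c: "chart_of M U S \<phi>" for U S \<phi>
  proof -
    have c': "U \<noteq> {}" "openin (top_of_set M) U" "subspace S" "openin (top_of_set S) (\<phi> ` U)"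
      using c by (auto simp: chart_of_iff)
    then obtain p where p: "p \<in> U" "p \<in> M" using openin_imp_subset by blast
    then obtain V T \<psi> where d: "chart_of M V T \<psi>" "p \<in> V" "dim T = d"
      using assms unfolding charted_def by blast
    have "dim S = d"
      using chart_dim_le[OF c d(1) p(1) d(2)] chart_dim_le[OF d(1) c d(2) p(1)] d(3) by simp
    moreover have "homeomorphic_map (top_of_set U) (top_of_set (\<phi> ` U)) \<phi>"
      using chart_of_homeomorphism[OF c]
      by (auto simp: homeomorphic_map_maps homeomorphic_maps_def homeomorphism_def)
    moreover have "subtopology (top_of_set M) U = top_of_set U"
      using c'(2) openin_imp_subset by (metis inf.absorb2 subtopology_subtopology)
    ultimately show ?thesis using c' by simp
  qed
  then show "\<forall>(U, S, \<phi>)\<in>charts (submanifold_structure M).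
       openin (top_of_set M) U \<and> subspace S \<and> dim S = d \<and> openin (top_of_set S) (\<phi> ` U) \<and>
       homeomorphic_map (subtopology (top_of_set M) U) (top_of_set (\<phi> ` U)) \<phi>"
    by blast
  have "smooth_on (\<phi> ` (U \<inter> V)) (\<psi> \<circ> inv_into U \<phi>)"
    if c: "chart_of M U S \<phi>" and d: "chart_of M V T \<psi>" for U S \<phi> V T \<psi>
    unfolding o_def
  proof (rule smooth_on_compose[where g = \<psi> and Y = V])
    show "smooth_on (\<phi> ` (U \<inter> V)) (inv_into U \<phi>)"
      by (rule smooth_on_subset[of "\<phi> ` U"]) (use c in \<open>auto simp: chart_of_iff\<close>)
    show "smooth_on V \<psi>" using d by (simp add: chart_of_iff)
    show "inv_into U \<phi> ` \<phi> ` (U \<inter> V) \<subseteq> V"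
      using c by (auto simp: chart_of_iff inv_into_f_f)
  qed
  then show "\<forall>(U, S, \<phi>)\<in>charts (submanifold_structure M). \<forall>(V, T, \<psi>)\<in>charts (submanifold_structure M).
       smooth_on (\<phi> ` (U \<inter> V)) (\<psi> \<circ> inv_into U \<phi>)"
    by blast
qed

lemma submanifold_imp_charted:
  assumes "submanifold V d M" shows "charted d M"
  unfolding charted_def
proof
  fix p assume p: "p \<in> M"
  obtain U \<phi> S where c: "chart_of V U V \<phi>" "p \<in> U" and S: "subspace S" "S \<subseteq> V" "dim S = d"
    and sl: "\<phi> ` (U \<inter> M) = \<phi> ` U \<inter> S"
    using assms p unfolding submanifold_def by blast
  have MV: "M \<subseteq> V" using assms by (simp add: submanifold_def)
  have U: "openin (top_of_set V) U" "inj_on \<phi> U" "openin (top_of_set V) (\<phi> ` U)"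
    "smooth_on U \<phi>" "smooth_on (\<phi> ` U) (inv_into U \<phi>)"
    using c by (auto simp: chart_of_iff)
  have inj: "inj_on \<phi> (U \<inter> M)" using U(2) by (meson inf_le1 inj_on_subset)
  have "chart_of M (U \<inter> M) S \<phi>"
    unfolding chart_of_iff
  proof (intro conjI)
    show "U \<inter> M \<noteq> {}" using p c by blast
    show "openin (top_of_set M) (U \<inter> M)"
      using U(1) MV unfolding openin_open by blast
    show "openin (top_of_set S) (\<phi> ` (U \<inter> M))"
      using U(3) S(2) unfolding openin_open sl by blast
    show "smooth_on (U \<inter> M) \<phi>" by (rule smooth_on_subset[OF U(4)]) auto
    have "smooth_on (\<phi> ` (U \<inter> M)) (inv_into U \<phi>)" by (rule smooth_on_subset[OF U(5)]) auto
    then show "smooth_on (\<phi> ` (U \<inter> M)) (inv_into (U \<inter> M) \<phi>)"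
    proof (rule smooth_on_cong)
      fix z assume "z \<in> \<phi> ` (U \<inter> M)"
      then obtain x where "x \<in> U \<inter> M" "z = \<phi> x" by blast
      then show "inv_into U \<phi> z = inv_into (U \<inter> M) \<phi> z"
        using U(2) inj by (simp add: inv_into_f_f)
    qed
  qed (use S inj in auto)
  then show "\<exists>U S \<phi>. chart_of M U S \<phi> \<and> p \<in> U \<and> dim S = d" using p c S by blast
qed

lemma submanifold_open_subset:
  assumes "submanifold V d M" "openin (top_of_set M) N" shows "submanifold V d N"
  unfolding submanifold_def
proof (intro conjI ballI)
  have NM: "N \<subseteq> M" using assms(2) openin_imp_subset by blast
  have MV: "M \<subseteq> V" using assms(1) by (simp add: submanifold_def)
  show "subspace V" "N \<subseteq> V" using assms(1) NM MV by (auto simp: submanifold_def)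
  fix p assume p: "p \<in> N"
  obtain U \<phi> S where c: "chart_of V U V \<phi>" "p \<in> U" and S: "subspace S" "S \<subseteq> V" "dim S = d"
    and sl: "\<phi> ` (U \<inter> M) = \<phi> ` U \<inter> S"
    using assms(1) p NM unfolding submanifold_def by blast
  obtain W where W: "open W" "N = M \<inter> W" using assms(2) by (auto simp: openin_open)
  have "openin (top_of_set V) (V \<inter> W)" using W(1) by blast
  then have "chart_of V (U \<inter> (V \<inter> W)) V \<phi>"
    using chart_of_restrict'[OF c(1)] c(2) p W MV by blast
  moreover have "\<phi> ` (U \<inter> (V \<inter> W) \<inter> N) = \<phi> ` (U \<inter> (V \<inter> W)) \<inter> S"
  proof -
    have inj: "inj_on \<phi> U" and UV: "U \<subseteq> V"
      using c(1) openin_imp_subset by (auto simp: chart_of_iff)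
    show ?thesis
    proof
      show "\<phi> ` (U \<inter> (V \<inter> W) \<inter> N) \<subseteq> \<phi> ` (U \<inter> (V \<inter> W)) \<inter> S"
        using sl NM by blast
      show "\<phi> ` (U \<inter> (V \<inter> W)) \<inter> S \<subseteq> \<phi> ` (U \<inter> (V \<inter> W) \<inter> N)"
      proof
        fix z assume z: "z \<in> \<phi> ` (U \<inter> (V \<inter> W)) \<inter> S"
        then obtain x where x: "x \<in> U" "x \<in> W" "z = \<phi> x" by blast
        have "z \<in> \<phi> ` (U \<inter> M)" using z x sl by blast
        then obtain y where y: "y \<in> U" "y \<in> M" "z = \<phi> y" by blast
        then have "x = y" using inj x by (metis inj_onD)
        then show "z \<in> \<phi> ` (U \<inter> (V \<inter> W) \<inter> N)" using x y W UV by blast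
      qed
    qed
  qed
  moreover have "p \<in> U \<inter> (V \<inter> W)" using p W c MV by blast
  ultimately show "\<exists>U \<phi> S. (U, V, \<phi>) \<in> charts (submanifold_structure V) \<and> p \<in> U \<and>
        subspace S \<and> S \<subseteq> V \<and> dim S = d \<and> \<phi> ` (U \<inter> N) = \<phi> ` U \<inter> S"
    using S by blast
qed

section \<open>An inverse function theorem between linear subspaces\<close>

lemma subspace_projection:
  fixes T :: "'a::euclidean_space set"
  assumes "subspace T"
  obtains P where "linear P" "range P \<subseteq> T" "\<And>x. x \<in> T \<Longrightarrow> P x = x"
    "subspace {x. P x = 0}" "dim {x. P x = 0} + dim T = DIM('a)"
proof -
  obtain P :: "'a \<Rightarrow> 'a" where P: "range P \<subseteq> T" "linear P" "\<forall>v\<in>T. P v = v"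
    using linear_exists_left_inverse_on[of "\<lambda>x::'a. x", OF _ assms] by (auto simp: linear_iff)
  let ?K = "{x. P x = 0}"
  have K: "subspace ?K" using P(2) by (simp add: subspace_def linear_add linear_scale linear_0)
  have "{x + y |x y. x \<in> ?K \<and> y \<in> T} = UNIV"
  proof -
    have "P (P z) = P z" "P z \<in> T" for z using P(1,3) by blast+
    then have "z = (z - P z) + P z \<and> z - P z \<in> ?K \<and> P z \<in> T" for z
      using P(2) by (simp add: linear_diff)
    then show ?thesis by blast
  qed
  moreover have "?K \<inter> T = {0}" using P assms by (auto simp: linear_0 subspace_0)
  ultimately have "dim ?K + dim T = DIM('a)"
    using dim_sums_Int[OF K assms] by simp
  then show ?thesis using that P K by blast
qed

text \<open>The inverse function theorem wants a map of the whole space. With projections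
  \<open>P\<close> onto \<open>T\<close> and \<open>Q\<close> onto \<open>S\<close>, the kernels
  have equal dimension, and an isometry \<open>E\<close> between them is added to the map on
  \<open>T\<close>. The sum \<open>H\<close> extends \<open>h\<close> near \<open>x0\<close> and has
  an injective derivative there.\<close>

lemma smooth_on_inverse:
  fixes h :: "'a::euclidean_space \<Rightarrow> 'a"
  assumes T: "subspace T" and S: "subspace S" and dims: "dim T = dim S"
    and X: "openin (top_of_set T) X" and hom: "homeomorphism X Y h k" and Y: "Y \<subseteq> S"
    and sm: "smooth_on X h"
    and der: "\<And>x. x \<in> X \<Longrightarrow> \<exists>D. (h has_derivative D) (at x within X) \<and> (\<forall>v\<in>T. D v = 0 \<longrightarrow> v = 0)"
  shows "smooth_on Y k"
  unfolding smooth_on_def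
proof
  fix y0 assume y0: "y0 \<in> Y"
  define x0 where "x0 = k y0"
  have hk: "h (k y) = y" "k y \<in> X" if "y \<in> Y" for y
    using hom that by (auto simp: homeomorphism_def)
  have x0: "x0 \<in> X" "h x0 = y0" using hk[OF y0] by (auto simp: x0_def)
  have XT: "X \<subseteq> T" using X openin_imp_subset by blast
  obtain U0 h' where U0: "open U0" "x0 \<in> U0" "Cinf_on U0 h'" and h': "\<And>y. y \<in> X \<Longrightarrow> y \<in> U0 \<Longrightarrow> h' y = h y"
    using smooth_onE[OF sm x0(1)] by metis
  obtain D where D: "(h has_derivative D) (at x0 within X)" and Dinj: "\<And>v. v \<in> T \<Longrightarrow> D v = 0 \<Longrightarrow> v = 0"
    using der[OF x0(1)] by blast
  define D' where "D' = frechet_derivative h' (at x0)"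
  have D': "(h' has_derivative D') (at x0)"
    using Cinf_on_differentiable[OF U0(3,2)] by (simp add: D'_def)
  have linD': "linear D'" using D' has_derivative_linear by blast
  have hXS: "h ` X \<subseteq> S" using hom Y by (simp add: homeomorphism_def)
  have DS: "D v \<in> S" if "v \<in> T" for v
    by (rule derivative_into_subspace[OF D X T x0(1) hXS S that])
  \<comment> \<open>The local extension \<open>h'\<close> and \<open>h\<close> agree on a relatively
    open set, so their derivatives agree along \<open>T\<close>, though not necessarily across
    it.\<close>
  have DD': "D' v = D v" if "v \<in> T" for v
  proof -
    have 1: "openin (top_of_set T) (X \<inter> U0)" using X U0(1) by (rule openin_Int_open)
    have "((\<lambda>x. h' x - h x) has_derivative (\<lambda>v. D' v - D v)) (at x0 within (X \<inter> U0))"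
      by (intro has_derivative_diff has_derivative_at_withinI[OF D'] has_derivative_subset[OF D]) auto
    then have "D' v - D v \<in> {0}"
      by (rule derivative_into_subspace[OF _ 1 T]) (use x0 U0 h' that in auto)
    then show ?thesis by simp
  qed
  obtain P where P: "linear P" "range P \<subseteq> T" "\<And>x. x \<in> T \<Longrightarrow> P x = x"
    "subspace {x. P x = 0}" "dim {x. P x = 0} + dim T = DIM('a)"
    using subspace_projection[OF T] by metis
  obtain Q where Q: "linear Q" "range Q \<subseteq> S" "\<And>x. x \<in> S \<Longrightarrow> Q x = x"
    "subspace {x. Q x = 0}" "dim {x. Q x = 0} + dim S = DIM('a)"
    using subspace_projection[OF S] by metis
  have "dim {x. P x = 0} = dim {x. Q x = 0}" using P(5) Q(5) dims by simp
  then obtain E where E: "linear E" "E ` {x. P x = 0} = {x. Q x = 0}" "\<And>x. x \<in> {x. P x = 0} \<Longrightarrow> norm (E x) = norm x"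
    using isometries_subspaces[OF P(4) Q(4)] by metis
  define H where "H z = Q (h' (P z)) + E (z - P z)" for z
  define U1 where "U1 = P -` U0"
  have U1: "open U1" unfolding U1_def
    by (intro open_vimage U0 linear_continuous_on) (simp add: P linear_conv_bounded_linear[symmetric])
  have x0T: "x0 \<in> T" "P x0 = x0" using x0 XT P(3) by auto
  have linE: "linear (\<lambda>z. E (z - P z))"
    using E(1) P(1) by (simp add: linear_iff algebra_simps linear_diff)
  have HC: "Cinf_on U1 H"
  proof
    fix k
    have "Ck_on k U1 (\<lambda>z. h' (P z))"
      by (rule Ck_on_compose[OF U1 U0(1) _ Ck_on_linear[OF P(1)]]) (use U0 in \<open>auto simp: U1_def\<close>)
    then have "Ck_on k U1 (\<lambda>z. Q (h' (P z)))" by (rule Ck_on_linear_compose[OF U1 Q(1)])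
    then show "Ck_on k U1 H"
      unfolding H_def by (rule Ck_on_add[OF U1 _ Ck_on_linear[OF linE]])
  qed
  have HD: "(H has_derivative (\<lambda>v. Q (D' (P v)) + E (v - P v))) (at x0)"
    unfolding H_def
  proof (rule has_derivative_add)
    have "(h' has_derivative D') (at (P x0))" using D' x0T by simp
    from has_derivative_compose[OF linear_imp_has_derivative[OF P(1)] this]
    have "((\<lambda>z. h' (P z)) has_derivative (\<lambda>v. D' (P v))) (at x0)" .
    with Q(1) show "((\<lambda>z. Q (h' (P z))) has_derivative (\<lambda>v. Q (D' (P v)))) (at x0)"
      unfolding linear_conv_bounded_linear by (rule bounded_linear.has_derivative)
    show "((\<lambda>z. E (z - P z)) has_derivative (\<lambda>v. E (v - P v))) (at x0)"
      by (rule linear_imp_has_derivative[OF linE])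
  qed
  have HI: "inj (\<lambda>v. Q (D' (P v)) + E (v - P v))"
  proof -
    have lin: "linear (\<lambda>v. Q (D' (P v)) + E (v - P v))"
      using linear_compose_add[OF linear_compose[OF linear_compose[OF P(1) linD'] Q(1)] linE] by (simp add: o_def)
    have "v = 0" if v: "Q (D' (P v)) + E (v - P v) = 0" for v
    proof -
      have "P (P v) = P v" using P(2,3) by blast
      then have k: "v - P v \<in> {x. P x = 0}" using P(1) by (simp add: linear_diff)
      then have "Q (E (v - P v)) = 0" using E(2) by blast
      moreover have "Q (Q (D' (P v))) = Q (D' (P v))" using Q(2,3) by blast
      ultimately have q: "Q (D' (P v)) = 0"
        using arg_cong[OF v, of Q] by (simp add: linear_add[OF Q(1)] linear_0[OF Q(1)])
      then have "E (v - P v) = 0" using v by simp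
      then have vP: "v = P v" using E(3)[OF k] by simp
      then have vT: "v \<in> T" using P(2) by (metis rangeI subsetD)
      have "Q (D v) = 0" using q vP DD'[OF vT] by simp
      then have "D v = 0" using Q(3) DS[OF vT] by simp
      then show "v = 0" using Dinj vT by blast
    qed
    then show ?thesis unfolding linear_injective_0[OF lin] by blast
  qed
  have x0U1: "x0 \<in> U1" using x0T U0 by (simp add: U1_def)
  obtain U V g where U: "open U" "U \<subseteq> U1" "x0 \<in> U" "open V" "homeomorphism U V H g" "Cinf_on V g"
    by (rule Cinf_local_inverse[OF U1 HC x0U1 HD HI])
  have Hh: "H x = h x" if "x \<in> X" "x \<in> U" for x
  proof -
    have "P x = x" using that P(3) XT by blast
    moreover from this have "x \<in> U0" using that(2) U(2) by (metis U1_def subsetD vimageD)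
    ultimately have "P x = x" "x \<in> U0" by blast+
    then show ?thesis using h'[OF that(1)] Q(3) hXS that(1) E(1) by (auto simp: H_def linear_0)
  qed
  have "continuous_on Y k" using hom by (simp add: homeomorphism_def)
  then obtain W where W: "open W" "W \<inter> Y = k -` U \<inter> Y"
    using U(1) continuous_on_open_invariant by metis
  have gk: "g y = k y" if "y \<in> Y" "y \<in> W" for y
  proof -
    have "k y \<in> U" "k y \<in> X" using that W(2) hk by auto
    then have "H (k y) = y" using Hh hk(1)[OF that(1)] by simp
    then show ?thesis using U(5) \<open>k y \<in> U\<close> by (metis homeomorphism_apply1)
  qed
  have "y0 \<in> V"
  proof -
    have "H x0 \<in> V" using U(3,5) by (auto simp: homeomorphism_def)
    then show ?thesis using Hh[OF x0(1) U(3)] x0(2) by simp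
  qed
  moreover have "y0 \<in> W" using W(2) y0 U(3) by (auto simp: x0_def)
  moreover have "Cinf_on (V \<inter> W) g"
  proof
    fix k
    from U(6) have "Ck_on k V g" ..
    then show "Ck_on k (V \<inter> W) g" by (rule Ck_on_subset) simp
  qed
  ultimately show "\<exists>U g. open U \<and> y0 \<in> U \<and> Cinf_on U g \<and> (\<forall>y\<in>Y \<inter> U. g y = k y)"
    using U(4) W(1) gk by (intro exI[of _ "V \<inter> W"] exI[of _ g]) auto
qed

section \<open>Homogeneous spaces\<close>

text \<open>Differentiating \<open>f (\<sigma> y) = y\<close> shows that \<open>E\<close> is a right
  inverse of \<open>D\<close> on \<open>T\<close>.\<close>

lemma derivative_of_section:
  fixes f :: "'a::euclidean_space \<Rightarrow> 'b::euclidean_space"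
  assumes Z: "openin (top_of_set S) Z" "subspace S" and Q: "openin (top_of_set T) Q" "subspace T"
    and q: "q \<in> Q" and \<sigma>: "\<sigma> ` Q \<subseteq> Z" "\<And>y. y \<in> Q \<Longrightarrow> f (\<sigma> y) = y" and f: "f ` Z \<subseteq> T"
    and D: "(f has_derivative D) (at (\<sigma> q) within Z)" and E: "(\<sigma> has_derivative E) (at q within Q)"
  shows "D ` S = T"
proof
  have \<sigma>q: "\<sigma> q \<in> Z" using \<sigma> q by blast
  have D1: "D s \<in> T" if "s \<in> S" for s
    by (rule derivative_into_subspace[OF D Z \<sigma>q f Q(2) that])
  then show "D ` S \<subseteq> T" by blast
  have \<sigma>S: "\<sigma> ` Q \<subseteq> S" using \<sigma>(1) Z(1) openin_imp_subset by blast
  show "T \<subseteq> D ` S"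
  proof
    fix t assume t: "t \<in> T"
    have Et: "E t \<in> S"
      by (rule derivative_into_subspace[OF E Q q \<sigma>S Z(2) t])
    have "((\<lambda>y. f (\<sigma> y) - y) has_derivative (\<lambda>v. D (E v) - v)) (at q within Q)"
      by (intro has_derivative_diff has_derivative_ident has_derivative_in_compose[OF E]
          has_derivative_subset[OF D \<sigma>(1)])
    then have "D (E t) - t \<in> {0}"
      by (rule derivative_into_subspace[OF _ Q q _ _ t]) (use \<sigma> in auto)
    then show "t \<in> D ` S" using Et by (metis eq_iff_diff_eq_0 image_eqI singletonD)
  qed
qed

text \<open>A smooth section through every point provides, in each pair of charts, a right inverse
  of the derivative.\<close>

lemma submersionI:
  assumes sm: "smooth_on X f" and fX: "f ` X \<subseteq> Y"
    and sec: "\<And>x. x \<in> X \<Longrightarrow> \<exists>W s. openin (top_of_set Y) W \<and> f x \<in> W \<and> smooth_on W s \<and> s (f x) = x \<and>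
        (\<forall>y\<in>W. s y \<in> X \<and> f (s y) = y)"
  shows "submersion (submanifold_structure X) (submanifold_structure Y) f"
proof -
  have contf: "continuous_on X f" by (rule smooth_on_imp_continuous_on[OF sm])
  have smooth: "smooth_on (\<phi> ` (U \<inter> f -` V)) (\<lambda>z. \<psi> (f (inv_into U \<phi> z)))"
    if c: "chart_of X U S \<phi>" and d: "chart_of Y V T \<psi>" for U S \<phi> V T \<psi>
  proof (rule smooth_on_compose[where g = \<psi> and Y = V])
    have U: "U \<subseteq> X" "inj_on \<phi> U" "smooth_on (\<phi> ` U) (inv_into U \<phi>)"
      using c openin_imp_subset by (auto simp: chart_of_iff)
    show "smooth_on V \<psi>" using d by (simp add: chart_of_iff)
    have inv: "inv_into U \<phi> ` \<phi> ` (U \<inter> f -` V) = U \<inter> f -` V"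
      using U(2) by (simp add: inv_into_image_cancel)
    show "smooth_on (\<phi> ` (U \<inter> f -` V)) (\<lambda>z. f (inv_into U \<phi> z))"
    proof (rule smooth_on_compose[where g = f and Y = X])
      show "smooth_on (\<phi> ` (U \<inter> f -` V)) (inv_into U \<phi>)"
        by (rule smooth_on_subset[OF U(3)]) blast
    qed (use sm inv U(1) in auto)
    show "(\<lambda>z. f (inv_into U \<phi> z)) ` \<phi> ` (U \<inter> f -` V) \<subseteq> V"
      using inv by (metis (no_types, lifting) IntD2 image_eqI image_subsetI vimageD)
  qed
  have der: "\<exists>D. ((\<psi> \<circ> f \<circ> inv_into U \<phi>) has_derivative D) (at (\<phi> x) within \<phi> ` (U \<inter> f -` V)) \<and> D ` S = T"
    if c: "chart_of X U S \<phi>" and d: "chart_of Y V T \<psi>" and x: "x \<in> U \<inter> f -` V" for U S \<phi> V T \<psi> x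
  proof -
    have U: "U \<subseteq> X" "inj_on \<phi> U" "smooth_on U \<phi>" "openin (top_of_set X) U" "subspace S"
      using c openin_imp_subset by (auto simp: chart_of_iff)
    have V: "V \<subseteq> Y" "\<psi> ` V \<subseteq> T" "openin (top_of_set Y) V" "subspace T"
      using d openin_imp_subset unfolding chart_of_iff by blast+
    define k where "k z = \<psi> (f (inv_into U \<phi> z))" for z
    define Z where "Z = \<phi> ` (U \<inter> f -` V)"
    have "openin (top_of_set X) (X \<inter> f -` V)"
      using contf fX V(3) continuous_openin_preimage by (metis image_subset_iff_funcset)
    then have "chart_of X (U \<inter> (X \<inter> f -` V)) S \<phi>"
      using chart_of_restrict'[OF c] x U(1) by blast
    moreover have "U \<inter> (X \<inter> f -` V) = U \<inter> f -` V" using U(1) by blast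
    ultimately have Z: "openin (top_of_set S) Z" by (simp add: chart_of_iff Z_def)
    have "smooth_on Z k" using smooth[OF c d] unfolding Z_def k_def .
    moreover have "\<phi> x \<in> Z" using x by (simp add: Z_def)
    ultimately obtain D where D: "(k has_derivative D) (at (\<phi> x) within Z)"
      by (rule smooth_on_has_derivative)
    obtain W s where W: "openin (top_of_set Y) W" "f x \<in> W" "smooth_on W s" "s (f x) = x"
      and s: "\<And>y. y \<in> W \<Longrightarrow> s y \<in> X" "\<And>y. y \<in> W \<Longrightarrow> f (s y) = y"
      using sec[of x] x U(1) by blast
    \<comment> \<open>The section is restricted to values in the chart domain \<open>U\<close> over
      base points in \<open>V\<close>, so that it can be written in coordinates.\<close>
    define V1 where "V1 = V \<inter> (W \<inter> s -` U)"
    have "openin (top_of_set W) (W \<inter> s -` U)"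
      using smooth_on_imp_continuous_on[OF W(3)] s(1) U(4)
      by (intro continuous_openin_preimage[where T = X]) auto
    then have "openin (top_of_set Y) (W \<inter> s -` U)" using W(1) openin_trans by blast
    moreover have fx: "f x \<in> V1" using x W by (simp add: V1_def)
    ultimately have d1: "chart_of Y V1 T \<psi>"
      using chart_of_restrict'[OF d] unfolding V1_def by blast
    define Q where "Q = \<psi> ` V1"
    have Q: "openin (top_of_set T) Q" and inj: "inj_on \<psi> V1" and smi: "smooth_on Q (inv_into V1 \<psi>)"
      using d1 by (auto simp: chart_of_iff Q_def)
    have invQ: "inv_into V1 \<psi> (\<psi> y) = y" if "y \<in> V1" for y using inj that by (rule inv_into_f_f)
    define \<sigma> where "\<sigma> q = \<phi> (s (inv_into V1 \<psi> q))" for q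
    have 1: "smooth_on Q (\<lambda>q. s (inv_into V1 \<psi> q))"
      by (rule smooth_on_compose[OF smi W(3)]) (auto simp: Q_def invQ, simp add: V1_def)
    have "smooth_on Q \<sigma>"
      unfolding \<sigma>_def
      by (rule smooth_on_compose[OF 1 U(3)]) (auto simp: Q_def invQ, simp add: V1_def)
    moreover have "\<psi> (f x) \<in> Q" using fx by (simp add: Q_def)
    ultimately obtain E where E: "(\<sigma> has_derivative E) (at (\<psi> (f x)) within Q)"
      by (rule smooth_on_has_derivative)
    have \<sigma>x: "\<sigma> (\<psi> (f x)) = \<phi> x" using fx W(4) by (simp add: \<sigma>_def invQ)
    have "D ` S = T"
    proof (rule derivative_of_section[OF Z U(5) Q V(4)])
      show "\<psi> (f x) \<in> Q" by fact
      show "\<sigma> ` Q \<subseteq> Z"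
      proof (clarsimp simp: Q_def)
        fix y assume y: "y \<in> V1"
        then have "s y \<in> U \<inter> f -` V" using s(2) by (auto simp: V1_def)
        then show "\<sigma> (\<psi> y) \<in> Z" using y by (simp add: \<sigma>_def invQ Z_def)
      qed
      show "k (\<sigma> q) = q" if qQ: "q \<in> Q" for q
      proof -
        obtain y where y: "y \<in> V1" "q = \<psi> y" using qQ unfolding Q_def by blast
        then have "s y \<in> U" "f (s y) = y" using s(2) by (auto simp: V1_def)
        then show ?thesis using y U(2) by (simp add: k_def \<sigma>_def invQ inv_into_f_f)
      qed
      show "k ` Z \<subseteq> T"
        using V(2) U(2) by (auto simp: k_def Z_def inv_into_f_f)
      show "(k has_derivative D) (at (\<sigma> (\<psi> (f x))) within Z)" using D \<sigma>x by simp
    qed (rule E)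
    then show ?thesis using D unfolding k_def Z_def o_def by blast
  qed
  have "continuous_map (top_of_set X) (top_of_set Y) f"
    using contf fX by (simp add: image_subset_iff_funcset)
  then show ?thesis
    unfolding submersion_def smooth_map_def mtop_submanifold_structure
    using smooth der unfolding o_def by blast
qed

lemma submersion_derivative:
  assumes "submersion A B f" "(U, S, \<phi>) \<in> charts A" "(V, T, \<psi>) \<in> charts B" "x \<in> U" "f x \<in> V"
  obtains D where
    "((\<psi> \<circ> f \<circ> inv_into U \<phi>) has_derivative D) (at (\<phi> x) within \<phi> ` (U \<inter> f -` V))" "D ` S = T"
proof -
  have "\<forall>(U, S, \<phi>)\<in>charts A. \<forall>(V, T, \<psi>)\<in>charts B. \<forall>x\<in>U \<inter> f -` V.
      \<exists>D. ((\<psi> \<circ> f \<circ> inv_into U \<phi>) has_derivative D) (at (\<phi> x) within \<phi> ` (U \<inter> f -` V)) \<and> D ` S = T"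
    using assms(1) unfolding submersion_def by (rule conjunct2)
  from bspec[OF this assms(2), unfolded prod.case, THEN bspec, OF assms(3), unfolded prod.case,
      THEN bspec, of x] assms(4,5) that
  show ?thesis by auto
qed

lemma homeomorphic_map_imp_homeomorphism:
  assumes "homeomorphic_map (top_of_set A) (top_of_set B) h"
  shows "homeomorphism A B h (inv_into A h)"
proof -
  have h: "inj_on h A" "h ` A = B" "continuous_on A h"
    using assms by (auto simp: homeomorphic_eq_everything_map)
  obtain g where g: "continuous_on B g" "\<And>x. x \<in> A \<Longrightarrow> g (h x) = x"
    using assms by (auto simp: homeomorphic_map_maps homeomorphic_maps_def)
  have "continuous_on B (inv_into A h)"
    using g(1) by (rule continuous_on_eq) (use g(2) h in auto)
  then show ?thesis
    using h by (auto simp: homeomorphism_def)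
qed

text \<open>A linear right inverse \<open>R\<close> of \<open>E\<close> is injective on
  \<open>S\<close>, so by the dimension bound it maps \<open>S\<close> onto \<open>T\<close>; on the
  image of \<open>S\<close> under \<open>R\<close> only zero is annihilated by
  \<open>E\<close>.\<close>

lemma linear_onto_imp_injective:
  fixes E :: "'a::euclidean_space \<Rightarrow> 'b::euclidean_space"
  assumes E: "linear E" "S \<subseteq> E ` T" and T: "subspace T" and S: "subspace S" and dims: "dim T \<le> dim S"
    and v: "v \<in> T" "E v = 0"
  shows "v = 0"
proof -
  obtain R where R: "range R \<subseteq> T" "linear R" "\<And>w. w \<in> E ` T \<Longrightarrow> E (R w) = w"
    using linear_exists_right_inverse_on[OF E(1) T] by blast
  have inj: "inj_on R S" using R(3) E(2) by (metis inj_on_inverseI subsetD)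
  have "dim (R ` S) = dim S"
    using S inj by (intro dim_image_eq[OF R(2)]) (simp add: span_eq_iff[THEN iffD2])
  then have "R ` S = T"
    using R(1,2) S T dims by (intro subspace_dim_equal) (auto intro: linear_subspace_image)
  then obtain w where "w \<in> S" "v = R w" using v(1) by blast
  then show "v = 0" using R v E(2) by (metis linear_0 subsetD)
qed

lemma smooth_manifold_dim:
  assumes "smooth_manifold d M" "(U, S, \<phi>) \<in> charts M" shows "dim S = d"
proof -
  have "\<forall>(U, S, \<phi>)\<in>charts M. openin (mtop M) U \<and> subspace S \<and> dim S = d \<and> openin (top_of_set S) (\<phi> ` U) \<and>
        homeomorphic_map (subtopology (mtop M) U) (top_of_set (\<phi> ` U)) \<phi>"
    using assms(1) unfolding smooth_manifold_def by (elim conjE)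
  from bspec[OF this assms(2)] show ?thesis by simp
qed

lemma smooth_manifold_transition:
  assumes "smooth_manifold d M" "(U, S, \<phi>) \<in> charts M" "(V, T, \<psi>) \<in> charts M"
  shows "smooth_on (\<phi> ` (U \<inter> V)) (\<psi> \<circ> inv_into U \<phi>)"
proof -
  have "\<forall>(U, S, \<phi>)\<in>charts M. \<forall>(V, T, \<psi>)\<in>charts M. smooth_on (\<phi> ` (U \<inter> V)) (\<psi> \<circ> inv_into U \<phi>)"
    using assms(1) unfolding smooth_manifold_def by (elim conjE)
  from bspec[OF this assms(2), unfolded prod.case, THEN bspec, OF assms(3)] show ?thesis by simp
qed

section \<open>Charts of a homogeneous space and of an orbit\<close>

locale homogeneous_fibration =
  fixes G H :: "(real^'n^'n) set" and p :: "real^'n^'n \<Rightarrow> 'e::euclidean_space" and N :: "'e set"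
    and k d :: nat
  assumes pG: "p ` G = N"
    \<comment> \<open>The map \<open>p\<close> is thought of as an orbit map: its fibres are the
      cosets, and the smooth local sections required next replace a general slice theorem for the
      group. The numbers \<open>k\<close> and \<open>d\<close> are the dimensions of
      \<open>G\<close> and \<open>N\<close>.\<close>
    and fibres: "\<And>g h. g \<in> G \<Longrightarrow> h \<in> G \<Longrightarrow> p g = p h \<longleftrightarrow> left_coset H g = left_coset H h"
    and smooth_p: "smooth_on G p"
    and sections: "\<And>x. x \<in> G \<Longrightarrow> \<exists>W s. openin (top_of_set N) W \<and> p x \<in> W \<and> smooth_on W s \<and>
        s (p x) = x \<and> (\<forall>A\<in>W. s A \<in> G \<and> p (s A) = A)"
    and chartedG: "charted k G" and chartedN: "charted d N"
begin

abbreviation "proj \<equiv> left_coset H"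
abbreviation "Q \<equiv> coset_topology G H"
abbreviation "GH \<equiv> homogeneous_space G H :: ((real^'n^'n) set, 'e) smooth_mfd"

text \<open>The mutually inverse bijections induced by \<open>p\<close> between cosets and points of
  \<open>N\<close>; by \<open>fibres\<close> the chosen representatives do not affect the
  values.\<close>

definition P :: "(real^'n^'n) set \<Rightarrow> 'e" where "P \<kappa> = p (SOME g. g \<in> G \<and> proj g = \<kappa>)"
definition F :: "'e \<Rightarrow> (real^'n^'n) set" where "F A = proj (SOME g. g \<in> G \<and> p g = A)"

lemma P_coset: "g \<in> G \<Longrightarrow> P (proj g) = p g"
  unfolding P_def by (rule someI2[of _ g]) (use fibres in auto)

lemma F_p: "g \<in> G \<Longrightarrow> F (p g) = proj g"
  unfolding F_def by (rule someI2[of _ g]) (use fibres in auto)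

lemma P_mem: "\<kappa> \<in> proj ` G \<Longrightarrow> P \<kappa> \<in> N" and F_P: "\<kappa> \<in> proj ` G \<Longrightarrow> F (P \<kappa>) = \<kappa>"
  and F_mem: "A \<in> N \<Longrightarrow> F A \<in> proj ` G" and P_F: "A \<in> N \<Longrightarrow> P (F A) = A"
  using pG by (auto simp: P_coset F_p)

lemma continuous_p: "continuous_on G p"
  by (rule smooth_on_imp_continuous_on[OF smooth_p])

text \<open>\<open>P\<close> is continuous since \<open>p\<close> is and the cosets carry the
  quotient topology. \<open>F\<close> is continuous since near each point it is a local section
  followed by the projection.\<close>

lemma homeo: "homeomorphic_maps (top_of_set N) Q F P"
  unfolding homeomorphic_maps_def
proof (intro conjI)
  show "continuous_map Q (top_of_set N) P"
    unfolding continuous_map_def topspace_coset_topology openin_coset_topology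
  proof (intro conjI allI impI)
    show "P \<in> proj ` G \<rightarrow> topspace (top_of_set N)" using P_mem by auto
    fix U assume "openin (top_of_set N) U"
    then have "openin (top_of_set G) (G \<inter> p -` U)"
      using continuous_p pG by (intro continuous_openin_preimage[where T = N]) auto
    moreover have "{g \<in> G. proj g \<in> {x \<in> proj ` G. P x \<in> U}} = G \<inter> p -` U"
      by (auto simp: P_coset)
    ultimately show "openin (top_of_set G) {g \<in> G. proj g \<in> {x \<in> proj ` G. P x \<in> U}}" by simp
  qed blast
  show "continuous_map (top_of_set N) Q F"
    unfolding continuous_map_def topspace_coset_topology openin_coset_topology
  proof (intro conjI allI impI)
    show "F \<in> topspace (top_of_set N) \<rightarrow> proj ` G" using F_mem by auto
    fix V assume "V \<subseteq> proj ` G \<and> openin (top_of_set G) {g \<in> G. proj g \<in> V}"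
    then have V: "openin (top_of_set G) {g \<in> G. proj g \<in> V}" by blast
    show "openin (top_of_set N) {x \<in> topspace (top_of_set N). F x \<in> V}"
    proof (subst openin_subopen, intro ballI)
      fix A assume A: "A \<in> {x \<in> topspace (top_of_set N). F x \<in> V}"
      then obtain x where x: "x \<in> G" "A = p x" using pG by auto
      obtain W s where W: "openin (top_of_set N) W" "p x \<in> W" "smooth_on W s"
        and s: "\<And>A. A \<in> W \<Longrightarrow> s A \<in> G" "\<And>A. A \<in> W \<Longrightarrow> p (s A) = A"
        using sections[OF x(1)] by blast
      have Fs: "F B = proj (s B)" if "B \<in> W" for B
        using F_p[OF s(1)[OF that]] s(2)[OF that] by simp
      have "openin (top_of_set W) (W \<inter> s -` {g \<in> G. proj g \<in> V})"
        using V smooth_on_imp_continuous_on[OF W(3)] s(1)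
        by (intro continuous_openin_preimage[where T = G]) auto
      then have "openin (top_of_set N) (W \<inter> s -` {g \<in> G. proj g \<in> V})" using W(1) openin_trans by blast
      moreover have "A \<in> W \<inter> s -` {g \<in> G. proj g \<in> V}" using A W(2) x s(1) Fs by auto
      moreover have "W \<inter> s -` {g \<in> G. proj g \<in> V} \<subseteq> {x \<in> topspace (top_of_set N). F x \<in> V}"
        using Fs W(1) openin_imp_subset by fastforce
      ultimately show "\<exists>T. openin (top_of_set N) T \<and> A \<in> T \<and> T \<subseteq> {x \<in> topspace (top_of_set N). F x \<in> V}"
        by blast
    qed
  qed
qed (auto simp: topspace_coset_topology P_F P_coset F_p)

lemma homeoP: "homeomorphic_map Q (top_of_set N) P" and homeoF: "homeomorphic_map (top_of_set N) Q F"
  using homeo homeomorphic_maps_map by blast+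

lemma openin_P: "openin Q U \<Longrightarrow> openin (top_of_set N) (P ` U)"
  using homeoP homeomorphic_map_openness_eq by blast

lemma openin_F: "openin (top_of_set N) U \<Longrightarrow> openin Q (F ` U)"
  using homeoF homeomorphic_map_openness_eq by blast

lemma openin_Q_subset: "openin Q U \<Longrightarrow> U \<subseteq> proj ` G"
  by (simp add: openin_coset_topology)

lemma FP_image: "U \<subseteq> proj ` G \<Longrightarrow> F ` P ` U = U" and PF_image: "V \<subseteq> N \<Longrightarrow> P ` F ` V = V"
  using F_P P_F by (force simp: image_iff subset_iff)+

lemma homeoP_sub:
  assumes "U \<subseteq> N" shows "homeomorphic_map (subtopology Q (F ` U)) (top_of_set U) P"
proof -
  have "subtopology (top_of_set N) U = top_of_set U" using assms by (simp add: inf.absorb2 subtopology_subtopology)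
  moreover have "homeomorphic_map (subtopology Q (F ` U)) (subtopology (top_of_set N) U) P"
  proof (rule homeomorphic_map_subtopologies[OF homeoP])
    have "proj ` G \<inter> F ` U = F ` U" using assms F_mem by blast
    then show "P ` (topspace Q \<inter> F ` U) = topspace (top_of_set N) \<inter> U"
      using assms PF_image[OF assms] by (simp add: topspace_coset_topology inf.absorb2)
  qed
  ultimately show ?thesis by simp
qed

lemma homeoF_sub:
  assumes "U \<subseteq> proj ` G" shows "homeomorphic_map (top_of_set (P ` U)) (subtopology Q U) F"
proof -
  have PU: "P ` U \<subseteq> N" using assms P_mem by blast
  have "subtopology (top_of_set N) (P ` U) = top_of_set (P ` U)"
    using PU by (simp add: inf.absorb2 subtopology_subtopology)
  moreover have "homeomorphic_map (subtopology (top_of_set N) (P ` U)) (subtopology Q U) F"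
  proof (rule homeomorphic_map_subtopologies[OF homeoF])
    show "F ` (topspace (top_of_set N) \<inter> P ` U) = topspace Q \<inter> U"
      using assms PU FP_image[OF assms] by (simp add: topspace_coset_topology inf.absorb2)
  qed
  ultimately show ?thesis by simp
qed

lemma charts_GH_iff: "(U, S, \<phi>) \<in> charts GH \<longleftrightarrow> U \<noteq> {} \<and> openin Q U \<and> subspace S \<and>
     openin (top_of_set S) (\<phi> ` U) \<and> homeomorphic_map (subtopology Q U) (top_of_set (\<phi> ` U)) \<phi> \<and>
     submersion (submanifold_structure {g\<in>G. proj g \<in> U}) (submanifold_structure (\<phi> ` U)) (\<phi> \<circ> proj)"
  by (simp add: homogeneous_space_def)

lemma mtop_GH: "mtop GH = Q"
  by (simp add: homogeneous_space_def)

text \<open>A section of \<open>p\<close>, precomposed with the inverse of the chart, is a section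
  of the chart composed with the projection, so \<open>submersionI\<close> applies.\<close>

lemma chart_to_GH:
  assumes c: "chart_of N U S \<psi>" shows "(F ` U, S, \<psi> \<circ> P) \<in> charts GH"
proof -
  have U: "U \<noteq> {}" "openin (top_of_set N) U" "subspace S" "openin (top_of_set S) (\<psi> ` U)" "inj_on \<psi> U"
    "smooth_on U \<psi>" "smooth_on (\<psi> ` U) (inv_into U \<psi>)"
    using c by (auto simp: chart_of_iff)
  have UN: "U \<subseteq> N" using U(2) openin_imp_subset by blast
  have im: "(\<psi> \<circ> P) ` F ` U = \<psi> ` U"
    unfolding image_comp[symmetric] PF_image[OF UN] ..
  have h\<psi>: "homeomorphic_map (top_of_set U) (top_of_set (\<psi> ` U)) \<psi>"
    using chart_of_homeomorphism[OF c]
    by (auto simp: homeomorphic_map_maps homeomorphic_maps_def homeomorphism_def)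
  have "homeomorphic_map (subtopology Q (F ` U)) (top_of_set (\<psi> ` U)) (\<psi> \<circ> P)"
    by (rule homeomorphic_map_compose[OF homeoP_sub[OF UN] h\<psi>])
  moreover
  let ?X = "{g \<in> G. proj g \<in> F ` U}"
  have Xp: "g \<in> ?X \<longleftrightarrow> g \<in> G \<and> p g \<in> U" for g
  proof -
    have "proj g \<in> F ` U \<longleftrightarrow> p g \<in> U" if "g \<in> G"
      using that F_p P_F UN P_coset by (metis image_eqI image_iff subsetD)
    then show ?thesis by blast
  qed
  have "submersion (submanifold_structure ?X) (submanifold_structure (\<psi> ` U)) ((\<psi> \<circ> P) \<circ> proj)"
  proof (rule submersionI)
    have "smooth_on ?X (\<lambda>g. \<psi> (p g))"
      by (rule smooth_on_compose[OF smooth_on_subset[OF smooth_p] U(6)]) (use Xp in auto)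
    then show "smooth_on ?X ((\<psi> \<circ> P) \<circ> proj)" by (rule smooth_on_cong) (simp add: P_coset)
    show "((\<psi> \<circ> P) \<circ> proj) ` ?X \<subseteq> \<psi> ` U" using Xp P_coset by auto
    fix x assume x: "x \<in> ?X"
    then have xG: "x \<in> G" "p x \<in> U" using Xp by auto
    obtain W s where W: "openin (top_of_set N) W" "p x \<in> W" "smooth_on W s" "s (p x) = x"
        and s: "\<And>A. A \<in> W \<Longrightarrow> s A \<in> G" "\<And>A. A \<in> W \<Longrightarrow> p (s A) = A"
      using sections[OF xG(1)] by blast
    have "openin (top_of_set U) (U \<inter> W)"
      using W(1) UN by (auto simp: openin_open)
    then have o: "openin (top_of_set (\<psi> ` U)) (\<psi> ` (U \<inter> W))"
      using homeomorphism_imp_open_map chart_of_homeomorphism[OF c] by blast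
    have inv: "inv_into U \<psi> (\<psi> A) = A" if "A \<in> U" for A using U(5) that by (rule inv_into_f_f)
    have f1: "smooth_on (\<psi> ` (U \<inter> W)) (\<lambda>z. s (inv_into U \<psi> z))"
      by (rule smooth_on_compose[OF smooth_on_subset[OF U(7)] W(3)]) (auto simp: inv)
    have f2: "s (inv_into U \<psi> z) \<in> ?X \<and> ((\<psi> \<circ> P) \<circ> proj) (s (inv_into U \<psi> z)) = z" if z: "z \<in> \<psi> ` (U \<inter> W)" for z
    proof -
      obtain A where A: "A \<in> U" "A \<in> W" "z = \<psi> A" using z by blast
      then have "s A \<in> ?X" using s[OF A(2)] Xp by simp
      then show ?thesis using A s[OF A(2)] by (simp add: inv P_coset)
    qed
    show "\<exists>W s. openin (top_of_set (\<psi> ` U)) W \<and> ((\<psi> \<circ> P) \<circ> proj) x \<in> W \<and> smooth_on W s \<and> s (((\<psi> \<circ> P) \<circ> proj) x) = x \<and>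
        (\<forall>y\<in>W. s y \<in> ?X \<and> ((\<psi> \<circ> P) \<circ> proj) (s y) = y)"
    proof (intro exI conjI)
      show "((\<psi> \<circ> P) \<circ> proj) x \<in> \<psi> ` (U \<inter> W)" using xG W(2) by (simp add: P_coset)
      show "s (inv_into U \<psi> (((\<psi> \<circ> P) \<circ> proj) x)) = x" using xG W(4) by (simp add: P_coset inv)
      show "\<forall>y\<in>\<psi> ` (U \<inter> W). s (inv_into U \<psi> y) \<in> ?X \<and> ((\<psi> \<circ> P) \<circ> proj) (s (inv_into U \<psi> y)) = y"
        using f2 by blast
    qed (rule o f1)+
  qed
  ultimately show ?thesis
    unfolding charts_GH_iff im using U(1,3,4) openin_F[OF U(2)] by simp
qed

text \<open>The delicate direction: smoothness of \<open>\<phi> \<circ> F\<close> comes from local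
  sections, that of its inverse from the submersion property. The latter makes the derivative of
  \<open>\<phi> \<circ> F\<close> in a chart of \<open>N\<close> onto, hence bijective by equality
  of dimensions, and \<open>smooth_on_inverse\<close> applies.\<close>

lemma chart_from_GH:
  assumes c: "(U, S, \<phi>) \<in> charts GH" shows "chart_of N (P ` U) S (\<phi> \<circ> F)"
proof -
  let ?X = "{g \<in> G. proj g \<in> U}" and ?f = "\<phi> \<circ> proj" and ?h = "\<phi> \<circ> F" and ?U = "P ` U"
  have U: "U \<noteq> {}" "openin Q U" "subspace S" "openin (top_of_set S) (\<phi> ` U)"
    and hom: "homeomorphic_map (subtopology Q U) (top_of_set (\<phi> ` U)) \<phi>"
    and sub: "submersion (submanifold_structure ?X) (submanifold_structure (\<phi> ` U)) ?f"
    using c by (auto simp: charts_GH_iff)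
  have UC: "U \<subseteq> proj ` G" using openin_Q_subset[OF U(2)] .
  have oU: "openin (top_of_set N) ?U" by (rule openin_P[OF U(2)])
  have UN: "?U \<subseteq> N" using oU openin_imp_subset by blast
  have oX: "openin (top_of_set G) ?X" using U(2) by (simp add: openin_coset_topology)
  have Xp: "g \<in> ?X \<longleftrightarrow> g \<in> G \<and> p g \<in> ?U" for g
  proof -
    have "proj g \<in> U \<longleftrightarrow> p g \<in> P ` U" if g: "g \<in> G"
    proof
      assume "proj g \<in> U"
      then show "p g \<in> P ` U" using P_coset[OF g] by (metis image_eqI)
    next
      assume "p g \<in> P ` U"
      then obtain \<kappa> where \<kappa>: "\<kappa> \<in> U" "p g = P \<kappa>" by blast
      then have "proj g = \<kappa>" using F_p[OF g] F_P UC by (metis subsetD)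
      then show "proj g \<in> U" using \<kappa> by simp
    qed
    then show ?thesis by blast
  qed
  have him: "?h ` ?U = \<phi> ` U"
    unfolding image_comp[symmetric] FP_image[OF UC] ..
  have "homeomorphic_map (top_of_set ?U) (top_of_set (\<phi> ` U)) ?h"
    by (rule homeomorphic_map_compose[OF homeoF_sub[OF UC] hom])
  then have homh: "homeomorphism ?U (\<phi> ` U) ?h (inv_into ?U ?h)"
    by (rule homeomorphic_map_imp_homeomorphism)
  have injh: "inj_on ?h ?U"
    using homh unfolding homeomorphism_def by (metis inj_on_inverseI)
  have inv: "inv_into ?U ?h (?h A) = A" if "A \<in> ?U" for A
    using injh that by (rule inv_into_f_f)
  \<comment> \<open>With the identity as chart of the image, the coordinate form of the submersion
    condition speaks about \<open>?f\<close> itself.\<close>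
  have id: "chart_of (\<phi> ` U) (\<phi> ` U) S (\<lambda>z. z)"
  proof -
    have "smooth_on (\<phi> ` U) (inv_into (\<phi> ` U) (\<lambda>z. z))"
      using smooth_on_id by (rule smooth_on_cong) (metis f_inv_into_f image_ident)
    then show ?thesis using U by (simp add: chart_of_iff smooth_on_id)
  qed
  have cX: "charted k ?X" by (rule charted_open_subset[OF chartedG oX])
  have fX: "U2 \<inter> ?f -` (\<phi> ` U) = U2" if "U2 \<subseteq> ?X" for U2 using that by auto
  have smf: "smooth_on ?X ?f"
  proof (rule smooth_on_local)
    fix g assume g: "g \<in> ?X"
    then obtain U2 S2 \<xi> where c2: "chart_of ?X U2 S2 \<xi>" "g \<in> U2" using cX unfolding charted_def by blast
    then have U2: "openin (top_of_set ?X) U2" "inj_on \<xi> U2" "smooth_on U2 \<xi>" by (auto simp: chart_of_iff)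
    have U2X: "U2 \<subseteq> ?X" using U2(1) openin_imp_subset by blast
    have "smooth_on (\<xi> ` (U2 \<inter> ?f -` (\<phi> ` U))) ((\<lambda>z. z) \<circ> ?f \<circ> inv_into U2 \<xi>)"
      using sub c2(1) id unfolding submersion_def smooth_map_def by blast
    then have "smooth_on (\<xi> ` U2) (\<lambda>z. ?f (inv_into U2 \<xi> z))"
      unfolding fX[OF U2X] by (simp add: o_def)
    then have "smooth_on U2 (\<lambda>g. ?f (inv_into U2 \<xi> (\<xi> g)))"
      by (rule smooth_on_compose[OF U2(3)]) simp
    then have "smooth_on U2 ?f" by (rule smooth_on_cong) (simp add: inv_into_f_f[OF U2(2)])
    moreover obtain W where "open W" "U2 = ?X \<inter> W" using U2(1) by (auto simp: openin_open)
    ultimately show "\<exists>W. open W \<and> g \<in> W \<and> smooth_on (?X \<inter> W) ?f" using c2(2) by blast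
  qed
  have smh: "smooth_on ?U ?h"
  proof (rule smooth_on_local)
    fix A assume A: "A \<in> ?U"
    then obtain x where x: "x \<in> G" "A = p x" using UN pG by blast
    obtain W s where W: "openin (top_of_set N) W" "p x \<in> W" "smooth_on W s"
        and s: "\<And>A. A \<in> W \<Longrightarrow> s A \<in> G" "\<And>A. A \<in> W \<Longrightarrow> p (s A) = A"
      using sections[OF x(1)] by blast
    \<comment> \<open>On \<open>W\<close> one has \<open>F B = proj (s B)\<close>, so
      \<open>?h\<close> is \<open>?f\<close> after the section.\<close>
    have "smooth_on (?U \<inter> W) (\<lambda>B. ?f (s B))"
      by (rule smooth_on_compose[OF smooth_on_subset[OF W(3)] smf]) (use s Xp in auto)
    then have "smooth_on (?U \<inter> W) ?h"
      by (rule smooth_on_cong) (metis F_p IntD2 comp_apply s)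
    moreover obtain W' where "open W'" "W = N \<inter> W'" using W(1) by (auto simp: openin_open)
    moreover have "?U \<inter> W = ?U \<inter> W'" using \<open>W = N \<inter> W'\<close> UN by blast
    ultimately show "\<exists>W. open W \<and> A \<in> W \<and> smooth_on (?U \<inter> W) ?h" using W(2) x(2) by auto
  qed
  have smi: "smooth_on (\<phi> ` U) (inv_into ?U ?h)"
  proof (rule smooth_on_local)
    fix y0 assume "y0 \<in> \<phi> ` U"
    then obtain A0 where A0: "A0 \<in> ?U" "y0 = ?h A0" using him by blast
    obtain V0 T \<psi> where d0: "chart_of N V0 T \<psi>" "A0 \<in> V0" using A0(1) UN chartedN unfolding charted_def by blast
    define V where "V = V0 \<inter> ?U"
    have d: "chart_of N V T \<psi>" "A0 \<in> V"
      using chart_of_restrict'[OF d0(1) oU] A0(1) d0(2) unfolding V_def by blast+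
    have V: "openin (top_of_set N) V" "subspace T" "openin (top_of_set T) (\<psi> ` V)" "inj_on \<psi> V"
      "smooth_on V \<psi>" "smooth_on (\<psi> ` V) (inv_into V \<psi>)"
      using d by (auto simp: chart_of_iff)
    have VU: "V \<subseteq> ?U" by (simp add: V_def)
    have inv\<psi>: "inv_into V \<psi> (\<psi> A) = A" if "A \<in> V" for A using V(4) that by (rule inv_into_f_f)
    define m where "m z = ?h (inv_into V \<psi> z)" for z
    define \<kappa> where "\<kappa> y = \<psi> (inv_into ?U ?h y)" for y
    have m\<psi>: "m (\<psi> A) = ?h A" if "A \<in> V" for A using that by (simp add: m_def inv\<psi>)
    have \<kappa>h: "\<kappa> (?h A) = \<psi> A" if "A \<in> V" for A using inv that VU unfolding \<kappa>_def by (metis subsetD)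
    have smm: "smooth_on (\<psi> ` V) m"
      unfolding m_def by (rule smooth_on_compose[OF V(6) smh]) (use inv\<psi> VU in auto)
    have cont\<kappa>: "continuous_on (?h ` V) \<kappa>"
    proof -
      have "continuous_on (\<phi> ` U) (inv_into ?U ?h)" using homh by (simp add: homeomorphism_def)
      then have "continuous_on (?h ` V) (inv_into ?U ?h)"
        by (rule continuous_on_subset) (use him VU in blast)
      note 1 = this
      have 2: "continuous_on V \<psi>" using V(5) by (rule smooth_on_imp_continuous_on)
      have 3: "inv_into ?U ?h ` ?h ` V \<subseteq> V"
      proof (rule image_subsetI)
        fix y assume "y \<in> ?h ` V"
        then obtain A where A: "A \<in> V" "y = ?h A" by blast
        then have "inv_into ?U ?h y = A" using inv VU by blast
        then show "inv_into ?U ?h y \<in> V" using A by simp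
      qed
      show ?thesis unfolding \<kappa>_def by (rule continuous_on_compose2[OF 2 1 3])
    qed
    have homm: "homeomorphism (\<psi> ` V) (?h ` V) m \<kappa>"
      unfolding homeomorphism_def
      using smooth_on_imp_continuous_on[OF smm] cont\<kappa> m\<psi> \<kappa>h by (auto simp: image_image)
    have oUV: "openin (top_of_set ?U) V" using V(1) VU UN openin_subset_trans by blast
    have ohV: "openin (top_of_set (\<phi> ` U)) (?h ` V)"
      by (rule homeomorphism_imp_open_map[OF homh oUV])
    then have ohS: "openin (top_of_set S) (?h ` V)" using U(4) openin_trans by blast
    have hVS: "?h ` V \<subseteq> S" using ohS openin_imp_subset by blast
    have \<psi>VT: "\<psi> ` V \<subseteq> T" using V(3) openin_imp_subset by blast
    \<comment> \<open>\<open>m\<close> is a homeomorphism between nonempty open subsets of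
      \<open>T\<close> and of \<open>S\<close>, so invariance of dimension applies in both
      directions.\<close>
    have "dim T \<le> dim S"
    proof (rule invariance_of_dimension_subspaces[OF V(3) V(2) U(3)])
      show "continuous_on (\<psi> ` V) m" by (rule smooth_on_imp_continuous_on[OF smm])
      show "m \<in> \<psi> ` V \<rightarrow> S" using m\<psi> hVS by auto
      show "inj_on m (\<psi> ` V)" using homm unfolding homeomorphism_def by (metis inj_on_inverseI)
    qed (use d(2) in auto)
    moreover have "dim S \<le> dim T"
    proof (rule invariance_of_dimension_subspaces[OF ohS U(3) V(2) cont\<kappa>])
      show "\<kappa> \<in> ?h ` V \<rightarrow> T" using \<kappa>h \<psi>VT by auto
      show "inj_on \<kappa> (?h ` V)" using homm unfolding homeomorphism_def by (metis inj_on_inverseI)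
    qed (use d(2) in auto)
    ultimately have dims: "dim T = dim S" by simp
    have "smooth_on (?h ` V) \<kappa>"
    proof (rule smooth_on_inverse[OF V(2) U(3) dims V(3) homm hVS smm])
      fix x assume x: "x \<in> \<psi> ` V"
      then obtain A where A: "A \<in> V" "x = \<psi> A" by blast
      then obtain g where g: "g \<in> G" "A = p g" using VU UN pG by blast
      have gX: "g \<in> ?X" using g A VU Xp by blast
      then obtain U2 S2 \<xi> where c2: "chart_of ?X U2 S2 \<xi>" "g \<in> U2" using cX unfolding charted_def by blast
      then have U2: "openin (top_of_set ?X) U2" "inj_on \<xi> U2" "subspace S2" "smooth_on (\<xi> ` U2) (inv_into U2 \<xi>)"
        by (auto simp: chart_of_iff)
      have U2X: "U2 \<subseteq> ?X" using U2(1) openin_imp_subset by blast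
      have "?f g \<in> \<phi> ` U" using gX by simp
      then obtain D where D0: "(((\<lambda>z. z) \<circ> ?f \<circ> inv_into U2 \<xi>) has_derivative D)
          (at (\<xi> g) within \<xi> ` (U2 \<inter> ?f -` (\<phi> ` U)))" "D ` S2 = S"
        by (rule submersion_derivative[OF sub c2(1) id c2(2)])
      have D: "((\<lambda>z. ?f (inv_into U2 \<xi> z)) has_derivative D) (at (\<xi> g) within \<xi> ` U2)" "D ` S2 = S"
        using D0 unfolding fX[OF U2X] by (simp_all only: o_def)
      have "openin (top_of_set ?X) (?X \<inter> p -` V)"
      proof (rule continuous_openin_preimage[where T = N])
        show "continuous_on ?X p" using continuous_p by (rule continuous_on_subset) blast
        show "p \<in> ?X \<rightarrow> N" using pG by blast
      qed (rule V(1))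
      then have c3: "chart_of ?X (U2 \<inter> (?X \<inter> p -` V)) S2 \<xi>"
        using chart_of_restrict'[OF c2(1)] c2(2) gX A g by blast
      define U3 where "U3 = U2 \<inter> (?X \<inter> p -` V)"
      define Z where "Z = \<xi> ` U3"
      have Z: "openin (top_of_set S2) Z" using c3 by (simp add: chart_of_iff Z_def U3_def)
      have gU3: "g \<in> U3" using c2(2) gX A g by (simp add: U3_def)
      have inv\<xi>: "inv_into U2 \<xi> (\<xi> u) = u" if "u \<in> U3" for u
        using that U2(2) by (simp add: inv_into_f_f U3_def)
      have ZU: "Z \<subseteq> \<xi> ` U2" by (auto simp: Z_def U3_def)
      define a where "a z = \<psi> (p (inv_into U2 \<xi> z))" for z
      have "smooth_on Z (\<lambda>z. p (inv_into U2 \<xi> z))"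
        by (rule smooth_on_compose[OF smooth_on_subset[OF U2(4) ZU] smooth_p]) (auto simp: Z_def inv\<xi>, simp add: U3_def)
      then have "smooth_on Z a"
        unfolding a_def by (rule smooth_on_compose[OF _ V(5)]) (auto simp: Z_def inv\<xi>, simp add: U3_def)
      moreover have \<xi>g: "\<xi> g \<in> Z" using gU3 by (simp add: Z_def)
      ultimately obtain D1 where D1: "(a has_derivative D1) (at (\<xi> g) within Z)"
        by (rule smooth_on_has_derivative)
      obtain E where E: "(m has_derivative E) (at x within \<psi> ` V)"
        using smooth_on_has_derivative[OF smm x] by blast
      have ag: "a (\<xi> g) = x" using gU3 g A by (simp add: a_def inv\<xi>)
      have aZ: "a ` Z \<subseteq> \<psi> ` V" by (auto simp: a_def Z_def inv\<xi>, simp add: U3_def)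
      have comp: "m (a z) - ?f (inv_into U2 \<xi> z) = 0" if zZ: "z \<in> Z" for z
      proof -
        obtain u where u: "u \<in> U3" "z = \<xi> u" using zZ unfolding Z_def by blast
        then have "p u \<in> V" "u \<in> G" by (auto simp: U3_def)
        then show ?thesis using u by (simp add: a_def inv\<xi> m\<psi> F_p)
      qed
      have "((\<lambda>z. m (a z) - ?f (inv_into U2 \<xi> z)) has_derivative (\<lambda>v. E (D1 v) - D v)) (at (\<xi> g) within Z)"
        by (intro has_derivative_diff has_derivative_in_compose[OF D1] has_derivative_subset[OF E[folded ag] aZ]
            has_derivative_subset[OF D(1) ZU])
      then have ED: "E (D1 v) - D v \<in> {0}" if "v \<in> S2" for v
        by (rule derivative_into_subspace[OF _ Z U2(3) \<xi>g _ _ that]) (use comp in auto)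
      have D1T: "D1 v \<in> T" if "v \<in> S2" for v
        using aZ \<psi>VT by (intro derivative_into_subspace[OF D1 Z U2(3) \<xi>g _ V(2) that]) blast
      \<comment> \<open>\<open>E\<close> after \<open>D1\<close> equals \<open>D\<close> on
        \<open>S2\<close>, and \<open>D\<close> is onto \<open>S\<close> because \<open>?f\<close>
        is a submersion; so already \<open>E\<close> is onto.\<close>
      have "S \<subseteq> E ` T"
      proof
        fix w assume "w \<in> S"
        then obtain v where "v \<in> S2" "w = D v" using D(2) by blast
        then show "w \<in> E ` T" using ED D1T by (metis eq_iff_diff_eq_0 image_eqI singletonD)
      qed
      then have "\<forall>v\<in>T. E v = 0 \<longrightarrow> v = 0"
        using linear_onto_imp_injective[OF has_derivative_linear[OF E] _ V(2) U(3)] dims by simp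
      then show "\<exists>D. (m has_derivative D) (at x within \<psi> ` V) \<and> (\<forall>v\<in>T. D v = 0 \<longrightarrow> v = 0)"
        using E by blast
    qed
    then have "smooth_on (?h ` V) (\<lambda>y. inv_into V \<psi> (\<kappa> y))"
      by (rule smooth_on_compose[OF _ V(6)]) (use \<kappa>h in auto)
    then have "smooth_on (?h ` V) (inv_into ?U ?h)"
    proof (rule smooth_on_cong)
      fix y assume "y \<in> ?h ` V"
      then obtain A where "A \<in> V" "y = ?h A" by blast
      then show "inv_into V \<psi> (\<kappa> y) = inv_into ?U ?h y"
        using \<kappa>h inv\<psi> inv VU by (metis subsetD)
    qed
    moreover obtain W where W: "open W" "?h ` V = \<phi> ` U \<inter> W" using ohV unfolding openin_open by blast
    moreover have "y0 \<in> W" using A0(2) d(2) W(2) by blast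
    ultimately show "\<exists>W. open W \<and> y0 \<in> W \<and> smooth_on (\<phi> ` U \<inter> W) (inv_into ?U ?h)"
      by (intro exI[of _ W]) simp
  qed
  show ?thesis
    unfolding chart_of_iff him using U oU injh smh smi by simp
qed

lemma P_inj: "U \<subseteq> proj ` G \<Longrightarrow> V \<subseteq> proj ` G \<Longrightarrow> P ` U \<inter> P ` V = P ` (U \<inter> V)"
  by (rule inj_on_image_Int[symmetric, of P "proj ` G"]) (rule inj_on_inverseI[of _ F], rule F_P)

text \<open>All requirements are carried over from \<open>N\<close>: the homeomorphism transports
  the topological ones, and \<open>chart_from_GH\<close> turns coordinate changes of the quotient
  into coordinate changes of \<open>N\<close>.\<close>

lemma smooth_manifold_GH: "smooth_manifold d GH"
proof -
  have mN: "smooth_manifold d (submanifold_structure N)"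
    by (rule smooth_manifold_of_charted[OF chartedN])
  have hs: "top_of_set N homeomorphic_space Q"
    using homeo unfolding homeomorphic_space_def by blast
  have cU: "U \<subseteq> proj ` G" if "(U, S, \<phi>) \<in> charts GH" for U S \<phi>
    using that openin_Q_subset by (simp add: charts_GH_iff)
  show ?thesis
    unfolding smooth_manifold_def mtop_GH
  proof (intro conjI)
    show "Hausdorff_space Q"
      using homeomorphic_Hausdorff_space[OF hs] by (simp add: Hausdorff_space_subtopology)
    show "second_countable Q"
      using homeomorphic_space_second_countability[OF hs] second_countable_top_of_set by blast
    have "openin Q U \<and> subspace S \<and> dim S = d \<and>
        openin (top_of_set S) (\<phi> ` U) \<and> homeomorphic_map (subtopology Q U) (top_of_set (\<phi> ` U)) \<phi>"
      if c: "(U, S, \<phi>) \<in> charts GH" for U S \<phi>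
    proof -
      have "dim S = d" by (rule smooth_manifold_dim[OF mN chart_from_GH[OF c]])
      then show ?thesis using c by (simp add: charts_GH_iff)
    qed
    then show "\<forall>(U, S, \<phi>)\<in>charts GH. openin Q U \<and> subspace S \<and> dim S = d \<and>
        openin (top_of_set S) (\<phi> ` U) \<and> homeomorphic_map (subtopology Q U) (top_of_set (\<phi> ` U)) \<phi>"
      by blast
    show "(\<Union>(U, S, \<phi>)\<in>charts GH. U) = topspace Q"
    proof
      show "(\<Union>(U, S, \<phi>)\<in>charts GH. U) \<subseteq> topspace Q" 
        unfolding topspace_coset_topology using cU by blast
      show "topspace Q \<subseteq> (\<Union>(U, S, \<phi>)\<in>charts GH. U)"
      proof
        fix \<kappa> assume "\<kappa> \<in> topspace Q"
        then have k: "\<kappa> \<in> proj ` G" by (simp add: topspace_coset_topology)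
        then obtain U S \<psi> where c: "chart_of N U S \<psi>" "P \<kappa> \<in> U"
          using chartedN P_mem unfolding charted_def by blast
        have "\<kappa> \<in> F ` U" using c(2) F_P[OF k] by (metis image_eqI)
        then show "\<kappa> \<in> (\<Union>(U, S, \<phi>)\<in>charts GH. U)" using chart_to_GH[OF c(1)] by blast
      qed
    qed
    have "smooth_on (\<phi> ` (U \<inter> V)) (\<psi> \<circ> inv_into U \<phi>)"
      if c: "(U, S, \<phi>) \<in> charts GH" and d: "(V, T, \<psi>) \<in> charts GH" for U S \<phi> V T \<psi>
    proof -
      note c' = chart_from_GH[OF c] and d' = chart_from_GH[OF d]
      have inj: "inj_on (\<phi> \<circ> F) (P ` U)" using c' by (simp add: chart_of_iff)
      have sm: "smooth_on ((\<phi> \<circ> F) ` (P ` U \<inter> P ` V)) ((\<psi> \<circ> F) \<circ> inv_into (P ` U) (\<phi> \<circ> F))"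
        by (rule smooth_manifold_transition[OF mN c' d'])
      have UV: "U \<inter> V \<subseteq> proj ` G" using cU[OF c] by blast
      have im: "(\<phi> \<circ> F) ` (P ` U \<inter> P ` V) = \<phi> ` (U \<inter> V)"
        unfolding P_inj[OF cU[OF c] cU[OF d]] image_comp[symmetric] FP_image[OF UV] ..
      have inj\<phi>: "inj_on \<phi> U"
        using c by (auto simp: charts_GH_iff homeomorphic_eq_everything_map topspace_coset_topology inf.absorb2 cU[OF c])
      show ?thesis using sm[unfolded im]
      proof (rule smooth_on_cong)
        fix z assume "z \<in> \<phi> ` (U \<inter> V)"
        then obtain \<kappa> where \<kappa>: "\<kappa> \<in> U" "\<kappa> \<in> V" "z = \<phi> \<kappa>" by blast
        then have Fk: "F (P \<kappa>) = \<kappa>" using F_P cU[OF c] by blast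
        then have "inv_into (P ` U) (\<phi> \<circ> F) z = P \<kappa>"
          using \<kappa> inv_into_f_f[OF inj, of "P \<kappa>"] by simp
        then show "(\<psi> \<circ> F \<circ> inv_into (P ` U) (\<phi> \<circ> F)) z = (\<psi> \<circ> inv_into U \<phi>) z"
          using Fk \<kappa> inv_into_f_f[OF inj\<phi>, of \<kappa>] by simp
      qed
    qed
    then show "\<forall>(U, S, \<phi>)\<in>charts GH. \<forall>(V, T, \<psi>)\<in>charts GH. smooth_on (\<phi> ` (U \<inter> V)) (\<psi> \<circ> inv_into U \<phi>)"
      by blast
  qed
qed

text \<open>Read in charts transported by \<open>chart_from_GH\<close>, both \<open>F\<close> and
  \<open>P\<close> are coordinate changes of \<open>N\<close>.\<close>

theorem diffeomorphic_homogeneous_space: "diffeomorphic (submanifold_structure N) GH"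
  unfolding diffeomorphic_def
proof (intro conjI exI)
  show mN: "smooth_manifold d (submanifold_structure N)"
    by (rule smooth_manifold_of_charted[OF chartedN])
  show "smooth_manifold d GH" by (rule smooth_manifold_GH)
  have cU: "U \<subseteq> proj ` G" if "(U, S, \<phi>) \<in> charts GH" for U S \<phi>
    using that openin_Q_subset by (simp add: charts_GH_iff)
  have compat: "smooth_on (\<phi> ` (U \<inter> V)) (\<psi> \<circ> inv_into U \<phi>)"
    if "chart_of N U S \<phi>" "chart_of N V T \<psi>" for U S \<phi> V T \<psi>
    by (rule smooth_manifold_transition[OF mN that])
  have "smooth_on (\<phi> ` (U \<inter> F -` V)) (\<psi> \<circ> F \<circ> inv_into U \<phi>)"
    if c: "chart_of N U S \<phi>" and d: "(V, T, \<psi>) \<in> charts GH" for U S \<phi> V T \<psi>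
  proof -
    have UN: "U \<subseteq> N" using c openin_imp_subset by (auto simp: chart_of_iff)
    have "U \<inter> F -` V = U \<inter> P ` V"
    proof
      show "U \<inter> F -` V \<subseteq> U \<inter> P ` V" using P_F UN by (auto simp: image_iff) (metis subsetD)
      show "U \<inter> P ` V \<subseteq> U \<inter> F -` V" using F_P cU[OF d] by auto
    qed
    then show ?thesis using compat[OF c chart_from_GH[OF d]] by simp
  qed
  then show "smooth_map (submanifold_structure N) GH F"
    unfolding smooth_map_def mtop_submanifold_structure mtop_GH
    using homeomorphic_imp_continuous_map[OF homeoF] by blast
  have "smooth_on (\<phi> ` (U \<inter> P -` V)) (\<psi> \<circ> P \<circ> inv_into U \<phi>)"
    if c: "(U, S, \<phi>) \<in> charts GH" and d: "chart_of N V T \<psi>" for U S \<phi> V T \<psi>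
  proof -
    note c' = chart_from_GH[OF c]
    have inj: "inj_on (\<phi> \<circ> F) (P ` U)" using c' by (simp add: chart_of_iff)
    have inj\<phi>: "inj_on \<phi> U"
      using c by (auto simp: charts_GH_iff homeomorphic_eq_everything_map topspace_coset_topology inf.absorb2 cU[OF c])
    have "P ` U \<inter> V = P ` (U \<inter> P -` V)" by blast
    moreover have UV: "U \<inter> P -` V \<subseteq> proj ` G" using cU[OF c] by blast
    ultimately have im: "(\<phi> \<circ> F) ` (P ` U \<inter> V) = \<phi> ` (U \<inter> P -` V)"
      by (simp only: image_comp[symmetric] FP_image[OF UV])
    show ?thesis using compat[OF c' d, unfolded im]
    proof (rule smooth_on_cong)
      fix z assume "z \<in> \<phi> ` (U \<inter> P -` V)"
      then obtain \<kappa> where \<kappa>: "\<kappa> \<in> U" "P \<kappa> \<in> V" "z = \<phi> \<kappa>" by blast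
      then have Fk: "F (P \<kappa>) = \<kappa>" using F_P cU[OF c] by blast
      then have "inv_into (P ` U) (\<phi> \<circ> F) z = P \<kappa>"
        using \<kappa> inv_into_f_f[OF inj, of "P \<kappa>"] by simp
      then show "(\<psi> \<circ> inv_into (P ` U) (\<phi> \<circ> F)) z = (\<psi> \<circ> P \<circ> inv_into U \<phi>) z"
        using \<kappa> inv_into_f_f[OF inj\<phi>, of \<kappa>] by simp
    qed
  qed
  then show "smooth_map GH (submanifold_structure N) P"
    unfolding smooth_map_def mtop_submanifold_structure mtop_GH
    using homeomorphic_imp_continuous_map[OF homeoP] by blast
  show "\<forall>x\<in>topspace (mtop (submanifold_structure N)). P (F x) = x"
    by (simp add: mtop_submanifold_structure P_F)
  show "\<forall>y\<in>topspace (mtop GH). F (P y) = y"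
    by (simp add: mtop_GH topspace_coset_topology F_P)
qed

end

section \<open>Gluing simply connected pieces\<close>

text \<open>The part of \<open>\<gamma>\<close> up to \<open>s\<close> has been deformed into
  \<open>A\<close>; the next segment lies in \<open>A\<close> and is appended. If the new endpoint
  is also in \<open>B\<close>, simple connectivity of \<open>A\<close> allows the result to be
  replaced by a path inside \<open>A \<inter> B\<close>, so that the next segment may run in
  \<open>B\<close>.\<close>

lemma van_kampen_step:
  fixes A B X :: "'a::real_normed_vector set"
  assumes A: "simply_connected A" and AX: "A \<subseteq> X" and AB: "path_connected (A \<inter> B)" "x0 \<in> A \<inter> B"
    and \<gamma>: "path \<gamma>" "path_image \<gamma> \<subseteq> X" "pathstart \<gamma> = x0"
    and st: "0 \<le> s" "s \<le> t" "t \<le> 1" and seg: "\<gamma> ` {s..t} \<subseteq> A"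
    and r: "path r" "path_image r \<subseteq> A" "pathstart r = x0" "pathfinish r = \<gamma> s"
      "homotopic_paths X (subpath 0 s \<gamma>) r"
  shows "\<exists>r. path r \<and> path_image r \<subseteq> A \<and> pathstart r = x0 \<and> pathfinish r = \<gamma> t \<and>
            homotopic_paths X (subpath 0 t \<gamma>) r"
    and "\<gamma> t \<in> B \<Longrightarrow> \<exists>r. path r \<and> path_image r \<subseteq> B \<and> pathstart r = x0 \<and> pathfinish r = \<gamma> t \<and>
            homotopic_paths X (subpath 0 t \<gamma>) r"
proof -
  let ?q = "subpath s t \<gamma>"
  define r1 where "r1 = r +++ ?q"
  have q: "path ?q" "path_image ?q \<subseteq> A" "pathstart ?q = \<gamma> s" "pathfinish ?q = \<gamma> t"
    using \<gamma>(1) st seg by (simp_all add: path_image_subpath)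
  have r1: "path r1" "path_image r1 \<subseteq> A" "pathstart r1 = x0" "pathfinish r1 = \<gamma> t"
    using r q by (simp_all add: r1_def path_image_join)
  have "homotopic_paths X (subpath 0 s \<gamma> +++ ?q) (subpath 0 t \<gamma>)"
    by (rule homotopic_join_subpaths1[OF \<gamma>(1,2)]) (use st in auto)
  moreover have "homotopic_paths X (subpath 0 s \<gamma> +++ ?q) r1"
    unfolding r1_def
  proof (rule homotopic_paths_join[OF r(5)])
    show "homotopic_paths X ?q ?q" using q(1,2) AX by simp
    show "pathfinish (subpath 0 s \<gamma>) = pathstart ?q" by simp
  qed
  ultimately have hr1: "homotopic_paths X (subpath 0 t \<gamma>) r1"
    using homotopic_paths_sym homotopic_paths_trans by blast
  then show "\<exists>r. path r \<and> path_image r \<subseteq> A \<and> pathstart r = x0 \<and> pathfinish r = \<gamma> t \<and>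
            homotopic_paths X (subpath 0 t \<gamma>) r"
    using r1 by blast
  assume tB: "\<gamma> t \<in> B"
  have "\<gamma> t \<in> A" using seg st by auto
  then obtain w where w: "path w" "path_image w \<subseteq> A \<inter> B" "pathstart w = x0" "pathfinish w = \<gamma> t"
    using AB tB unfolding path_connected_def by blast
  have "homotopic_paths A r1 w"
    using A r1 w unfolding simply_connected_eq_homotopic_paths by simp
  then have "homotopic_paths X r1 w" using AX homotopic_paths_subset by blast
  then show "\<exists>r. path r \<and> path_image r \<subseteq> B \<and> pathstart r = x0 \<and> pathfinish r = \<gamma> t \<and>
            homotopic_paths X (subpath 0 t \<gamma>) r"
    using w hr1 homotopic_paths_trans by (intro exI[of _ w]) auto
qed

text \<open>A loop is followed in steps shorter than a Lebesgue number of the cover. The invariant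
  is that the part up to \<open>t\<close> deforms, inside the union, to a path within each of
  \<open>A\<close> and \<open>B\<close> that contains \<open>\<gamma> t\<close>; at the end the loop
  lies in \<open>A\<close> and contracts.\<close>

lemma simply_connected_Un:
  fixes A B :: "'a::real_normed_vector set"
  assumes oA: "openin (top_of_set (A \<union> B)) A" and oB: "openin (top_of_set (A \<union> B)) B"
    and A: "simply_connected A" and B: "simply_connected B" and AB: "path_connected (A \<inter> B)"
    and ne: "A \<inter> B \<noteq> {}"
  shows "simply_connected (A \<union> B)"
proof -
  define X where "X = A \<union> B"
  obtain x0 where x0: "x0 \<in> A \<inter> B" using ne by blast
  have pcX: "path_connected X"
    unfolding X_def using A B ne by (intro path_connected_Un simply_connected_imp_path_connected)
  have AX: "A \<subseteq> X" "B \<subseteq> X" by (auto simp: X_def)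
  have loop: "homotopic_paths X \<gamma> (linepath x0 x0)"
    if \<gamma>: "path \<gamma>" "path_image \<gamma> \<subseteq> X" "pathstart \<gamma> = x0" "pathfinish \<gamma> = x0" for \<gamma>
  proof -
    define R where "R C t \<longleftrightarrow> (\<exists>r. path r \<and> path_image r \<subseteq> C \<and> pathstart r = x0 \<and> pathfinish r = \<gamma> t \<and>
            homotopic_paths X (subpath 0 t \<gamma>) r)" for C t
    have cont: "continuous_on {0..1} \<gamma>" using \<gamma>(1) by (simp add: path_def)
    have im: "\<gamma> ` {0..1} \<subseteq> X" using \<gamma>(2) by (simp add: path_image_def)
    have "\<exists>W. open W \<and> {0..1} \<inter> \<gamma> -` C = {0..1} \<inter> W" if "openin (top_of_set X) C" for C
      using continuous_openin_preimage[OF cont _ that] im unfolding openin_open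
      by (auto simp: image_subset_iff_funcset)
    then obtain WA WB where W: "open WA" "{0..1} \<inter> \<gamma> -` A = {0..1} \<inter> WA"
      "open WB" "{0..1} \<inter> \<gamma> -` B = {0..1} \<inter> WB"
      using oA oB unfolding X_def by metis
    have c1: "{0..1} \<subseteq> \<Union>{WA, WB}"
    proof
      fix t :: real assume t: "t \<in> {0..1}"
      then have "\<gamma> t \<in> A \<or> \<gamma> t \<in> B" using im unfolding X_def by blast
      then have "t \<in> {0..1} \<inter> \<gamma> -` A \<or> t \<in> {0..1} \<inter> \<gamma> -` B" using t by simp
      then show "t \<in> \<Union>{WA, WB}" unfolding W(2,4) by auto
    qed
    have c2: "open G" if "G \<in> {WA, WB}" for G using that W(1,3) by auto
    obtain \<epsilon> where \<epsilon>: "0 < \<epsilon>" "\<And>x. x \<in> {0..1} \<Longrightarrow> \<exists>G\<in>{WA, WB}. ball x \<epsilon> \<subseteq> G"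
      using Heine_Borel_lemma[OF compact_Icc c1 c2] by metis
    have step: "(\<gamma> t \<in> A \<longrightarrow> R A t) \<and> (\<gamma> t \<in> B \<longrightarrow> R B t)"
      if st: "0 \<le> s" "s \<le> t" "t \<le> 1" "t - s < \<epsilon>" and Rs: "(\<gamma> s \<in> A \<longrightarrow> R A s) \<and> (\<gamma> s \<in> B \<longrightarrow> R B s)" for s t
    proof -
      have sub: "{s..t} \<subseteq> ball s \<epsilon>" using st by (auto simp: dist_real_def)
      have sin: "s \<in> {s..t}" "{s..t} \<subseteq> {0..1}" using st by auto
      consider "ball s \<epsilon> \<subseteq> WA" | "ball s \<epsilon> \<subseteq> WB" using \<epsilon>(2)[of s] st by auto
      then show ?thesis
      proof cases
        case 1
        then have "{s..t} \<subseteq> {0..1} \<inter> \<gamma> -` A" unfolding W(2) using sub sin by blast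
        then have seg: "\<gamma> ` {s..t} \<subseteq> A" by blast
        then have "R A s" using Rs sin by blast
        then obtain r where r: "path r" "path_image r \<subseteq> A" "pathstart r = x0" "pathfinish r = \<gamma> s"
            "homotopic_paths X (subpath 0 s \<gamma>) r" unfolding R_def by blast
        show ?thesis
          using van_kampen_step[OF A AX(1) AB x0 \<gamma>(1-3) st(1-3) seg r] unfolding R_def by blast
      next
        case 2
        then have "{s..t} \<subseteq> {0..1} \<inter> \<gamma> -` B" unfolding W(4) using sub sin by blast
        then have seg: "\<gamma> ` {s..t} \<subseteq> B" by blast
        then have "R B s" using Rs sin by blast
        then obtain r where r: "path r" "path_image r \<subseteq> B" "pathstart r = x0" "pathfinish r = \<gamma> s"
            "homotopic_paths X (subpath 0 s \<gamma>) r" unfolding R_def by blast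
        have AB': "path_connected (B \<inter> A)" "x0 \<in> B \<inter> A" using AB x0 by (simp_all add: Int_commute)
        show ?thesis
          using van_kampen_step[OF B AX(2) AB' \<gamma>(1-3) st(1-3) seg r] unfolding R_def by blast
      qed
    qed
    have "\<forall>t\<in>{0..1}. t \<le> real n * (\<epsilon>/2) \<longrightarrow> (\<gamma> t \<in> A \<longrightarrow> R A t) \<and> (\<gamma> t \<in> B \<longrightarrow> R B t)" for n
    proof (induction n)
      case 0
      have g0: "\<gamma> 0 = x0" using \<gamma>(3) by (simp add: pathstart_def)
      have "R C 0" if "x0 \<in> C" "C \<subseteq> X" for C
        unfolding R_def using that g0 \<gamma>(1)
        by (intro exI[of _ "subpath 0 0 \<gamma>"]) (auto simp: path_image_subpath)
      then show ?case using x0 AX by auto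
    next
      case (Suc n)
      show ?case
      proof (intro ballI impI)
        fix t :: real assume t: "t \<in> {0..1}" "t \<le> real (Suc n) * (\<epsilon>/2)"
        \<comment> \<open>Steps of length \<open>\<epsilon>/2\<close> stay strictly below the
          Lebesgue number; the maximum keeps \<open>s\<close> in the unit interval during the first
          step.\<close>
        define s where "s = max 0 (t - \<epsilon>/2)"
        have s: "0 \<le> s" "s \<le> t" "t \<le> 1" "t - s < \<epsilon>" "s \<in> {0..1}" "s \<le> real n * (\<epsilon>/2)"
          using t \<epsilon>(1) by (auto simp: s_def max_def algebra_simps)
        then show "(\<gamma> t \<in> A \<longrightarrow> R A t) \<and> (\<gamma> t \<in> B \<longrightarrow> R B t)" using Suc.IH step[OF s(1-4)] by blast
      qed
    qed
    moreover obtain n where "1 \<le> real n * (\<epsilon>/2)"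
      using \<epsilon>(1) ex_less_of_nat_mult[of "\<epsilon>/2" 1] less_imp_le by auto
    moreover have "\<gamma> 1 \<in> A" using \<gamma>(4) x0 by (simp add: pathfinish_def)
    ultimately have "R A 1" by (metis atLeastAtMost_iff order_refl zero_le_one)
    then obtain r where r: "path r" "path_image r \<subseteq> A" "pathstart r = x0" "pathfinish r = x0"
        "homotopic_paths X \<gamma> r"
      unfolding R_def using \<gamma>(4) by (auto simp: pathfinish_def)
    have "homotopic_paths A r (linepath x0 x0)"
      using A r unfolding simply_connected_eq_contractible_path by metis
    then show ?thesis using r(5) AX(1) homotopic_paths_subset homotopic_paths_trans by blast
  qed
  have "\<exists>a. a \<in> X \<and> homotopic_loops X p (linepath a a)"
    if p: "path p" "path_image p \<subseteq> X" "pathfinish p = pathstart p" for p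
  proof -
    have "pathstart p \<in> X" using p(2) pathstart_in_path_image by blast
    then obtain r where r: "path r" "path_image r \<subseteq> X" "pathstart r = x0" "pathfinish r = pathstart p"
      using pcX x0 AX unfolding path_connected_def by blast
    \<comment> \<open>A loop with another base point is freely homotopic to its conjugate based at
      \<open>x0\<close>.\<close>
    define \<gamma> where "\<gamma> = r +++ p +++ reversepath r"
    have "homotopic_loops X \<gamma> p"
      unfolding \<gamma>_def by (rule homotopic_loops_conjugate) (use p r in auto)
    moreover have "homotopic_paths X \<gamma> (linepath x0 x0)"
      by (rule loop) (use p r in \<open>auto simp: \<gamma>_def path_image_join\<close>)
    then have "homotopic_loops X \<gamma> (linepath x0 x0)"
      by (rule homotopic_paths_imp_homotopic_loops) (use r in \<open>auto simp: \<gamma>_def\<close>)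
    ultimately show ?thesis using x0 AX homotopic_loops_sym homotopic_loops_trans by blast
  qed
  then show ?thesis
    unfolding simply_connected_eq_contractible_loop_some using pcX unfolding X_def by blast
qed

lemma connected_subset_open_partition:
  assumes "connected C" "C \<subseteq> P \<union> Q" "P \<inter> Q = {}" "openin (top_of_set X) P" "openin (top_of_set X) Q"
  shows "C \<subseteq> P \<or> C \<subseteq> Q"
proof -
  obtain W1 W2 where W: "open W1" "P = X \<inter> W1" "open W2" "Q = X \<inter> W2"
    using assms(4,5) unfolding openin_open by blast
  have "W1 \<inter> C = {} \<or> W2 \<inter> C = {}"
    by (rule connectedD[OF assms(1) W(1,3)]) (use assms(2,3) W in blast)+
  then show ?thesis using assms(2) W by blast
qed

text \<open>The statement carried through the induction on the dimension. The pieces stay unnamed,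
  since the trivialisations are not compared by orientation; the Pfaffian identifies them at the
  end.\<close>

definition two_sc_pieces :: "'a::real_normed_vector set \<Rightarrow> bool" where
  "two_sc_pieces X \<longleftrightarrow> (\<exists>E1 E2. X = E1 \<union> E2 \<and> E1 \<inter> E2 = {} \<and> E1 \<noteq> {} \<and> E2 \<noteq> {} \<and>
     openin (top_of_set X) E1 \<and> openin (top_of_set X) E2 \<and> simply_connected E1 \<and> simply_connected E2)"

text \<open>\<open>D1\<close> and \<open>D2\<close> meet the union of the primed pieces in connected
  sets, so each meets just one of them. Every primed piece is met, so this is a bijection, and each
  matched pair is glued by \<open>simply_connected_Un\<close>.\<close>

lemma two_sc_pieces_glue:
  assumes X: "X = D1 \<union> D2 \<union> (D1' \<union> D2')" and dis: "D1 \<inter> D2 = {}" "D1' \<inter> D2' = {}"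
    and op: "openin (top_of_set X) D1" "openin (top_of_set X) D2" "openin (top_of_set X) D1'" "openin (top_of_set X) D2'"
    and sc: "simply_connected D1" "simply_connected D2" "simply_connected D1'" "simply_connected D2'"
    and pc: "path_connected (D1 \<inter> (D1' \<union> D2'))" "path_connected (D2 \<inter> (D1' \<union> D2'))"
    and ne: "D1 \<inter> (D1' \<union> D2') \<noteq> {}" "D2 \<inter> (D1' \<union> D2') \<noteq> {}" "D1' \<inter> (D1 \<union> D2) \<noteq> {}" "D2' \<inter> (D1 \<union> D2) \<noteq> {}"
  shows "two_sc_pieces X"
proof -
  have main: "two_sc_pieces X"
    if X: "X = D1 \<union> D2 \<union> (D1' \<union> D2')" and dis': "D1' \<inter> D2' = {}" and op': "openin (top_of_set X) D1'" "openin (top_of_set X) D2'"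
      and sc': "simply_connected D1'" "simply_connected D2'"
      and pc: "path_connected (D1 \<inter> (D1' \<union> D2'))" "path_connected (D2 \<inter> (D1' \<union> D2'))"
      and ne: "D1 \<inter> (D1' \<union> D2') \<noteq> {}" "D2 \<inter> (D1' \<union> D2') \<noteq> {}" "D2' \<inter> (D1 \<union> D2) \<noteq> {}"
      and sub: "D1 \<inter> (D1' \<union> D2') \<subseteq> D1'" for D1' D2'
  proof -
    have "D2 \<inter> (D1' \<union> D2') \<subseteq> D1' \<or> D2 \<inter> (D1' \<union> D2') \<subseteq> D2'"
      by (rule connected_subset_open_partition[OF path_connected_imp_connected[OF pc(2)] _ dis' op']) blast
    \<comment> \<open>\<open>D2'\<close> misses \<open>D1\<close> but must meet
      \<open>D1 \<union> D2\<close>, so \<open>D2\<close> cannot be matched with \<open>D1'\<close>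
      as well.\<close>
    then have sub2: "D2 \<inter> (D1' \<union> D2') \<subseteq> D2'" using sub ne(3) dis' by blast
    have i1: "D1 \<inter> D1' = D1 \<inter> (D1' \<union> D2')" and i2: "D2 \<inter> D2' = D2 \<inter> (D1' \<union> D2')" using sub sub2 by blast+
    have X12: "X = (D1 \<union> D1') \<union> (D2 \<union> D2')" using X by blast
    have s1: "D1 \<union> D1' \<subseteq> X" and s2: "D2 \<union> D2' \<subseteq> X" using X by blast+
    have "simply_connected (D1 \<union> D1')"
      using op(1) op'(1) s1 sc(1) sc'(1) pc(1) ne(1)
      by (intro simply_connected_Un) (auto simp: i1 intro: openin_subset_trans)
    moreover have "simply_connected (D2 \<union> D2')"
      using op(2) op'(2) s2 sc(2) sc'(2) pc(2) ne(2)
      by (intro simply_connected_Un) (auto simp: i2 intro: openin_subset_trans)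
    moreover have "(D1 \<union> D1') \<inter> (D2 \<union> D2') = {}" using dis(1) dis' sub sub2 by blast
    moreover have "openin (top_of_set X) (D1 \<union> D1')" "openin (top_of_set X) (D2 \<union> D2')"
      using op op' by (auto intro: openin_Un)
    moreover have "D1 \<union> D1' \<noteq> {}" "D2 \<union> D2' \<noteq> {}" using ne by blast+
    ultimately show ?thesis unfolding two_sc_pieces_def using X12 by blast
  qed
  have "D1 \<inter> (D1' \<union> D2') \<subseteq> D1' \<or> D1 \<inter> (D1' \<union> D2') \<subseteq> D2'"
    by (rule connected_subset_open_partition[OF path_connected_imp_connected[OF pc(1)] _ dis(2) op(3,4)]) blast
  then show ?thesis
  proof
    assume "D1 \<inter> (D1' \<union> D2') \<subseteq> D1'"
    then show ?thesis by (rule main[OF X dis(2) op(3,4) sc(3,4) pc ne(1,2,4)])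
  next
    assume "D1 \<inter> (D1' \<union> D2') \<subseteq> D2'"
    then show ?thesis
      using main[of D2' D1'] X dis(2) op(3,4) sc(3,4) pc ne(1-3) by (simp add: Un_commute Int_commute)
  qed
qed

lemma components_two_pieces:
  assumes "X = E1 \<union> E2" "E1 \<inter> E2 = {}" "E1 \<noteq> {}" "E2 \<noteq> {}" "openin (top_of_set X) E1" "openin (top_of_set X) E2"
    "connected E1" "connected E2"
  shows "components X = {E1, E2}"
proof -
  have "E1 \<in> components X"
    unfolding in_components_maximal
  proof (intro conjI allI impI)
    fix D assume D: "D \<noteq> {} \<and> E1 \<subseteq> D \<and> D \<subseteq> X \<and> connected D"
    then have "D \<subseteq> E1 \<or> D \<subseteq> E2"
      using connected_subset_open_partition[OF _ _ assms(2,5,6)] assms(1) by blast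
    then show "D = E1" using D assms(2,3) by blast
  qed (use assms in auto)
  moreover have "E2 \<in> components X"
    unfolding in_components_maximal
  proof (intro conjI allI impI)
    fix D assume D: "D \<noteq> {} \<and> E2 \<subseteq> D \<and> D \<subseteq> X \<and> connected D"
    then have "D \<subseteq> E1 \<or> D \<subseteq> E2"
      using connected_subset_open_partition[OF _ _ assms(2,5,6)] assms(1) by blast
    then show "D = E2" using D assms(2,4) by blast
  qed (use assms in auto)
  moreover have "C = E1 \<or> C = E2" if C: "C \<in> components X" for C
  proof -
    have "C \<noteq> {}" "C \<subseteq> X" using C in_components_nonempty in_components_subset by blast+
    then have "C \<inter> E1 \<noteq> {} \<or> C \<inter> E2 \<noteq> {}" using assms(1) by blast
    then show ?thesis using components_eq[OF C] \<open>E1 \<in> components X\<close> \<open>E2 \<in> components X\<close> by blast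
  qed
  ultimately show ?thesis by blast
qed

section \<open>Complex structures on subspaces\<close>

lemma matrix_vector_inner: "(A *v x) \<bullet> y = x \<bullet> (transpose A *v y)" for A :: "real^'n^'m"
  by (metis dot_lmul_matrix inner_commute transpose_matrix_vector)

lemma inner_matrix_vector_skew:
  fixes A :: "real^'n^'n"
  assumes "transpose A = - A" shows "(A *v x) \<bullet> y = - (x \<bullet> (A *v y))"
proof -
  have "(A *v x) \<bullet> y = x \<bullet> ((- A) *v y)" unfolding matrix_vector_inner assms ..
  also have "(- A) *v y = - (A *v y)"
    using matrix_vector_mult_diff_rdistrib[of 0 A y] by simp
  finally show ?thesis by simp
qed

definition outer :: "real^'n \<Rightarrow> real^'n \<Rightarrow> real^'n^'n" where
  "outer u v = (\<chi> i j. u $ i * v $ j)"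

lemma outer_mult: "outer u v *v x = (v \<bullet> x) *\<^sub>R u"
  by (simp add: outer_def matrix_vector_mult_def vec_eq_iff inner_vec_def sum_distrib_left mult_ac)

lemma transpose_outer: "transpose (outer u v) = outer v u"
  by (simp add: outer_def transpose_def vec_eq_iff mult.commute)

lemma continuous_on_outer[continuous_intros]:
  assumes "continuous_on S f" "continuous_on S g"
  shows "continuous_on S (\<lambda>x. outer (f x) (g x))"
  unfolding outer_def using assms by (intro continuous_intros)

lemma continuous_on_matrix_matrix_mult[continuous_intros]:
  "continuous_on S f \<Longrightarrow> continuous_on S g \<Longrightarrow> continuous_on S (\<lambda>x. f x ** g x :: real^'p^'m)"
  for f :: "_ \<Rightarrow> real^'n^'m"
  by (rule bounded_bilinear.continuous_on[OF bounded_bilinear_matrix_mult])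

lemma continuous_on_matrix_vector[continuous_intros]:
  "continuous_on S f \<Longrightarrow> continuous_on S (\<lambda>x. f x *v v)" for f :: "_ \<Rightarrow> real^'n^'m"
  unfolding matrix_vector_mult_def by (intro continuous_intros)

text \<open>The reflection in the hyperplane orthogonal to \<open>m\<close>; for
  \<open>m = 0\<close> it is the identity.\<close>

definition refl_mat :: "real^'n \<Rightarrow> real^'n^'n" where
  "refl_mat m = mat 1 - (2 / (m \<bullet> m)) *\<^sub>R outer m m"

lemma refl_mat_mult: "refl_mat m *v x = x - (2 * (m \<bullet> x) / (m \<bullet> m)) *\<^sub>R m"
  by (simp add: refl_mat_def matrix_vector_mult_diff_rdistrib outer_mult flip: scaleR_matrix_vector_assoc)

lemma transpose_refl_mat: "transpose (refl_mat m) = refl_mat m"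
proof -
  have "transpose (refl_mat m) = transpose (mat 1) - (2 / (m \<bullet> m)) *\<^sub>R transpose (outer m m)"
    unfolding refl_mat_def by (simp add: linear_diff[OF linear_transpose] linear_scale[OF linear_transpose])
  then show ?thesis by (simp add: transpose_outer refl_mat_def)
qed

lemma refl_mat_involution: "m \<noteq> 0 \<Longrightarrow> refl_mat m *v (refl_mat m *v x) = x"
  by (simp add: refl_mat_mult inner_diff_right)

lemma refl_mat_fix: "m \<bullet> x = 0 \<Longrightarrow> refl_mat m *v x = x"
  by (simp add: refl_mat_mult)

text \<open>For two vectors of equal length the hyperplane orthogonal to their difference is their
  bisector. The coefficients of the reflection formula come out as 1 and -1.\<close>

lemma refl_mat_swap:
  assumes "norm v = 1" "norm w = 1" "v \<noteq> w"
  shows "refl_mat (v - w) *v v = w" "refl_mat (v - w) *v w = v"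
proof -
  have vw: "v \<bullet> v = 1" "w \<bullet> w = 1" using assms by (simp_all add: norm_eq_1)
  have mm: "(v - w) \<bullet> (v - w) = 2 - 2 * (v \<bullet> w)"
    by (simp add: inner_diff_left inner_diff_right vw inner_commute)
  have ne: "2 - 2 * (v \<bullet> w) \<noteq> 0" using mm assms(3) by (metis inner_eq_zero_iff right_minus_eq)
  have r1: "2 * ((v - w) \<bullet> v) = 2 - 2 * (v \<bullet> w)" and r2: "2 * ((v - w) \<bullet> w) = - (2 - 2 * (v \<bullet> w))"
    unfolding inner_diff_left vw inner_commute[of w v] by simp_all
  have c1: "2 * ((v - w) \<bullet> v) / ((v - w) \<bullet> (v - w)) = 1"
    unfolding mm r1 by (rule divide_self[OF ne])
  have c2: "2 * ((v - w) \<bullet> w) / ((v - w) \<bullet> (v - w)) = -1"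
    unfolding mm r2 minus_divide_left[symmetric] divide_self[OF ne] ..
  show "refl_mat (v - w) *v v = w" "refl_mat (v - w) *v w = v"
    unfolding refl_mat_mult c1 c2 by simp_all
qed

lemma continuous_on_refl_mat[continuous_intros]:
  assumes "continuous_on S f" "\<And>x. x \<in> S \<Longrightarrow> f x \<noteq> 0"
  shows "continuous_on S (\<lambda>x. refl_mat (f x))"
  unfolding refl_mat_def using assms by (intro continuous_intros) auto

text \<open>Complex structures of a subspace are stored as matrices of full size that vanish on its
  orthogonal complement, so that the induction over subspaces stays within one matrix type.\<close>

definition cstructs :: "(real^'n) set \<Rightarrow> (real^'n^'n) set" where
  "cstructs V = {A. transpose A = - A \<and> (\<forall>v\<in>V. A *v (A *v v) = - v) \<and>
                    (\<forall>v. (\<forall>u\<in>V. u \<bullet> v = 0) \<longrightarrow> A *v v = 0)}"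

text \<open>The range of a skew matrix is orthogonal to its kernel, which here contains the
  complement of \<open>V\<close>.\<close>

lemma cstructs_range:
  assumes "A \<in> cstructs V" "subspace V" shows "A *v x \<in> V"
proof -
  have "(A *v x) \<bullet> u = 0" if "\<forall>y\<in>V. y \<bullet> u = 0" for u
  proof -
    have "A *v u = 0" "transpose A = - A" using assms(1) that by (auto simp: cstructs_def)
    then show ?thesis using inner_matrix_vector_skew[of A x u] by simp
  qed
  then have "A *v x \<in> (V\<^sup>\<bottom>)\<^sup>\<bottom>"
    by (auto simp: orthogonal_comp_def orthogonal_def inner_commute)
  then show ?thesis using orthogonal_comp_self[OF assms(2)] by simp
qed

lemma cstructs_unit:
  assumes "A \<in> cstructs V" "e \<in> V" "norm e = 1"
  shows "norm (A *v e) = 1" "(A *v e) \<bullet> e = 0"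
proof -
  have sk: "transpose A = - A" and sq: "A *v (A *v e) = - e" using assms by (auto simp: cstructs_def)
  show "(A *v e) \<bullet> e = 0" using inner_matrix_vector_skew[OF sk, of e e] by (simp add: inner_commute)
  have "(A *v e) \<bullet> (A *v e) = 1"
    using inner_matrix_vector_skew[OF sk, of e "A *v e"] sq assms(3) by (simp add: norm_eq_1)
  then show "norm (A *v e) = 1" by (simp add: norm_eq_1)
qed

lemma cstructs_conj_refl:
  assumes A: "A \<in> cstructs V" and V: "subspace V" and m: "m \<in> V" "m \<noteq> 0"
  shows "refl_mat m ** A ** refl_mat m \<in> cstructs V"
proof -
  let ?R = "refl_mat m"
  have sk: "transpose A = - A" and sq: "\<And>v. v \<in> V \<Longrightarrow> A *v (A *v v) = - v"
    and ker: "\<And>v. \<forall>u\<in>V. u \<bullet> v = 0 \<Longrightarrow> A *v v = 0" using A by (auto simp: cstructs_def)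
  have RV: "?R *v v \<in> V" if "v \<in> V" for v
    using that m V by (simp add: refl_mat_mult subspace_diff subspace_scale)
  have ap: "(?R ** A ** ?R) *v v = ?R *v (A *v (?R *v v))" for v
    by (simp add: matrix_vector_mul_assoc matrix_mul_assoc)
  have tr: "transpose (?R ** A ** ?R) = - (?R ** A ** ?R)"
    by (simp add: matrix_transpose_mul transpose_refl_mat sk matrix_mul_assoc
        linear_neg[OF linear_matrix_mult_right] linear_neg[OF linear_matrix_mult_left])
  have "(?R ** A ** ?R) *v ((?R ** A ** ?R) *v v) = - v" if "v \<in> V" for v
  proof -
    have "(?R ** A ** ?R) *v ((?R ** A ** ?R) *v v) = ?R *v (A *v (A *v (?R *v v)))"
      unfolding ap refl_mat_involution[OF m(2)] ..
    also have "\<dots> = ?R *v (- (?R *v v))" using sq[OF RV[OF that]] by simp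
    also have "\<dots> = - (?R *v (?R *v v))" by (rule linear_neg[OF matrix_vector_mul_linear])
    finally show ?thesis using refl_mat_involution[OF m(2)] by simp
  qed
  moreover have "(?R ** A ** ?R) *v v = 0" if "\<forall>u\<in>V. u \<bullet> v = 0" for v
    using refl_mat_fix[of m v] that m(1) ker[OF that] by (simp add: ap)
  ultimately show ?thesis using tr by (simp add: cstructs_def)
qed

lemma refl_mat_square: "m \<noteq> 0 \<Longrightarrow> refl_mat m ** refl_mat m = mat 1"
  by (simp add: matrix_eq refl_mat_involution flip: matrix_vector_mul_assoc)

lemma refl_mat_conj_conj: "m \<noteq> 0 \<Longrightarrow> refl_mat m ** (refl_mat m ** X ** refl_mat m) ** refl_mat m = X"
proof -
  assume m: "m \<noteq> 0"
  have "refl_mat m ** (refl_mat m ** X ** refl_mat m) ** refl_mat m =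
     (refl_mat m ** refl_mat m) ** X ** (refl_mat m ** refl_mat m)"
    by (simp only: matrix_mul_assoc)
  then show ?thesis by (simp add: refl_mat_square[OF m])
qed

section \<open>Trivialisation over a punctured sphere\<close>

locale cs_fibration =
  fixes V :: "(real^'n) set" and e w :: "real^'n"
  assumes V: "subspace V" and e: "e \<in> V" "norm e = 1" and w: "w \<in> V" "norm w = 1" and we: "w \<bullet> e = 0"
begin

definition "V' = {x \<in> V. x \<bullet> e = 0 \<and> x \<bullet> w = 0}"
definition "S0 = {v \<in> V. v \<bullet> e = 0 \<and> norm v = 1}"
text \<open>The quarter turn of the plane of \<open>e\<close> and \<open>w\<close>: the part shared
  by all complex structures that take \<open>e\<close> to \<open>w\<close>.\<close>

definition "B0 = outer w e - outer e w"
text \<open>\<open>B0\<close> plus a structure of the fibre takes \<open>e\<close> to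
  \<open>w\<close>. The reflection exchanges \<open>v\<close> and \<open>w\<close> and fixes
  \<open>e\<close>, because \<open>v\<close> and \<open>w\<close> are orthogonal to
  \<open>e\<close>; so the conjugate takes \<open>e\<close> to \<open>v\<close>.\<close>

definition "\<Phi> vC = (let R = refl_mat (fst vC - w) in R ** (B0 + snd vC) ** R)"
definition "\<Psi> A = (A *v e, refl_mat (A *v e - w) ** A ** refl_mat (A *v e - w) - B0)"
definition "Ow = {A \<in> cstructs V. A *v e \<noteq> w}"

lemma ee: "e \<bullet> e = 1" "w \<bullet> w = 1" "e \<bullet> w = 0"
  using e w we by (simp_all add: norm_eq_1 inner_commute)

lemma V'_subspace: "subspace V'" and V'_subset: "V' \<subseteq> V"
proof -
  show "subspace V'"
    unfolding subspace_def V'_def using V by (auto simp: subspace_0 subspace_add subspace_scale inner_add_left)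
qed (auto simp: V'_def)

lemma B0_mult: "B0 *v x = (e \<bullet> x) *\<^sub>R w - (w \<bullet> x) *\<^sub>R e"
  by (simp add: B0_def matrix_vector_mult_diff_rdistrib outer_mult)

lemma transpose_B0: "transpose B0 = - B0"
  by (simp add: B0_def linear_diff[OF linear_transpose] transpose_outer)

lemma B0_V': "x \<in> V' \<Longrightarrow> B0 *v x = 0"
  by (simp add: B0_mult V'_def inner_commute)

lemma V'_part: "x \<in> V \<Longrightarrow> x - (x \<bullet> e) *\<^sub>R e - (x \<bullet> w) *\<^sub>R w \<in> V'"
  unfolding V'_def using V e(1) w(1) by (simp add: subspace_diff subspace_scale inner_diff_left ee we)

lemma perp_part:
  assumes x: "\<forall>u\<in>V'. u \<bullet> x = 0"
  shows "\<forall>u\<in>V. u \<bullet> (x - (x \<bullet> e) *\<^sub>R e - (x \<bullet> w) *\<^sub>R w) = 0"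
proof
  fix u assume u: "u \<in> V"
  let ?y = "x - (x \<bullet> e) *\<^sub>R e - (x \<bullet> w) *\<^sub>R w" and ?u = "u - (u \<bullet> e) *\<^sub>R e - (u \<bullet> w) *\<^sub>R w"
  have ye: "e \<bullet> ?y = 0" "w \<bullet> ?y = 0"
    by (simp_all add: inner_diff_right ee we inner_commute[of e x] inner_commute[of w x])
  have u': "?u \<in> V'" by (rule V'_part[OF u])
  then have "?u \<bullet> e = 0" "?u \<bullet> w = 0" "?u \<bullet> x = 0" using x by (auto simp: V'_def)
  then have "?u \<bullet> ?y = 0" by (simp only: inner_diff_right inner_scaleR_right)
  moreover have "u \<bullet> ?y = ?u \<bullet> ?y"
    using ye by (simp only: inner_diff_left inner_scaleR_left)
  ultimately show "u \<bullet> ?y = 0" by simp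
qed

text \<open>\<open>A\<close> maps \<open>e\<close> to \<open>w\<close> and \<open>w\<close> to
  \<open>- e\<close>, hence by skewness preserves \<open>V'\<close>, where \<open>B0\<close>
  vanishes. On the complement of \<open>V'\<close> it agrees with \<open>B0\<close>: after
  subtraction of the components along \<open>e\<close> and \<open>w\<close> such a vector is
  orthogonal to \<open>V\<close>.\<close>

lemma fibre_to:
  assumes A: "A \<in> cstructs V" and Ae: "A *v e = w" shows "A - B0 \<in> cstructs V'"
proof -
  have sk: "transpose A = - A" and sq: "\<And>v. v \<in> V \<Longrightarrow> A *v (A *v v) = - v"
    and ker: "\<And>v. \<forall>u\<in>V. u \<bullet> v = 0 \<Longrightarrow> A *v v = 0" using A by (auto simp: cstructs_def)
  have Aw: "A *v w = - e" using sq[OF e(1)] Ae by simp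
  have AV': "A *v x \<in> V'" if "x \<in> V'" for x
    using that cstructs_range[OF A V] inner_matrix_vector_skew[OF sk, of x] Ae Aw
    by (simp add: V'_def)
  have ap: "(A - B0) *v x = A *v x" if "x \<in> V'" for x
    by (simp add: matrix_vector_mult_diff_rdistrib B0_V'[OF that])
  have "transpose (A - B0) = - (A - B0)"
    by (simp add: linear_diff[OF linear_transpose] sk transpose_B0)
  moreover have "(A - B0) *v ((A - B0) *v x) = - x" if "x \<in> V'" for x
    using that ap AV' sq V'_subset by auto
  moreover have "(A - B0) *v x = 0" if x: "\<forall>u\<in>V'. u \<bullet> x = 0" for x
  proof -
    let ?y = "x - (x \<bullet> e) *\<^sub>R e - (x \<bullet> w) *\<^sub>R w"
    have "A *v ?y = 0" by (rule ker[OF perp_part[OF x]])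
    then have "A *v x - (x \<bullet> e) *\<^sub>R w + (x \<bullet> w) *\<^sub>R e = 0"
      by (simp add: matrix_vector_mult_diff_distrib matrix_vector_mult_scaleR Ae Aw)
    then have "A *v x = (x \<bullet> e) *\<^sub>R w - (x \<bullet> w) *\<^sub>R e"
      by (simp add: algebra_simps)
    then show ?thesis
      by (simp add: matrix_vector_mult_diff_rdistrib B0_mult inner_commute)
  qed
  ultimately show ?thesis by (simp add: cstructs_def)
qed

lemma fibre_from:
  assumes C: "C \<in> cstructs V'" shows "B0 + C \<in> cstructs V" "(B0 + C) *v e = w"
proof -
  have sk: "transpose C = - C" and sq: "\<And>v. v \<in> V' \<Longrightarrow> C *v (C *v v) = - v"
    and ker: "\<And>v. \<forall>u\<in>V'. u \<bullet> v = 0 \<Longrightarrow> C *v v = 0" using C by (auto simp: cstructs_def)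
  have Ce: "C *v e = 0" "C *v w = 0" using ker by (auto simp: V'_def)
  have ap: "(B0 + C) *v x = (e \<bullet> x) *\<^sub>R w - (w \<bullet> x) *\<^sub>R e + C *v x" for x
    by (simp add: matrix_vector_mult_add_rdistrib B0_mult)
  show we': "(B0 + C) *v e = w" by (simp add: ap ee we Ce)
  have ew: "(B0 + C) *v w = - e" by (simp add: ap ee we Ce)
  have "transpose (B0 + C) = - (B0 + C)"
    by (simp add: linear_add[OF linear_transpose] sk transpose_B0)
  moreover have "(B0 + C) *v ((B0 + C) *v x) = - x" if x: "x \<in> V" for x
  proof -
    obtain y a b where xeq: "x = y + a *\<^sub>R e + b *\<^sub>R w" and y: "y \<in> V'"
    proof
      show "x = (x - (x \<bullet> e) *\<^sub>R e - (x \<bullet> w) *\<^sub>R w) + (x \<bullet> e) *\<^sub>R e + (x \<bullet> w) *\<^sub>R w" by simp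
    qed (rule V'_part[OF x])
    have on: "(B0 + C) *v z = C *v z" if "z \<in> V'" for z
      using B0_V'[OF that] by (simp add: matrix_vector_mult_add_rdistrib)
    have yy: "(B0 + C) *v ((B0 + C) *v y) = - y"
      using on[OF y] on[OF cstructs_range[OF C V'_subspace]] sq[OF y] by simp
    have "(B0 + C) *v x = (B0 + C) *v y + a *\<^sub>R w + b *\<^sub>R (- e)"
      unfolding xeq by (simp only: matrix_vector_right_distrib matrix_vector_mult_scaleR we' ew)
    then have "(B0 + C) *v ((B0 + C) *v x) = - y + a *\<^sub>R (- e) + b *\<^sub>R (- w)"
      by (simp only: matrix_vector_right_distrib matrix_vector_mult_scaleR yy ew
          linear_neg[OF matrix_vector_mul_linear] we')
    then show ?thesis unfolding xeq by simp
  qed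
  moreover have "(B0 + C) *v x = 0" if x: "\<forall>u\<in>V. u \<bullet> x = 0" for x
  proof -
    have "C *v x = 0" by (rule ker) (use x V'_subset in blast)
    then show ?thesis using x e(1) w(1) by (simp add: ap)
  qed
  ultimately show "B0 + C \<in> cstructs V" by (simp add: cstructs_def)
qed

lemma S0_diff:
  assumes "v \<in> S0 - {w}"
  shows "v - w \<in> V" "v - w \<noteq> 0" "refl_mat (v - w) *v v = w" "refl_mat (v - w) *v w = v"
    "refl_mat (v - w) *v e = e"
  using assms V w e we refl_mat_swap[of v w]
  by (auto simp: S0_def subspace_diff inner_diff_left intro!: refl_mat_fix)

lemma cstructs_e_S0: "A \<in> cstructs V \<Longrightarrow> A *v e \<in> S0"
  using cstructs_unit[OF _ e] cstructs_range[OF _ V] by (simp add: S0_def)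

lemma \<Phi>_e:
  assumes "v \<in> S0 - {w}" "C \<in> cstructs V'" shows "\<Phi> (v, C) *v e = v"
  using S0_diff[OF assms(1)] fibre_from(2)[OF assms(2)]
  by (simp add: \<Phi>_def Let_def flip: matrix_vector_mul_assoc)

lemma homeomorphism_\<Phi>: "homeomorphism ((S0 - {w}) \<times> cstructs V') Ow \<Phi> \<Psi>"
proof (rule homeomorphismI)
  show "continuous_on ((S0 - {w}) \<times> cstructs V') \<Phi>"
    unfolding \<Phi>_def Let_def by (intro continuous_intros) auto
  show "continuous_on Ow \<Psi>"
    unfolding \<Psi>_def by (intro continuous_intros) (auto simp: Ow_def)
  have m: "\<Phi> (v, C) \<in> Ow" if "v \<in> S0 - {w}" "C \<in> cstructs V'" for v C
    using \<Phi>_e[OF that] cstructs_conj_refl[OF fibre_from(1)[OF that(2)] V S0_diff(1,2)[OF that(1)]] that(1)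
    by (simp add: Ow_def \<Phi>_def Let_def)
  show "\<Phi> ` ((S0 - {w}) \<times> cstructs V') \<subseteq> Ow" using m by blast
  show "\<Psi> (\<Phi> x) = x" if x: "x \<in> (S0 - {w}) \<times> cstructs V'" for x
  proof -
    obtain v C where vC: "x = (v, C)" "v \<in> S0 - {w}" "C \<in> cstructs V'" using x by blast
    have "\<Phi> (v, C) = refl_mat (v - w) ** (B0 + C) ** refl_mat (v - w)" by (simp add: \<Phi>_def Let_def)
    then have "refl_mat (v - w) ** \<Phi> (v, C) ** refl_mat (v - w) = B0 + C"
      using refl_mat_conj_conj[OF S0_diff(2)[OF vC(2)]] by simp
    then show ?thesis unfolding vC(1) \<Psi>_def \<Phi>_e[OF vC(2,3)] by simp
  qed
  have p: "A *v e \<in> S0 - {w} \<and> snd (\<Psi> A) \<in> cstructs V'" if "A \<in> Ow" for A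
  proof -
    have A: "A \<in> cstructs V" and v: "A *v e \<in> S0 - {w}" using that cstructs_e_S0 by (auto simp: Ow_def)
    let ?R = "refl_mat (A *v e - w)"
    have "(?R ** A ** ?R) *v e = w"
      using S0_diff[OF v] by (simp flip: matrix_vector_mul_assoc)
    then show ?thesis
      using fibre_to[OF cstructs_conj_refl[OF A V S0_diff(1,2)[OF v]]] v by (simp add: \<Psi>_def)
  qed
  then show "\<Psi> ` Ow \<subseteq> (S0 - {w}) \<times> cstructs V'" by (auto simp: \<Psi>_def)
  show "\<Phi> (\<Psi> A) = A" if "A \<in> Ow" for A
    using refl_mat_conj_conj[of "A *v e - w" A] that by (simp add: \<Phi>_def \<Psi>_def Let_def Ow_def)
qed

lemma openin_Ow: "openin (top_of_set (cstructs V)) Ow"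
proof -
  have "continuous_on (cstructs V) (\<lambda>A. A *v e)" by (intro continuous_intros)
  then have "openin (top_of_set (cstructs V)) (cstructs V \<inter> (\<lambda>A. A *v e) -` (- {w}))"
    by (intro continuous_openin_preimage_gen) auto
  moreover have "cstructs V \<inter> (\<lambda>A. A *v e) -` (- {w}) = Ow" by (auto simp: Ow_def)
  ultimately show ?thesis by simp
qed

text \<open>By \<open>\<Phi>_e\<close> the first coordinate is the value at \<open>e\<close>. The
  overlap with the trivialisation centred at the opposite pole is therefore the part over the sphere
  without both poles, again a product of path connected sets.\<close>

lemma piece:
  assumes E: "openin (top_of_set (cstructs V')) E" "simply_connected E" "E \<noteq> {}" and S: "simply_connected (S0 - {w})"
    and S': "path_connected (S0 - {w} - {- w})" "S0 - {w} - {- w} \<noteq> {}"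
  shows "openin (top_of_set (cstructs V)) (\<Phi> ` ((S0 - {w}) \<times> E))"
    "simply_connected (\<Phi> ` ((S0 - {w}) \<times> E))"
    "path_connected (\<Phi> ` ((S0 - {w}) \<times> E) \<inter> {A \<in> cstructs V. A *v e \<noteq> - w})"
    "\<Phi> ` ((S0 - {w}) \<times> E) \<inter> {A \<in> cstructs V. A *v e \<noteq> - w} \<noteq> {}"
proof -
  have EC: "E \<subseteq> cstructs V'" using E(1) openin_imp_subset by blast
  have "openin (top_of_set ((S0 - {w}) \<times> cstructs V')) ((S0 - {w}) \<times> E)"
    by (rule openin_Times[OF _ E(1)]) simp
  then have "openin (top_of_set Ow) (\<Phi> ` ((S0 - {w}) \<times> E))"
    by (rule homeomorphism_imp_open_map[OF homeomorphism_\<Phi>])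
  then show "openin (top_of_set (cstructs V)) (\<Phi> ` ((S0 - {w}) \<times> E))"
    using openin_Ow openin_trans by blast
  have sub: "(S0 - {w}) \<times> E \<subseteq> (S0 - {w}) \<times> cstructs V'" using EC by blast
  have im: "\<Phi> ` ((S0 - {w}) \<times> E) \<subseteq> Ow"
    using homeomorphism_\<Phi> sub unfolding homeomorphism_def by blast
  have "homeomorphism ((S0 - {w}) \<times> E) (\<Phi> ` ((S0 - {w}) \<times> E)) \<Phi> \<Psi>"
    by (rule homeomorphism_of_subsets[OF homeomorphism_\<Phi> sub im]) simp
  then have "(S0 - {w}) \<times> E homeomorphic \<Phi> ` ((S0 - {w}) \<times> E)"
    unfolding homeomorphic_def by blast
  from homeomorphic_simply_connected_eq[OF this]
  show "simply_connected (\<Phi> ` ((S0 - {w}) \<times> E))"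
    using simply_connected_Times[OF S E(2)] by simp
  have eq: "\<Phi> ` ((S0 - {w}) \<times> E) \<inter> {A \<in> cstructs V. A *v e \<noteq> - w} = \<Phi> ` ((S0 - {w} - {- w}) \<times> E)"
  proof -
    have "\<Phi> (v, C) *v e = v \<and> \<Phi> (v, C) \<in> cstructs V" if "v \<in> S0 - {w}" "C \<in> E" for v C
      using \<Phi>_e[OF that(1)] im that EC by (auto simp: Ow_def)
    then show ?thesis by (auto simp: image_iff)
  qed
  have "continuous_on ((S0 - {w} - {- w}) \<times> E) \<Phi>"
    using homeomorphism_\<Phi> EC unfolding homeomorphism_def by (blast intro: continuous_on_subset)
  then show "path_connected (\<Phi> ` ((S0 - {w}) \<times> E) \<inter> {A \<in> cstructs V. A *v e \<noteq> - w})"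
    unfolding eq using path_connected_Times[OF S'(1) simply_connected_imp_path_connected[OF E(2)]]
    by (rule path_connected_continuous_image)
  show "\<Phi> ` ((S0 - {w}) \<times> E) \<inter> {A \<in> cstructs V. A *v e \<noteq> - w} \<noteq> {}"
    unfolding eq using S'(2) E(3) by blast
qed

lemma \<Phi>_Un_Int:
  assumes "cstructs V' = E1 \<union> E2" "E1 \<inter> E2 = {}"
  shows "\<Phi> ` ((S0 - {w}) \<times> E1) \<union> \<Phi> ` ((S0 - {w}) \<times> E2) = Ow"
    "\<Phi> ` ((S0 - {w}) \<times> E1) \<inter> \<Phi> ` ((S0 - {w}) \<times> E2) = {}"
proof -
  have im: "\<Phi> ` ((S0 - {w}) \<times> cstructs V') = Ow" using homeomorphism_\<Phi> by (simp add: homeomorphism_def)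
  have inj: "inj_on \<Phi> ((S0 - {w}) \<times> cstructs V')"
    using homeomorphism_\<Phi> unfolding homeomorphism_def by (metis inj_on_inverseI)
  have "(S0 - {w}) \<times> cstructs V' = (S0 - {w}) \<times> E1 \<union> (S0 - {w}) \<times> E2" using assms by blast
  then show "\<Phi> ` ((S0 - {w}) \<times> E1) \<union> \<Phi> ` ((S0 - {w}) \<times> E2) = Ow"
    using im by (simp add: image_Un)
  have "\<Phi> ` ((S0 - {w}) \<times> E1) \<inter> \<Phi> ` ((S0 - {w}) \<times> E2) = \<Phi> ` ((S0 - {w}) \<times> E1 \<inter> (S0 - {w}) \<times> E2)"
    by (rule inj_on_image_Int[OF inj, symmetric]) (use assms in auto)
  also have "(S0 - {w}) \<times> E1 \<inter> (S0 - {w}) \<times> E2 = {}" using assms(2) by blast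
  finally show "\<Phi> ` ((S0 - {w}) \<times> E1) \<inter> \<Phi> ` ((S0 - {w}) \<times> E2) = {}" by simp
qed

lemma dim_V': "dim V' + 2 = dim V"
proof -
  have ind: "e \<noteq> w" using ee we by auto
  have ne: "e \<noteq> 0" "w \<noteq> 0" using e w by auto
  have "independent {e, w}"
    by (rule pairwise_orthogonal_independent) (use ne we in \<open>auto simp: pairwise_def orthogonal_def inner_commute\<close>)
  then have d2: "dim (span {e, w}) = 2"
    using ind by (simp add: dim_eq_card_independent)
  have eq: "{y \<in> V. \<forall>x\<in>span {e, w}. orthogonal x y} = V'"
  proof -
    have "(\<forall>x\<in>span {e, w}. orthogonal x y) \<longleftrightarrow> orthogonal e y \<and> orthogonal w y" for y
    proof
      assume "orthogonal e y \<and> orthogonal w y"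
      then show "\<forall>x\<in>span {e, w}. orthogonal x y"
        using orthogonal_to_span[of _ "{e, w}" y] by (auto simp: orthogonal_commute)
    qed (auto intro: span_base)
    then show ?thesis by (auto simp: V'_def orthogonal_def inner_commute)
  qed
  have "span {e, w} \<subseteq> V" using e w V by (simp add: span_minimal)
  from dim_subspace_orthogonal_to_vectors[OF subspace_span V this] show ?thesis
    unfolding eq d2 .
qed

lemma S0_two:
  assumes "dim V = 2" shows "S0 = {w, - w}"
proof -
  have "dim V' = 0" using dim_V' assms by simp
  then have "V' = {0}" using V'_subspace by (simp add: dim_eq_0 subspace_0 subset_singleton_iff) (use subspace_0 in blast)
  then have "v = (v \<bullet> w) *\<^sub>R w" if "v \<in> S0" for v
    using V'_part[of v] that by (auto simp: S0_def)
  then have "v = w \<or> v = - w" if "v \<in> S0" for v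
  proof -
    have v: "v = (v \<bullet> w) *\<^sub>R w" "norm v = 1" using \<open>\<And>v. v \<in> S0 \<Longrightarrow> v = (v \<bullet> w) *\<^sub>R w\<close> that by (auto simp: S0_def)
    then have "\<bar>v \<bullet> w\<bar> = 1" using w(2) by (metis mult.right_neutral norm_scaleR)
    then have "v \<bullet> w = 1 \<or> v \<bullet> w = -1" by linarith
    then show ?thesis using v(1) by (metis scaleR_minus1_left scaleR_one)
  qed
  then show ?thesis using V w we by (auto simp: S0_def subspace_neg)
qed

text \<open>Stereographic projection from \<open>w\<close> identifies the unit sphere of the
  complement of \<open>e\<close>, punctured at \<open>w\<close>, with a space of the dimension of
  \<open>V'\<close>. Deleting \<open>- w\<close> too deletes one point of it.\<close>

lemma sphere_pieces:
  assumes "4 \<le> dim V"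
  shows "simply_connected (S0 - {w})" "path_connected (S0 - {w} - {- w})" "S0 - {w} - {- w} \<noteq> {}"
proof -
  define T where "T = {v \<in> V. v \<bullet> e = 0}"
  have T: "subspace T" unfolding subspace_def T_def using V
    by (auto simp: subspace_0 subspace_add subspace_scale inner_add_left)
  have S0: "S0 - {w} = (sphere 0 1 \<inter> T) - {w}" by (auto simp: S0_def T_def)
  have dT: "dim T + 1 = dim V"
  proof -
    have "e \<noteq> 0" using e by auto
    then have d1: "dim (span {e}) = 1" by (simp add: dim_eq_card_independent)
    have "(\<forall>x\<in>span {e}. orthogonal x y) \<longleftrightarrow> orthogonal e y" for y
    proof
      assume "orthogonal e y"
      then show "\<forall>x\<in>span {e}. orthogonal x y"
        using orthogonal_to_span[of _ "{e}" y] by (auto simp: orthogonal_commute)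
    qed (auto intro: span_base)
    then have eq: "{y \<in> V. \<forall>x\<in>span {e}. orthogonal x y} = T" by (auto simp: T_def orthogonal_def inner_commute)
    have "span {e} \<subseteq> V" using e V by (simp add: span_minimal)
    from dim_subspace_orthogonal_to_vectors[OF subspace_span V this] show ?thesis
      unfolding eq d1 .
  qed
  have aff: "aff_dim T = aff_dim V' + 1"
    using dT dim_V' by (simp add: aff_dim_subspace T V'_subspace)
  have hom: "S0 - {w} homeomorphic V'"
    unfolding S0
    by (rule homeomorphic_punctured_affine_sphere_affine[OF _ _ _ _ _ _ aff])
      (use w we T V'_subspace subspace_0[OF V] in \<open>auto simp: subspace_imp_affine T_def\<close>)
  then show "simply_connected (S0 - {w})"
    using homeomorphic_simply_connected_eq[OF hom] convex_imp_simply_connected subspace_imp_convex[OF V'_subspace] by blast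
  obtain f g where fg: "homeomorphism (S0 - {w}) V' f g" using hom unfolding homeomorphic_def by blast
  have mw: "- w \<in> S0 - {w}"
  proof -
    have "- w \<noteq> w" using ee(2) by (metis inner_minus_left minus_equation_iff neg_equal_iff_equal one_neq_neg_one)
    then show ?thesis using V w we by (simp add: S0_def subspace_neg)
  qed
  have inj: "inj_on f (S0 - {w})" using fg unfolding homeomorphism_def by (metis inj_on_inverseI)
  have fim: "f ` (S0 - {w} - {- w}) = V' - {f (- w)}"
    using inj_on_image_set_diff[OF inj, of "S0 - {w}" "{- w}"] mw fg by (simp add: homeomorphism_def)
  have "homeomorphism (S0 - {w} - {- w}) (V' - {f (- w)}) f g"
    by (rule homeomorphism_of_subsets[OF fg _ _ fim]) auto
  then have h2: "S0 - {w} - {- w} homeomorphic V' - {f (- w)}" unfolding homeomorphic_def by blast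
  \<comment> \<open>A convex set without one point is path connected unless it is one-dimensional;
    here \<open>V'\<close> has dimension at least 2.\<close>
  have "aff_dim V' \<noteq> 1" using dim_V' assms by (simp add: aff_dim_subspace V'_subspace)
  then have "path_connected (V' - {f (- w)})"
    by (rule path_connected_punctured_convex[OF subspace_imp_convex[OF V'_subspace]])
  then show "path_connected (S0 - {w} - {- w})"
    using homeomorphic_path_connectedness[OF h2] by simp
  have "V' \<noteq> {f (- w)}"
  proof
    assume "V' = {f (- w)}"
    then have "V' = {0}" using subspace_0[OF V'_subspace] by (metis singletonD)
    then have "dim V' = 0" by simp
    then show False using dim_V' assms by linarith
  qed
  moreover have "V' \<noteq> {}" using subspace_0[OF V'_subspace] by blast
  ultimately have "V' - {f (- w)} \<noteq> {}" by blast
  then show "S0 - {w} - {- w} \<noteq> {}" unfolding fim[symmetric] by blast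
qed

end

section \<open>Induction on the dimension\<close>

lemma cs_fibration_exists:
  fixes V :: "(real^'n) set"
  assumes V: "subspace V" and d: "2 \<le> dim V"
  obtains e w where "cs_fibration V e w"
proof -
  obtain B where B: "B \<subseteq> V" "pairwise orthogonal B" "\<And>x. x \<in> B \<Longrightarrow> norm x = 1" "card B = dim V"
    using orthonormal_basis_subspace[OF V] by metis
  then obtain e w where "e \<in> B" "w \<in> B" "e \<noteq> w"
    using d by (metis card_le_Suc0_iff_eq card.infinite not_less_eq_eq numeral_2_eq_2 not_numeral_le_zero)
  then have "cs_fibration V e w"
    using B V by (auto simp: cs_fibration_def pairwise_def orthogonal_def)
  then show ?thesis using that by blast
qed

text \<open>In dimension 2 the sphere consists of \<open>w\<close> and \<open>- w\<close>, the two
  trivialisations do not overlap, and the structures are just \<open>B0\<close> and its negative.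
  From dimension 4 on the two punctured spheres overlap in a path connected set and the gluing lemma
  applies.\<close>

lemma two_sc_pieces_cstructs:
  fixes V :: "(real^'n) set"
  assumes "subspace V" "dim V = 2 * n + 2"
  shows "two_sc_pieces (cstructs V)"
  using assms
proof (induction n arbitrary: V)
  case 0
  then obtain e w where "cs_fibration V e w" using cs_fibration_exists[of V] by auto
  then interpret F: cs_fibration V e w .
  have S0: "F.S0 = {w, - w}" using F.S0_two 0 by simp
  have V'0: "F.V' = {0}"
    using F.dim_V' 0 F.V'_subspace dim_eq_0 subspace_0 by (metis add_cancel_left_left add_cancel_right_left mult_0_right subset_singleton_iff empty_iff)
  have C0: "cstructs F.V' = {0}"
  proof -
    have "A = 0" if "A \<in> cstructs F.V'" for A
      using that unfolding V'0 cstructs_def by (auto simp: matrix_eq)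
    moreover have "(0::real^'n^'n) \<in> cstructs F.V'"
      by (simp add: V'0 cstructs_def linear_0[OF linear_transpose])
    ultimately show ?thesis by blast
  qed
  have B: "F.B0 \<in> cstructs V" "F.B0 *v e = w" using F.fibre_from[of 0] C0 by auto
  have nB: "- F.B0 \<in> cstructs V"
  proof -
    have neg: "(- X) *v v = - (X *v v)" for X :: "real^'n^'n" and v
      using matrix_vector_mult_diff_rdistrib[of 0 X v] by simp
    show ?thesis
      using B(1) unfolding cstructs_def
      by (simp add: neg linear_neg[OF linear_transpose] linear_neg[OF matrix_vector_mul_linear])
  qed
  have "A = F.B0 \<or> A = - F.B0" if A: "A \<in> cstructs V" for A
  proof -
    have neg: "(- A) *v v = - (A *v v)" for v
      using matrix_vector_mult_diff_rdistrib[of 0 A v] by simp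
    consider "A *v e = w" | "A *v e = - w" using F.cstructs_e_S0[OF A] S0 by blast
    then show ?thesis
    proof cases
      case 1
      then have "A - F.B0 = 0" using F.fibre_to[OF A] C0 by blast
      then show ?thesis by simp
    next
      case 2
      have "- A \<in> cstructs V"
        using A unfolding cstructs_def
        by (simp add: neg linear_neg[OF linear_transpose] linear_neg[OF matrix_vector_mul_linear])
      moreover have "(- A) *v e = w" using 2 by (simp add: neg)
      ultimately have "- A - F.B0 = 0" using F.fibre_to C0 by blast
      then have "A = - F.B0" by (metis add.inverse_inverse right_minus_eq)
      then show ?thesis by simp
    qed
  qed
  then have CV: "cstructs V = {F.B0} \<union> {- F.B0}" using B nB by blast
  have ne: "F.B0 \<noteq> - F.B0"
  proof
    assume "F.B0 = - F.B0"
    then have "F.B0 = 0" by (metis (no_types) add.right_inverse  scaleR_half_double scaleR_zero_right)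
    then show False using B(2) F.w by auto
  qed
  have o: "openin (top_of_set (cstructs V)) {F.B0}" "openin (top_of_set (cstructs V)) {- F.B0}"
  proof -
    have "{F.B0} = cstructs V \<inter> (- {- F.B0})" "{- F.B0} = cstructs V \<inter> (- {F.B0})" using CV ne by auto
    then show "openin (top_of_set (cstructs V)) {F.B0}" "openin (top_of_set (cstructs V)) {- F.B0}"
      by (metis closed_singleton open_Compl openin_open_Int)+
  qed
  show ?case
    unfolding two_sc_pieces_def
    using CV ne o convex_imp_simply_connected[OF convex_singleton] by (intro exI[of _ "{F.B0}"] exI[of _ "{- F.B0}"]) auto
next
  case (Suc n)
  then obtain e w where "cs_fibration V e w" using cs_fibration_exists[of V] by auto
  then interpret F: cs_fibration V e w .
  \<comment> \<open>The trivialisation away from the opposite pole. It has the same sphere and the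
    same fibre space, so one pair \<open>E1\<close>, \<open>E2\<close> from the induction hypothesis
    serves both.\<close>
  interpret G: cs_fibration V e "- w"
    using F.V F.e F.w F.we by unfold_locales (auto simp: subspace_neg)
  have GV': "G.V' = F.V'" by (simp add: F.V'_def G.V'_def)
  have GS0: "G.S0 = F.S0" by (simp add: F.S0_def G.S0_def)
  have "dim F.V' = 2 * n + 2" using F.dim_V' Suc.prems by simp
  then obtain E1 E2 where E: "cstructs F.V' = E1 \<union> E2" "E1 \<inter> E2 = {}" "E1 \<noteq> {}" "E2 \<noteq> {}"
    "openin (top_of_set (cstructs F.V')) E1" "openin (top_of_set (cstructs F.V')) E2"
    "simply_connected E1" "simply_connected E2"
    using Suc.IH[OF F.V'_subspace] unfolding two_sc_pieces_def by blast
  have d4: "4 \<le> dim V" using Suc.prems by simp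
  note SF = F.sphere_pieces[OF d4] and SG = G.sphere_pieces[OF d4]
  note F1 = F.piece[OF E(5,7,3) SF] and F2 = F.piece[OF E(6,8,4) SF]
  note G1 = G.piece[unfolded GV', OF E(5,7,3) SG] and G2 = G.piece[unfolded GV', OF E(6,8,4) SG]
  note FU = F.\<Phi>_Un_Int[OF E(1,2)] and GU = G.\<Phi>_Un_Int[unfolded GV', OF E(1,2)]
  have FO: "{A \<in> cstructs V. A *v e \<noteq> - w} = G.Ow" "{A \<in> cstructs V. A *v e \<noteq> - (- w)} = F.Ow"
    by (simp_all add: F.Ow_def G.Ow_def)
  have cov: "cstructs V = F.Ow \<union> G.Ow"
  proof -
    have "w \<noteq> - w" using F.ee(2) by (metis inner_minus_left minus_equation_iff one_neq_neg_one)
    then show ?thesis by (auto simp: F.Ow_def G.Ow_def)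
  qed
  note GO = GU(1)[symmetric] and FO' = FU(1)[symmetric]
  have X: "cstructs V = F.\<Phi> ` ((F.S0 - {w}) \<times> E1) \<union> F.\<Phi> ` ((F.S0 - {w}) \<times> E2) \<union>
      (G.\<Phi> ` ((G.S0 - {- w}) \<times> E1) \<union> G.\<Phi> ` ((G.S0 - {- w}) \<times> E2))"
    unfolding FU(1) GU(1) by (rule cov)
  show ?case
    by (rule two_sc_pieces_glue[OF X FU(2) GU(2) F1(1) F2(1) G1(1) G2(1) F1(2) F2(2) G1(2) G2(2)
          F1(3)[unfolded FO(1) GO] F2(3)[unfolded FO(1) GO] F1(4)[unfolded FO(1) GO] F2(4)[unfolded FO(1) GO]
          G1(4)[unfolded FO(2) FO'] G2(4)[unfolded FO(2) FO']])
qed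

section \<open>The Pfaffian\<close>

lemma one_neq_two_mod2: "(1::2) \<noteq> 2" "(2::2) \<noteq> 1"
  by simp_all

lemma UNIV_block: "(UNIV :: ('m \<times> 2) set) = UNIV \<times> {1, 2}"
  using UNIV_2 by auto

lemma prod_UNIV_block:
  fixes g :: "'m::finite \<times> 2 \<Rightarrow> real"
  shows "(\<Prod>j\<in>UNIV. g j) = (\<Prod>i\<in>UNIV. g (i, 1) * g (i, 2))"
proof -
  have "(\<Prod>i\<in>UNIV. \<Prod>a\<in>{1, 2}. g (i, a)) = prod g (UNIV \<times> {1, 2})"
    by (subst prod.cartesian_product) simp
  then show ?thesis unfolding UNIV_block by simp
qed

lemma conj_entry:
  fixes Q A :: "real^'n^'n"
  shows "(Q ** A ** transpose Q) $ a $ b =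
    (\<Sum>kl\<in>UNIV. Q $ a $ fst kl * Q $ b $ snd kl * A $ fst kl $ snd kl)"
proof -
  have "(Q ** A ** transpose Q) $ a $ b = (\<Sum>l\<in>UNIV. \<Sum>k\<in>UNIV. Q $ a $ k * A $ k $ l * Q $ b $ l)"
    by (simp add: matrix_matrix_mult_def transpose_def sum_distrib_right)
  also have "\<dots> = (\<Sum>k\<in>UNIV. \<Sum>l\<in>UNIV. Q $ a $ k * A $ k $ l * Q $ b $ l)"
    by (rule sum.swap)
  also have "\<dots> = (\<Sum>kl\<in>UNIV \<times> UNIV. Q $ a $ fst kl * A $ fst kl $ snd kl * Q $ b $ snd kl)"
    by (simp add: sum.cartesian_product split_beta)
  finally show ?thesis by (simp add: mult_ac)
qed

text \<open>The left side is the determinant of \<open>Q\<close> with columns selected by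
  \<open>f\<close>. A repeated column makes it vanish, a permutation contributes its sign.\<close>

lemma sum_sign_columns:
  fixes Q :: "real^'n^'n"
  shows "(\<Sum>p | p permutes UNIV. of_int (sign p) * (\<Prod>j\<in>UNIV. Q $ p j $ f j)) =
    (if f permutes UNIV then of_int (sign f) * det Q else 0)"
proof -
  let ?B = "\<chi> i j. Q $ i $ f j"
  have d: "(\<Sum>p | p permutes UNIV. of_int (sign p) * (\<Prod>j\<in>UNIV. Q $ p j $ f j)) = det ?B"
    unfolding trans[OF det_transpose[symmetric] det_def]
    by (simp add: transpose_def)
  show ?thesis
  proof (cases "f permutes UNIV")
    case True
    then show ?thesis unfolding d by (simp add: det_permute_columns)
  next
    case False
    then have "\<not> inj f" by (metis bij_imp_permutes bij_betw_def finite_UNIV_inj_surj finite UNIV_I iso_tuple_UNIV_I)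
    then obtain j k where jk: "j \<noteq> k" "f j = f k" by (auto simp: inj_on_def)
    have "det ?B = 0"
      by (rule det_identical_columns[OF jk(1)]) (simp add: column_def jk(2))
    then show ?thesis unfolding d using False by simp
  qed
qed

text \<open>Each factor of the Pfaffian is expanded as a sum over pairs of indices. Exchanging
  summations leaves, for every map \<open>f\<close> of the indices, the sum evaluated by
  \<open>sum_sign_columns\<close>; only permutations survive, and what remains is the Pfaffian of
  \<open>A\<close>.\<close>

theorem pfaffian_conj:
  fixes Q A :: "'m::finite block_matrix"
  shows "pfaffian (Q ** A ** transpose Q) = det Q * pfaffian A"
proof -
  \<comment> \<open>A choice of one pair of indices per block is the same as a single map of all
    indices; \<open>F\<close> is this bijection.\<close>
  define F :: "('m \<Rightarrow> ('m \<times> 2) \<times> ('m \<times> 2)) \<Rightarrow> 'm \<times> 2 \<Rightarrow> 'm \<times> 2" where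
    "F h = (\<lambda>j. if snd j = 1 then fst (h (fst j)) else snd (h (fst j)))" for h
  define a where "a f = (\<Prod>i\<in>UNIV. A $ f (i, 1) $ f (i, 2))" for f :: "'m \<times> 2 \<Rightarrow> 'm \<times> 2"
  let ?D = "\<lambda>f. \<Sum>p | p permutes UNIV. of_int (sign p) * (\<Prod>j\<in>UNIV. Q $ p j $ f j)"
  have two: "j = (fst j, 1) \<or> j = (fst j, 2)" for j :: "'m \<times> 2"
    using exhaust_2[of "snd j"] by (metis prod.collapse)
  have bijF: "bij F"
  proof (rule bij_betw_byWitness[where f' = "\<lambda>f i. (f (i, 1), f (i, 2))"])
    show "\<forall>h\<in>UNIV. (\<lambda>i. (F h (i, 1), F h (i, 2))) = h" by (simp add: F_def)
    show "\<forall>f\<in>UNIV. F (\<lambda>i. (f (i, 1), f (i, 2))) = f"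
    proof (intro ballI ext)
      fix f :: "'m \<times> 2 \<Rightarrow> 'm \<times> 2" and j
      show "F (\<lambda>i. (f (i, 1), f (i, 2))) j = f j"
        using two[of j] unfolding F_def by (metis fst_conv one_neq_two_mod2(2) snd_conv)
    qed
  qed auto
  have expand: "(\<Prod>i\<in>UNIV. (Q ** A ** transpose Q) $ p (i, 1) $ p (i, 2)) =
      (\<Sum>h\<in>UNIV. a (F h) * (\<Prod>j\<in>UNIV. Q $ p j $ F h j))" for p :: "'m \<times> 2 \<Rightarrow> 'm \<times> 2"
    unfolding conj_entry
    by (subst prod_sum_PiE) (simp_all add: prod_UNIV_block a_def F_def prod.distrib mult_ac)
  have "(\<Sum>p | p permutes UNIV. of_int (sign p) *
        (\<Prod>i\<in>UNIV. (Q ** A ** transpose Q) $ p (i, 1) $ p (i, 2))) =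
      (\<Sum>p | p permutes UNIV. \<Sum>h\<in>UNIV. a (F h) * (of_int (sign p) * (\<Prod>j\<in>UNIV. Q $ p j $ F h j)))"
    unfolding expand by (simp add: sum_distrib_left mult_ac)
  also have "\<dots> = (\<Sum>h\<in>UNIV. a (F h) * ?D (F h))"
    by (subst sum.swap) (simp add: sum_distrib_left)
  also have "\<dots> = (\<Sum>f\<in>UNIV. a f * ?D f)"
    by (rule sum.reindex_bij_betw[OF bijF, of "\<lambda>f. a f * ?D f"])
  also have "\<dots> = (\<Sum>f\<in>UNIV. if f permutes UNIV then det Q * (of_int (sign f) * a f) else 0)"
    unfolding sum_sign_columns by (intro sum.cong refl) auto
  also have "\<dots> = (\<Sum>f | f permutes UNIV. det Q * (of_int (sign f) * a f))"
    by (simp add: sum.If_cases)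
  finally show ?thesis
    unfolding pfaffian_def a_def by (simp add: sum_distrib_left)
qed

text \<open>The permutations of the indices that carry blocks to blocks: \<open>\<sigma>\<close>
  moves the blocks, and the two positions are exchanged in the blocks belonging to
  \<open>E\<close>.\<close>

definition block_perm :: "('m \<Rightarrow> 'm) \<Rightarrow> 'm set \<Rightarrow> 'm \<times> 2 \<Rightarrow> 'm \<times> 2" where
  "block_perm \<sigma> E j = (\<sigma> (fst j), if fst j \<in> E then (if snd j = 1 then 2 else 1) else snd j)"

lemma block_perm_comp: "block_perm \<sigma> {} \<circ> block_perm id E = block_perm \<sigma> E"
  by (auto simp: block_perm_def fun_eq_iff)

lemma block_perm_flip: "block_perm id E (block_perm id E j) = j"
proof -
  have "snd j = 1 \<or> snd j = 2" using exhaust_2 by blast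
  then show ?thesis by (cases j) (auto simp: block_perm_def)
qed

lemma permutes_UNIV_iff_bij: "p permutes UNIV \<longleftrightarrow> bij p"
  by (metis UNIV_I bij_imp_permutes permutes_bij)

lemma block_perm_permutes:
  assumes "\<sigma> permutes (UNIV :: 'm::finite set)"
  shows "block_perm \<sigma> E permutes UNIV"
proof -
  have "bij (block_perm id E)" by (rule o_bij[of "block_perm id E"]) (auto simp: block_perm_flip)
  moreover have "bij \<sigma>" using assms permutes_bij by blast
  then have "bij (block_perm \<sigma> {})"
    by (intro o_bij[of "block_perm (inv \<sigma>) {}"]) (auto simp: block_perm_def fun_eq_iff bij_is_inj bij_is_surj surj_f_inv_f)
  ultimately show ?thesis
    unfolding permutes_UNIV_iff_bij block_perm_comp[symmetric, of \<sigma> E] using bij_comp by blast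
qed

lemma permutation_UNIV: "p permutes (UNIV :: 'n::finite set) \<Longrightarrow> permutation p"
  using permutes_imp_permutation[OF finite] by blast

lemma sign_block_flip: "sign (block_perm id (E :: 'm::finite set)) = (-1) ^ card E"
proof -
  have "finite E" by simp
  then show ?thesis
  proof (induction E rule: finite_induct)
    case empty
    have "block_perm id {} = (id :: 'm \<times> 2 \<Rightarrow> 'm \<times> 2)" by (auto simp: block_perm_def fun_eq_iff)
    from arg_cong[OF this, of sign] show ?case by (simp only: sign_id card.empty power_0)
  next
    case (insert i E)
    have eq: "block_perm id (insert i E) = Transposition.transpose (i, 1) (i, 2) \<circ> block_perm id E"
    proof
      fix j :: "'m \<times> 2"
      have "snd j = 1 \<or> snd j = 2" using exhaust_2 by blast
      then show "block_perm id (insert i E) j = (Transposition.transpose (i, 1) (i, 2) \<circ> block_perm id E) j"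
        using insert.hyps by (cases j) (auto simp: block_perm_def Transposition.transpose_def)
    qed
    have "permutation (block_perm id E)"
      by (rule permutation_UNIV[OF block_perm_permutes[OF permutes_id]])
    note sign_compose[OF permutation_swap_id this, of "(i, 1)" "(i, 2)", folded eq, unfolded insert.IH]
    moreover have "(if (i, 1::2) = (i, 2) then 1 else - 1) * (- 1) ^ card E = (- 1 :: int) ^ card (insert i E)"
      using insert.hyps by simp
    ultimately show ?case unfolding sign_swap_id by (rule trans)
  qed
qed

text \<open>A permutation of the blocks is the product of its actions on the first and on the second
  positions; these two are conjugate, so their signs cancel.\<close>

lemma sign_block_shift:
  assumes \<sigma>: "\<sigma> permutes (UNIV :: 'm::finite set)"
  shows "sign (block_perm \<sigma> {}) = 1"
proof -
  define \<tau> where "\<tau> = (block_perm id UNIV :: 'm \<times> 2 \<Rightarrow> 'm \<times> 2)"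
  define p1 where "p1 s j = (if snd j = 1 then (s (fst j), snd j) else j)" for s and j :: "'m \<times> 2"
  have bs: "bij \<sigma>" using \<sigma> permutes_bij by blast
  have "bij (p1 \<sigma>)"
    by (rule o_bij[of "p1 (inv \<sigma>)"])
      (auto simp: p1_def fun_eq_iff bs bij_is_inj bij_is_surj surj_f_inv_f)
  then have p1: "permutation (p1 \<sigma>)" using permutation_UNIV permutes_UNIV_iff_bij by blast
  have \<tau>: "permutation \<tau>" unfolding \<tau>_def by (rule permutation_UNIV[OF block_perm_permutes[OF permutes_id]])
  have "block_perm \<sigma> {} = p1 \<sigma> \<circ> (\<tau> \<circ> (p1 \<sigma> \<circ> \<tau>))"
  proof
    fix j :: "'m \<times> 2"
    have "snd j = 1 \<or> snd j = 2" using exhaust_2 by blast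
    then show "block_perm \<sigma> {} j = (p1 \<sigma> \<circ> (\<tau> \<circ> (p1 \<sigma> \<circ> \<tau>))) j"
      by (cases j) (auto simp: block_perm_def p1_def \<tau>_def)
  qed
  then have "sign (block_perm \<sigma> {}) = sign (p1 \<sigma>) * (sign \<tau> * (sign (p1 \<sigma>) * sign \<tau>))"
    using p1 \<tau> by (simp add: sign_compose permutation_compose)
  also have "\<dots> = (sign (p1 \<sigma>) * sign (p1 \<sigma>)) * (sign \<tau> * sign \<tau>)" by (simp only: mult_ac)
  finally show ?thesis by simp
qed

lemma J_entry: "J $ r $ c = (if fst r = fst c then E0 $ snd r $ snd c else 0)"
  by (simp add: J_def)

lemma E0_entries: "E0 $ 1 $ 1 = 0" "E0 $ 1 $ 2 = 1" "E0 $ 2 $ 1 = -1" "E0 $ 2 $ 2 = 0"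
  by (simp_all add: E0_def vector_2)

text \<open>A term is nonzero only if the permutation carries blocks to blocks. Each flipped block
  contributes -1 to the product and -1 to the sign, while moving blocks is even, so every such term
  is 1; their number is the denominator.\<close>

theorem pfaffian_J: "pfaffian (J :: 'm::finite block_matrix) = 1"
proof -
  define t where "t p = of_int (sign p) * (\<Prod>i\<in>UNIV. (J :: 'm block_matrix) $ p (i, 1) $ p (i, 2))"
    for p :: "'m \<times> 2 \<Rightarrow> 'm \<times> 2"
  define S where "S = {\<sigma>. \<sigma> permutes (UNIV :: 'm set)} \<times> (UNIV :: 'm set set)"
  let ?b = "\<lambda>(\<sigma>, E). block_perm \<sigma> E :: 'm \<times> 2 \<Rightarrow> 'm \<times> 2"
  have t1: "t (block_perm \<sigma> E) = 1" if \<sigma>: "\<sigma> permutes UNIV" for \<sigma> E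
  proof -
    have "(\<Prod>i\<in>UNIV. (J :: 'm block_matrix) $ block_perm \<sigma> E (i, 1) $ block_perm \<sigma> E (i, 2)) =
        (\<Prod>i\<in>UNIV. if i \<in> E then -1 else 1)"
      by (intro prod.cong refl) (simp add: J_entry block_perm_def E0_entries)
    also have "\<dots> = (-1) ^ card E" by (simp add: prod.If_cases)
    finally have "(\<Prod>i\<in>UNIV. (J :: 'm block_matrix) $ block_perm \<sigma> E (i, 1) $ block_perm \<sigma> E (i, 2)) = (-1) ^ card E" .
    moreover have "sign (block_perm \<sigma> E) = (-1) ^ card E"
    proof -
      have "sign (block_perm \<sigma> {} \<circ> block_perm id E) = sign (block_perm \<sigma> {}) * sign (block_perm id E)"
        by (intro sign_compose permutation_UNIV block_perm_permutes \<sigma> permutes_id)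
      then show ?thesis by (simp add: block_perm_comp sign_block_shift[OF \<sigma>] sign_block_flip)
    qed
    ultimately show ?thesis by (simp add: t_def flip: power_mult_distrib)
  qed
  have inj: "inj_on ?b S"
  proof (rule inj_onI, clarify)
    fix \<sigma> \<sigma>' :: "'m \<Rightarrow> 'm" and E E'
    assume eq: "block_perm \<sigma> E = block_perm \<sigma>' E'"
    have "\<sigma> i = \<sigma>' i \<and> (i \<in> E \<longleftrightarrow> i \<in> E')" for i
      using fun_cong[OF eq, of "(i, 1)"] by (auto simp: block_perm_def split: if_splits)
    then show "\<sigma> = \<sigma>' \<and> E = E'" by auto
  qed
  \<comment> \<open>A nonzero entry of \<open>J\<close> forces the two images of a block into a
    common block and at different positions.\<close>
  have cover: "p \<in> ?b ` S" if p: "p permutes UNIV" and nz: "t p \<noteq> 0" for p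
  proof -
    define \<sigma> where "\<sigma> i = fst (p (i, 1))" for i
    define E where "E = {i. snd (p (i, 1)) = 2}"
    have ent: "(J :: 'm block_matrix) $ p (i, 1) $ p (i, 2) \<noteq> 0" for i
      using nz by (auto simp: t_def)
    have s1: "snd (p (i, 1)) = 1 \<or> snd (p (i, 1)) = 2" "snd (p (i, 2)) = 1 \<or> snd (p (i, 2)) = 2" for i
      using exhaust_2 by blast+
    have e1: "p (i, 1) = (\<sigma> i, if i \<in> E then 2 else 1)" for i
      using s1[of i] by (auto simp: \<sigma>_def E_def prod_eq_iff)
    have e2: "p (i, 2) = (\<sigma> i, if i \<in> E then 1 else 2)" for i
    proof -
      have "fst (p (i, 1)) = fst (p (i, 2))" "E0 $ snd (p (i, 1)) $ snd (p (i, 2)) \<noteq> 0"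
        using ent[of i] by (auto simp: J_entry split: if_splits)
      then show ?thesis using s1[of i] by (auto simp: \<sigma>_def E_def prod_eq_iff E0_entries)
    qed
    have pj: "p j = block_perm \<sigma> E j" for j
    proof -
      have "snd j = 1 \<or> snd j = 2" using exhaust_2 by blast
      then show ?thesis using e1[of "fst j"] e2[of "fst j"] by (cases j) (auto simp: block_perm_def)
    qed
    have "surj \<sigma>"
    proof (rule surjI[of _ "\<lambda>k. fst (inv p (k, 1))"])
      fix k
      have "p (inv p (k, 1)) = (k, 1)" using p by (simp add: permutes_surj surj_f_inv_f)
      then show "\<sigma> (fst (inv p (k, 1))) = k" unfolding pj by (simp add: block_perm_def)
    qed
    then have "\<sigma> permutes UNIV"
      unfolding permutes_UNIV_iff_bij bij_def using finite_UNIV_surj_inj[of \<sigma>] by simp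
    then show ?thesis using pj by (auto simp: S_def intro!: image_eqI[of _ _ "(\<sigma>, E)"])
  qed
  have "(\<Sum>p | p permutes UNIV. t p) = (\<Sum>p\<in>?b ` S. t p)"
  proof (rule sum.mono_neutral_right)
    show "?b ` S \<subseteq> {p. p permutes UNIV}" using block_perm_permutes by (auto simp: S_def)
    show "\<forall>p\<in>{p. p permutes UNIV} - ?b ` S. t p = 0" using cover by blast
  qed (simp add: finite_permutations)
  also have "\<dots> = (\<Sum>x\<in>S. t (?b x))" using sum.reindex[OF inj, of t] by (simp add: o_def)
  also have "\<dots> = (\<Sum>x\<in>S. 1)" by (intro sum.cong refl) (auto simp: S_def t1)
  also have "\<dots> = fact CARD('m) * 2 ^ CARD('m)"
  proof -
    have "card {\<sigma>. \<sigma> permutes (UNIV :: 'm set)} = fact CARD('m)"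
      by (rule card_permutations) simp_all
    moreover have "card (UNIV :: 'm set set) = 2 ^ CARD('m)"
      using card_Pow[of "UNIV :: 'm set"] by simp
    ultimately show ?thesis by (simp add: S_def card_cartesian_product)
  qed
  finally show ?thesis unfolding pfaffian_def t_def by simp
qed

lemma continuous_on_pfaffian: "continuous_on S (pfaffian :: 'm::finite block_matrix \<Rightarrow> real)"
  unfolding pfaffian_def by (intro continuous_intros) auto

section \<open>Charts of the orthogonal complex structures and of the rotation group\<close>

lemma mat_diff_left: "(A - B) ** C = A ** C - B ** C" for A B :: "real^'n^'m" and C :: "real^'p^'n"
  by (rule linear_diff[OF linear_matrix_mult_left])
lemma mat_diff_right: "C ** (A - B) = C ** A - C ** B" for A B :: "real^'n^'m" and C :: "real^'m^'p"
  by (rule linear_diff[OF linear_matrix_mult_right])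
lemma mat_minus_left: "(- A) ** C = - (A ** C)" for A :: "real^'n^'m" and C :: "real^'p^'n"
  by (rule linear_neg[OF linear_matrix_mult_left])
lemma mat_minus_right: "C ** (- A) = - (C ** A)" for A :: "real^'n^'m" and C :: "real^'m^'p"
  by (rule linear_neg[OF linear_matrix_mult_right])
lemma mat_scaleR_left: "(c *\<^sub>R A) ** C = c *\<^sub>R (A ** C)" for A :: "real^'n^'m" and C :: "real^'p^'n"
  by (rule linear_scale[OF linear_matrix_mult_left])
lemma mat_scaleR_right: "C ** (c *\<^sub>R A) = c *\<^sub>R (C ** A)" for A :: "real^'n^'m" and C :: "real^'m^'p"
  by (rule linear_scale[OF linear_matrix_mult_right])
lemma mat_add_left: "(A + B) ** C = A ** C + B ** C" for A B :: "real^'n^'m" and C :: "real^'p^'n"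
  by (rule linear_add[OF linear_matrix_mult_left])
lemma mat_add_right: "C ** (A + B) = C ** A + C ** B" for A B :: "real^'n^'m" and C :: "real^'m^'p"
  by (rule linear_add[OF linear_matrix_mult_right])

lemmas mat_distrib = mat_diff_left mat_diff_right mat_minus_left mat_minus_right
  mat_scaleR_left mat_scaleR_right mat_add_left mat_add_right

lemma transpose_distrib:
  fixes A B :: "real^'n^'m"
  shows "transpose (A + B) = transpose A + transpose B" "transpose (A - B) = transpose A - transpose B"
    "transpose (- A) = - transpose A" "transpose (c *\<^sub>R A) = c *\<^sub>R transpose A"
  by (rule linear_add[OF linear_transpose] linear_diff[OF linear_transpose]
      linear_neg[OF linear_transpose] linear_scale[OF linear_transpose])+

lemma transpose_matrix_inv:
  fixes X :: "real^'n^'n" assumes "invertible X"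
  shows "invertible (transpose X)" "matrix_inv (transpose X) = transpose (matrix_inv X)"
proof -
  have "transpose X ** transpose (matrix_inv X) = mat 1"
    unfolding matrix_transpose_mul[symmetric] matrix_inv_left[OF assms] by simp
  then show "invertible (transpose X)" "matrix_inv (transpose X) = transpose (matrix_inv X)"
    using matrix_inv_unique by blast+
qed

lemma matrix_inv_scaleR:
  fixes X :: "real^'n^'n" assumes "invertible X" "c \<noteq> 0"
  shows "invertible (c *\<^sub>R X)" "matrix_inv (c *\<^sub>R X) = inverse c *\<^sub>R matrix_inv X"
proof -
  have "(c *\<^sub>R X) ** (inverse c *\<^sub>R matrix_inv X) = mat 1"
    using assms by (simp add: mat_distrib matrix_inv_right)
  then show "invertible (c *\<^sub>R X)" "matrix_inv (c *\<^sub>R X) = inverse c *\<^sub>R matrix_inv X"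
    using matrix_inv_unique by blast+
qed

lemma invertible_matrix_inv:
  fixes X :: "real^'n^'n" assumes "invertible X"
  shows "invertible (matrix_inv X)" "matrix_inv (matrix_inv X) = X"
  using matrix_inv_unique[OF matrix_inv_left[OF assms]] by auto

lemma matrix_sandwich_cancel:
  fixes X :: "real^'n^'n"
  assumes "invertible X" "X ** P ** X = X ** P' ** X" shows "P = P'"
proof -
  have "matrix_inv X ** (X ** P ** X) ** matrix_inv X = P" for P
  proof -
    have "matrix_inv X ** (X ** P ** X) ** matrix_inv X = (matrix_inv X ** X) ** P ** (X ** matrix_inv X)"
      by (simp only: matrix_mul_assoc)
    then show ?thesis by (simp add: matrix_inv_left[OF assms(1)] matrix_inv_right[OF assms(1)])
  qed
  then show ?thesis using assms(2) by metis
qed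

lemma orthogonal_matrixD: "orthogonal_matrix Q \<Longrightarrow> transpose Q ** Q = mat 1"
  "orthogonal_matrix Q \<Longrightarrow> Q ** transpose Q = mat 1"
  by (simp_all add: orthogonal_matrix_def)

lemma chart_ofI:
  assumes "U \<noteq> {}" "openin (top_of_set M) U" "subspace S" "openin (top_of_set S) (\<phi> ` U)"
    "smooth_on U \<phi>" "smooth_on (\<phi> ` U) \<theta>" "\<And>x. x \<in> U \<Longrightarrow> \<theta> (\<phi> x) = x"
  shows "chart_of M U S \<phi>"
proof -
  have inj: "inj_on \<phi> U" using assms(7) by (rule inj_on_inverseI)
  have "smooth_on (\<phi> ` U) (inv_into U \<phi>)"
    using assms(6) by (rule smooth_on_cong) (use inj assms(7) in auto)
  then show ?thesis using assms inj by (simp add: chart_of_iff)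
qed

text \<open>The two sets may lie in different Euclidean spaces. Charts are transported by
  \<open>g\<close>, and the model space \<open>S\<close> is moved by a linear isometry into the
  second space; the bound on \<open>d\<close> provides room for it.\<close>

lemma charted_diffeomorphic:
  fixes X :: "'a::euclidean_space set" and Y :: "'b::euclidean_space set"
  assumes X: "charted d X" and d: "d \<le> DIM('b)"
    and f: "smooth_on X f" "f ` X = Y" and g: "smooth_on Y g" "\<And>x. x \<in> X \<Longrightarrow> g (f x) = x"
  shows "diffeomorphic (submanifold_structure X) (submanifold_structure Y)"
proof -
  have gY: "g y \<in> X" "f (g y) = y" if "y \<in> Y" for y using that f(2) g(2) by auto
  have hom: "homeomorphism X Y f g"
    unfolding homeomorphism_def
    using smooth_on_imp_continuous_on[OF f(1)] smooth_on_imp_continuous_on[OF g(1)] f(2) g(2) gY by force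
  have "charted d Y"
    unfolding charted_def
  proof
    fix q assume q: "q \<in> Y"
    obtain U S \<phi> where c: "chart_of X U S \<phi>" "g q \<in> U" "dim S = d"
      using X gY(1)[OF q] unfolding charted_def by blast
    have U: "openin (top_of_set X) U" "subspace S" "openin (top_of_set S) (\<phi> ` U)" "inj_on \<phi> U"
      "smooth_on U \<phi>" "smooth_on (\<phi> ` U) (inv_into U \<phi>)"
      using c by (auto simp: chart_of_iff)
    have UX: "U \<subseteq> X" using U(1) openin_imp_subset by blast
    obtain S' :: "'b set" where S': "subspace S'" "dim S' = dim S"
      using choose_subspace_of_subspace[of d "UNIV :: 'b set"] d c(3) by auto
    obtain \<iota> \<kappa> where i: "linear \<iota>" "linear \<kappa>" "\<iota> ` S = S'" "\<kappa> ` S' = S" "\<And>x. x \<in> S \<Longrightarrow> \<kappa> (\<iota> x) = x" "\<And>x. x \<in> S' \<Longrightarrow> \<iota> (\<kappa> x) = x"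
      using isometries_subspaces[OF U(2) S'(1)] S'(2) by metis
    have \<phi>S: "\<phi> ` U \<subseteq> S" using U(3) openin_imp_subset by blast
    have homi: "homeomorphism S S' \<iota> \<kappa>"
      unfolding homeomorphism_def using i by (simp add: linear_continuous_on linear_linear)
    have im: "(\<lambda>y. \<iota> (\<phi> (g y))) ` f ` U = \<iota> ` \<phi> ` U"
      unfolding image_image by (rule image_cong) (use UX g(2) in auto)
    have "chart_of Y (f ` U) S' (\<lambda>y. \<iota> (\<phi> (g y)))"
    proof (rule chart_ofI[where \<theta> = "\<lambda>z. f (inv_into U \<phi> (\<kappa> z))"])
      show "f ` U \<noteq> {}" using c(2) by blast
      show "openin (top_of_set Y) (f ` U)" by (rule homeomorphism_imp_open_map[OF hom U(1)])
      show "subspace S'" by fact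
      show "openin (top_of_set S') ((\<lambda>y. \<iota> (\<phi> (g y))) ` f ` U)"
        unfolding im by (rule homeomorphism_imp_open_map[OF homi U(3)])
      have k\<phi>: "\<kappa> (\<iota> (\<phi> x)) = \<phi> x" if "x \<in> U" for x using i(5) \<phi>S that by blast
      have fUY: "f ` U \<subseteq> Y" using UX f(2) by blast
      have "smooth_on (f ` U) (\<lambda>y. \<phi> (g y))"
        by (rule smooth_on_compose[OF smooth_on_subset[OF g(1) fUY] U(5)]) (use UX g(2) in auto)
      then show "smooth_on (f ` U) (\<lambda>y. \<iota> (\<phi> (g y)))" by (rule smooth_on_linear_compose[OF i(1)])
      have "smooth_on (\<iota> ` \<phi> ` U) (\<lambda>z. inv_into U \<phi> (\<kappa> z))"
        by (rule smooth_on_compose[OF smooth_on_linear[OF i(2)] U(6)]) (use i(5) \<phi>S in auto)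
      then show "smooth_on ((\<lambda>y. \<iota> (\<phi> (g y))) ` f ` U) (\<lambda>z. f (inv_into U \<phi> (\<kappa> z)))"
        unfolding im by (rule smooth_on_compose[OF _ f(1)]) (use k\<phi> UX U(4) in auto)
      show "f (inv_into U \<phi> (\<kappa> (\<iota> (\<phi> (g y))))) = y" if y: "y \<in> f ` U" for y
      proof -
        obtain x where x: "x \<in> U" "y = f x" using y by blast
        have "g y = x" using x UX g(2) by blast
        moreover have "\<kappa> (\<iota> (\<phi> x)) = \<phi> x" using i(5) \<phi>S x(1) by blast
        ultimately show ?thesis using x U(4) by (simp add: inv_into_f_f)
      qed
    qed
    moreover have "q \<in> f ` U" using c(2) gY(2)[OF q] by (metis image_eqI)
    ultimately show "\<exists>U S \<phi>. chart_of Y U S \<phi> \<and> q \<in> U \<and> dim S = d" using S'(2) c(3) by blast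
  qed
  then have mf: "smooth_manifold d (submanifold_structure X)" "smooth_manifold d (submanifold_structure Y)"
    using X smooth_manifold_of_charted by blast+
  have "submersion (submanifold_structure X) (submanifold_structure Y) f"
  proof (rule submersionI[OF f(1)])
    show "f ` X \<subseteq> Y" using f(2) by simp
    show "\<exists>W s. openin (top_of_set Y) W \<and> f x \<in> W \<and> smooth_on W s \<and> s (f x) = x \<and> (\<forall>y\<in>W. s y \<in> X \<and> f (s y) = y)"
      if "x \<in> X" for x
      using g gY that f(2) by (intro exI[of _ Y] exI[of _ g]) auto
  qed
  moreover have "submersion (submanifold_structure Y) (submanifold_structure X) g"
  proof (rule submersionI[OF g(1)])
    show "g ` Y \<subseteq> X" using gY by blast
    show "\<exists>W s. openin (top_of_set X) W \<and> g x \<in> W \<and> smooth_on W s \<and> s (g x) = x \<and> (\<forall>y\<in>W. s y \<in> Y \<and> g (s y) = y)"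
      if "x \<in> Y" for x
      using g(2) gY that f by (intro exI[of _ X] exI[of _ f]) auto
  qed
  ultimately show ?thesis
    unfolding diffeomorphic_def submersion_def mtop_submanifold_structure
    using mf g(2) gY(2) by (intro conjI exI[of _ d] exI[of _ f] exI[of _ g]) auto
qed

text \<open>For skew matrices the square condition is orthogonality (\<open>ocs_eq\<close>). In this
  form only products of matrices enter the chart computations.\<close>

definition ocs :: "(real^'n^'n) set" where
  "ocs = {A. transpose A = - A \<and> A ** A = - mat 1}"

lemma ocs_eq: "ocs = {A \<in> skew_matrices. orthogonal_matrix A}"
proof -
  have "A ** A = - mat 1 \<longleftrightarrow> orthogonal_matrix A" if "transpose A = - A" for A :: "real^'n^'n"
  proof -
    have "orthogonal_matrix A \<longleftrightarrow> - (A ** A) = mat 1"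
      by (simp add: orthogonal_matrix that mat_distrib)
    then show ?thesis by (metis add.inverse_inverse)
  qed
  then show ?thesis by (auto simp: ocs_def skew_matrices_def)
qed

lemma cstructs_UNIV: "cstructs UNIV = ocs"
proof -
  have f1: "(\<forall>v\<in>UNIV. A *v (A *v v) = - v) \<longleftrightarrow> A ** A = - mat 1" for A :: "real^'n^'n"
  proof -
    have "(- mat 1) *v v = - v" for v :: "real^'n"
      using matrix_vector_mult_diff_rdistrib[of 0 "mat 1" v] by simp
    then show ?thesis by (simp add: matrix_eq matrix_vector_mul_assoc)
  qed
  have f2: "(\<forall>v. (\<forall>u\<in>UNIV. u \<bullet> v = 0) \<longrightarrow> A *v v = 0)" for A :: "real^'n^'n"
  proof (intro allI impI)
    fix v :: "real^'n" assume "\<forall>u\<in>UNIV. u \<bullet> v = 0"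
    then have "v = 0" by (metis UNIV_I inner_eq_zero_iff)
    then show "A *v v = 0" by simp
  qed
  have "A \<in> cstructs UNIV \<longleftrightarrow> A \<in> ocs" for A :: "real^'n^'n"
    unfolding cstructs_def ocs_def mem_Collect_eq using f1[of A] f2[of A] by argo
  then show ?thesis by blast
qed

lemma subspace_skew: "subspace (skew_matrices :: (real^'n^'n) set)"
  by (simp add: subspace_def skew_matrices_def transpose_distrib linear_0[OF linear_transpose])

text \<open>A linear fractional transformation which straightens the orthogonal complex structures:
  near \<open>A0\<close> it takes them to the skew matrices anticommuting with \<open>A0\<close>.\<close>

definition slice :: "real^'n^'n \<Rightarrow> real^'n^'n \<Rightarrow> real^'n^'n" where
  "slice A0 B = A0 + 2 *\<^sub>R matrix_inv (B + A0)"

text \<open>The solution for \<open>B\<close> of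
  \<open>W - A0 = 2 *\<^sub>R matrix_inv (B + A0)\<close>. For \<open>A0\<close> in
  \<open>ocs\<close> the transformation \<open>slice A0\<close> is
  \<open>A0 ** (B - A0) ** matrix_inv (B + A0)\<close> where defined, a Cayley transform centred at
  \<open>A0\<close>; the factor 2 makes it take \<open>A0\<close> to zero.\<close>

definition unslice :: "real^'n^'n \<Rightarrow> real^'n^'n \<Rightarrow> real^'n^'n" where
  "unslice A0 W = 2 *\<^sub>R matrix_inv (W - A0) - A0"

text \<open>The tangent space at a point \<open>A0\<close> of \<open>ocs\<close>: the linearisation
  of \<open>A ** A = - mat 1\<close> within the skew matrices.\<close>

definition anticomm :: "real^'n^'n \<Rightarrow> (real^'n^'n) set" where
  "anticomm A0 = {W \<in> skew_matrices. W ** A0 = - (A0 ** W)}"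

definition slice_dom :: "real^'n^'n \<Rightarrow> (real^'n^'n) set" where
  "slice_dom A0 = {B \<in> skew_matrices. invertible (B + A0)}"

lemma subspace_anticomm: "subspace (anticomm A0)"
  by (rule subspaceI)
    (auto simp: anticomm_def mat_distrib subspace_0[OF subspace_skew] subspace_add[OF subspace_skew]
      subspace_scale[OF subspace_skew])

lemma skew_matrix_inv:
  fixes X :: "real^'n^'n"
  assumes "transpose X = - X" "invertible X" shows "transpose (matrix_inv X) = - matrix_inv X"
proof -
  have "transpose (matrix_inv X) = matrix_inv (- X)" using transpose_matrix_inv(2)[OF assms(2)] assms(1) by simp
  also have "\<dots> = - matrix_inv X" using matrix_inv_scaleR[OF assms(2), of "-1"] by simp
  finally show ?thesis .
qed

lemma slice_props:
  assumes A0: "A0 \<in> skew_matrices" and B: "B \<in> slice_dom A0"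
  shows "slice A0 B \<in> skew_matrices" "invertible (slice A0 B - A0)" "unslice A0 (slice A0 B) = B"
proof -
  have i: "invertible (B + A0)" and sk: "transpose (B + A0) = - (B + A0)" "transpose A0 = - A0"
    using A0 B by (auto simp: slice_dom_def skew_matrices_def transpose_distrib)
  show "slice A0 B \<in> skew_matrices"
    using skew_matrix_inv[OF sk(1) i] sk(2) by (simp add: slice_def skew_matrices_def transpose_distrib)
  have e: "slice A0 B - A0 = 2 *\<^sub>R matrix_inv (B + A0)" by (simp add: slice_def)
  show "invertible (slice A0 B - A0)"
    unfolding e by (rule matrix_inv_scaleR(1)[OF invertible_matrix_inv(1)[OF i]]) simp
  show "unslice A0 (slice A0 B) = B"
    unfolding unslice_def e matrix_inv_scaleR(2)[OF invertible_matrix_inv(1)[OF i], of 2, simplified]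
      invertible_matrix_inv(2)[OF i] by simp
qed

lemma unslice_props:
  assumes A0: "A0 \<in> skew_matrices" and W: "W \<in> skew_matrices" "invertible (W - A0)"
  shows "unslice A0 W \<in> slice_dom A0" "slice A0 (unslice A0 W) = W"
proof -
  have sk: "transpose (W - A0) = - (W - A0)" "transpose A0 = - A0"
    using A0 W by (auto simp: skew_matrices_def transpose_distrib)
  have e: "unslice A0 W + A0 = 2 *\<^sub>R matrix_inv (W - A0)" by (simp add: unslice_def)
  have i: "invertible (unslice A0 W + A0)"
    unfolding e by (rule matrix_inv_scaleR(1)[OF invertible_matrix_inv(1)[OF W(2)]]) simp
  have "transpose (unslice A0 W) = - unslice A0 W"
    unfolding unslice_def using skew_matrix_inv[OF sk(1) W(2)] sk(2) by (simp add: transpose_distrib)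
  then show "unslice A0 W \<in> slice_dom A0" using i by (simp add: slice_dom_def skew_matrices_def)
  show "slice A0 (unslice A0 W) = W"
    unfolding slice_def e matrix_inv_scaleR(2)[OF invertible_matrix_inv(1)[OF W(2)], of 2, simplified]
      invertible_matrix_inv(2)[OF W(2)] by simp
qed

lemma slice_image:
  assumes "A0 \<in> skew_matrices"
  shows "slice A0 ` slice_dom A0 = {W \<in> skew_matrices. invertible (W - A0)}"
proof
  show "slice A0 ` slice_dom A0 \<subseteq> {W \<in> skew_matrices. invertible (W - A0)}"
    using slice_props[OF assms] by blast
  show "{W \<in> skew_matrices. invertible (W - A0)} \<subseteq> slice A0 ` slice_dom A0"
    using unslice_props[OF assms] by (metis (no_types, lifting) image_eqI mem_Collect_eq subsetI)
qed

text \<open>If \<open>Y\<close> is the inverse of \<open>X\<close>, the right side contains no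
  inverse. Identities about \<open>Y\<close> are thus checked after this sandwiching and recovered
  by \<open>matrix_sandwich_cancel\<close>.\<close>

lemma sandwich_anticomm:
  fixes X Y A :: "real^'n^'n"
  shows "X ** (Y ** A + A ** Y) ** X = (X ** Y) ** A ** X + X ** A ** (Y ** X)"
  by (simp only: mat_add_left mat_add_right matrix_mul_assoc)

lemma ocsD: "A \<in> ocs \<Longrightarrow> transpose A = - A" "A \<in> ocs \<Longrightarrow> A ** A = - mat 1"
  "A \<in> ocs \<Longrightarrow> A \<in> skew_matrices"
  by (auto simp: ocs_def skew_matrices_def)

lemma slice_anticomm:
  assumes A0: "A0 \<in> ocs" and B: "B \<in> ocs" "B \<in> slice_dom A0" shows "slice A0 B \<in> anticomm A0"
proof -
  let ?X = "B + A0" and ?Y = "matrix_inv (B + A0)"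
  have i: "invertible ?X" using B by (simp add: slice_dom_def)
  note a = ocsD(2)[OF A0] ocsD(2)[OF B(1)]
  have "?X ** (?Y ** A0 + A0 ** ?Y) ** ?X = (?X ** ?Y) ** A0 ** ?X + ?X ** A0 ** (?Y ** ?X)"
    by (rule sandwich_anticomm)
  also have "\<dots> = A0 ** ?X + ?X ** A0" by (simp add: matrix_inv_left[OF i] matrix_inv_right[OF i])
  \<comment> \<open>Since \<open>A0\<close> and \<open>B\<close> square to \<open>- mat 1\<close>,
    both sides are \<open>A0 ** B + B ** A0 - 2 *\<^sub>R mat 1\<close>.\<close>
  also have "\<dots> = ?X ** mat 1 ** ?X" by (simp add: mat_distrib a)
  finally have 1: "?Y ** A0 + A0 ** ?Y = mat 1" by (rule matrix_sandwich_cancel[OF i])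
  have "(A0 + 2 *\<^sub>R ?Y) ** A0 + A0 ** (A0 + 2 *\<^sub>R ?Y) = 2 *\<^sub>R (A0 ** A0) + 2 *\<^sub>R (?Y ** A0 + A0 ** ?Y)"
    by (simp only: mat_distrib scaleR_2 add_ac)
  also have "\<dots> = 0" unfolding 1 a by simp
  finally have "slice A0 B ** A0 = - (A0 ** slice A0 B)" unfolding slice_def by (simp only: eq_neg_iff_add_eq_0)
  then show ?thesis
    using slice_props(1)[OF ocsD(3)[OF A0] B(2)] by (simp add: anticomm_def)
qed

text \<open>With Z the inverse of \<open>W - A0\<close>, the square of \<open>unslice A0 W\<close>
  is 4 Z Z - 2 (Z A0 + A0 Z) - 1, and anticommutation turns the bracket into 2 Z Z.\<close>

lemma unslice_ocs:
  assumes A0: "A0 \<in> ocs" and W: "W \<in> anticomm A0" "invertible (W - A0)" shows "unslice A0 W \<in> ocs"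
proof -
  let ?X = "W - A0" and ?Z = "matrix_inv (W - A0)"
  note a = ocsD(2)[OF A0]
  have Wsk: "W \<in> skew_matrices" and ac: "W ** A0 = - (A0 ** W)" using W by (auto simp: anticomm_def)
  have "?X ** (?Z ** A0 + A0 ** ?Z) ** ?X = (?X ** ?Z) ** A0 ** ?X + ?X ** A0 ** (?Z ** ?X)"
    by (rule sandwich_anticomm)
  also have "\<dots> = A0 ** ?X + ?X ** A0" by (simp add: matrix_inv_left[OF W(2)] matrix_inv_right[OF W(2)])
  also have "\<dots> = 2 *\<^sub>R mat 1" by (simp add: mat_distrib a ac scaleR_2)
  also have "\<dots> = 2 *\<^sub>R ((?X ** ?Z) ** (?Z ** ?X))" by (simp add: matrix_inv_left[OF W(2)] matrix_inv_right[OF W(2)])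
  also have "\<dots> = ?X ** (2 *\<^sub>R (?Z ** ?Z)) ** ?X"
    by (simp only: mat_scaleR_left mat_scaleR_right matrix_mul_assoc)
  finally have 1: "?Z ** A0 + A0 ** ?Z = 2 *\<^sub>R (?Z ** ?Z)" by (rule matrix_sandwich_cancel[OF W(2)])
  have "unslice A0 W ** unslice A0 W = 4 *\<^sub>R (?Z ** ?Z) - 2 *\<^sub>R (?Z ** A0 + A0 ** ?Z) + A0 ** A0"
    unfolding unslice_def by (simp add: mat_distrib algebra_simps)
  also have "\<dots> = - mat 1" unfolding 1 a by simp
  finally show ?thesis
    using unslice_props(1)[OF ocsD(3)[OF A0] Wsk W(2)] by (simp add: ocs_def slice_dom_def skew_matrices_def)
qed

lemma openin_skew_invertible:
  "openin (top_of_set skew_matrices) {B \<in> skew_matrices. invertible (B + C :: real^'n^'n)}"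
proof -
  have "open ((\<lambda>B. B + C) -` {A. invertible A})"
    by (intro open_vimage open_invertible continuous_intros)
  moreover have "{B \<in> skew_matrices. invertible (B + C)} = skew_matrices \<inter> (\<lambda>B. B + C) -` {A. invertible A}" by auto
  ultimately show ?thesis using openin_open_Int by simp
qed

lemma slice_dom_self: "A0 \<in> ocs \<Longrightarrow> A0 \<in> slice_dom A0"
proof -
  assume A0: "A0 \<in> ocs"
  have "(A0 + A0) ** ((- 1 / 2) *\<^sub>R A0) = mat 1"
    unfolding scaleR_2[symmetric] mat_scaleR_left mat_scaleR_right ocsD(2)[OF A0] by simp
  then show ?thesis using matrix_inv_unique(1) ocsD(3)[OF A0] by (auto simp: slice_dom_def)
qed

text \<open>\<open>slice A0\<close> maps an open set of skew matrices onto an open set of skew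
  matrices and takes \<open>ocs\<close> to the slice \<open>anticomm A0\<close>. The dimension
  enters as a hypothesis; it is computed later from the normal form, for block index types.\<close>

lemma submanifold_ocs:
  assumes "\<And>A0 :: real^'n^'n. A0 \<in> ocs \<Longrightarrow> dim (anticomm A0) = d"
  shows "submanifold skew_matrices d (ocs :: (real^'n^'n) set)"
  unfolding submanifold_def
proof (intro conjI ballI)
  show "subspace (skew_matrices :: (real^'n^'n) set)" by (rule subspace_skew)
  show "(ocs :: (real^'n^'n) set) \<subseteq> skew_matrices" using ocsD(3) by blast
  fix A0 :: "real^'n^'n" assume A0: "A0 \<in> ocs"
  note sk = ocsD(3)[OF A0]
  have "chart_of skew_matrices (slice_dom A0) skew_matrices (slice A0)"
  proof (rule chart_ofI[where \<theta> = "unslice A0"])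
    show "slice_dom A0 \<noteq> {}" using slice_dom_self[OF A0] by blast
    show "openin (top_of_set skew_matrices) (slice_dom A0)"
      unfolding slice_dom_def by (rule openin_skew_invertible)
    show "openin (top_of_set skew_matrices) (slice A0 ` slice_dom A0)"
      unfolding slice_image[OF sk] using openin_skew_invertible[of "- A0"] by simp
    show "smooth_on (slice_dom A0) (slice A0)"
      unfolding slice_def by (intro smooth_on_intros) (simp add: slice_dom_def)
    show "smooth_on (slice A0 ` slice_dom A0) (unslice A0)"
      unfolding slice_image[OF sk] unslice_def by (intro smooth_on_intros) simp
  qed (use subspace_skew slice_props(3)[OF sk] in auto)
  moreover have "slice A0 ` (slice_dom A0 \<inter> ocs) = slice A0 ` slice_dom A0 \<inter> anticomm A0"
  proof
    show "slice A0 ` (slice_dom A0 \<inter> ocs) \<subseteq> slice A0 ` slice_dom A0 \<inter> anticomm A0"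
      using slice_anticomm[OF A0] by blast
    show "slice A0 ` slice_dom A0 \<inter> anticomm A0 \<subseteq> slice A0 ` (slice_dom A0 \<inter> ocs)"
    proof
      fix W assume W: "W \<in> slice A0 ` slice_dom A0 \<inter> anticomm A0"
      then have W': "W \<in> skew_matrices" "invertible (W - A0)" "W \<in> anticomm A0"
        unfolding slice_image[OF sk] by auto
      then show "W \<in> slice A0 ` (slice_dom A0 \<inter> ocs)"
        using unslice_props[OF sk W'(1,2)] unslice_ocs[OF A0 W'(3,2)] by (metis IntI image_eqI)
    qed
  qed
  moreover have "anticomm A0 \<subseteq> skew_matrices" by (auto simp: anticomm_def)
  ultimately show "\<exists>U \<phi> S. (U, skew_matrices, \<phi>) \<in> charts (submanifold_structure skew_matrices) \<and> A0 \<in> U \<and>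
      subspace S \<and> S \<subseteq> skew_matrices \<and> dim S = d \<and> \<phi> ` (U \<inter> ocs) = \<phi> ` U \<inter> S"
    using slice_dom_self[OF A0] subspace_anticomm assms[OF A0] by blast
qed

text \<open>A kernel vector would satisfy \<open>X *v v = - v\<close>, but skewness makes
  \<open>X *v v\<close> orthogonal to \<open>v\<close>.\<close>

lemma skew_plus_one_invertible:
  fixes X :: "real^'n^'n"
  assumes "X \<in> skew_matrices" shows "invertible (mat 1 + X)"
proof -
  have sk: "transpose X = - X" using assms by (simp add: skew_matrices_def)
  have "v = 0" if "(mat 1 + X) *v v = 0" for v
  proof -
    have "v + X *v v = 0" using that by (simp add: matrix_vector_mult_add_rdistrib)
    then have "X *v v = - v" by (simp add: add_eq_0_iff)
    moreover have "(X *v v) \<bullet> v = 0"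
      using inner_matrix_vector_skew[OF sk, of v v] by (simp add: inner_commute)
    ultimately show ?thesis by simp
  qed
  then show ?thesis
    by (metis matrix_left_invertible_ker invertible_left_inverse)
qed

text \<open>Where defined, this is \<open>(mat 1 - h) ** matrix_inv (mat 1 + h)\<close>. With a
  single occurrence of \<open>h\<close> it is readily seen to be its own inverse.\<close>

definition cayley :: "real^'n^'n \<Rightarrow> real^'n^'n" where
  "cayley h = 2 *\<^sub>R matrix_inv (mat 1 + h) - mat 1"

lemma cayley_cayley:
  fixes h :: "real^'n^'n"
  assumes "invertible (mat 1 + h)" shows "invertible (mat 1 + cayley h)" "cayley (cayley h) = h"
proof -
  have e: "mat 1 + cayley h = 2 *\<^sub>R matrix_inv (mat 1 + h)" by (simp add: cayley_def)
  show "invertible (mat 1 + cayley h)"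
    unfolding e by (rule matrix_inv_scaleR(1)[OF invertible_matrix_inv(1)[OF assms]]) simp
  show "cayley (cayley h) = h"
    unfolding cayley_def[of "cayley h"] e matrix_inv_scaleR(2)[OF invertible_matrix_inv(1)[OF assms], of 2, simplified]
      invertible_matrix_inv(2)[OF assms] by simp
qed

lemma cayley_mult:
  fixes h :: "real^'n^'n"
  assumes "invertible (mat 1 + h)" shows "(mat 1 + h) ** cayley h = mat 1 - h" "cayley h ** (mat 1 + h) = mat 1 - h"
  using assms unfolding cayley_def
  by (simp_all only: mat_diff_right mat_diff_left mat_scaleR_right mat_scaleR_left matrix_inv_right matrix_inv_left
      matrix_mul_rid matrix_mul_lid) (simp_all add: scaleR_2)

lemma cayley_skew:
  fixes h :: "real^'n^'n"
  assumes h: "orthogonal_matrix h" and i: "invertible (mat 1 + h)" shows "cayley h \<in> skew_matrices"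
proof -
  have ti: "invertible (mat 1 + transpose h)"
    using transpose_matrix_inv(1)[OF i] by (simp add: transpose_distrib)
  have tc: "transpose (cayley h) = cayley (transpose h)"
    unfolding cayley_def using transpose_matrix_inv(2)[OF i] by (simp add: transpose_distrib)
  have "(mat 1 + h) ** transpose (cayley h) = h ** ((mat 1 + transpose h) ** cayley (transpose h))"
    unfolding tc using orthogonal_matrixD(2)[OF h] by (simp add: matrix_mul_assoc mat_distrib add.commute)
  also have "\<dots> = h - mat 1"
    unfolding cayley_mult(1)[OF ti] using orthogonal_matrixD(2)[OF h] by (simp add: mat_distrib)
  also have "\<dots> = (mat 1 + h) ** (- cayley h)"
    using cayley_mult(1)[OF i] by (simp add: mat_minus_right)
  finally have "(mat 1 + h) ** transpose (cayley h) = (mat 1 + h) ** (- cayley h)" .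
  then have "matrix_inv (mat 1 + h) ** (mat 1 + h) ** transpose (cayley h) = matrix_inv (mat 1 + h) ** (mat 1 + h) ** (- cayley h)"
    by (simp only: matrix_mul_assoc[symmetric])
  then show ?thesis by (simp add: matrix_inv_left[OF i] skew_matrices_def)
qed

text \<open>The determinant is 1 because \<open>mat 1 - X\<close> is the transpose of
  \<open>mat 1 + X\<close>, so numerator and denominator of the transform have equal
  determinants.\<close>

lemma cayley_rotation:
  fixes X :: "real^'n^'n"
  assumes X: "X \<in> skew_matrices" shows "rotation_matrix (cayley X)"
proof -
  have sk: "transpose X = - X" using X by (simp add: skew_matrices_def)
  have i: "invertible (mat 1 + X)" by (rule skew_plus_one_invertible[OF X])
  have "- X \<in> skew_matrices" using X subspace_skew subspace_neg by blast
  then have i': "invertible (mat 1 - X)" using skew_plus_one_invertible[of "- X"] by simp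
  have tc: "transpose (cayley X) = cayley (- X)"
    unfolding cayley_def using transpose_matrix_inv(2)[OF i] sk by (simp add: transpose_distrib)
  have m: "(mat 1 - X) ** cayley (- X) = mat 1 + X" "cayley (- X) ** (mat 1 - X) = mat 1 + X"
    using cayley_mult[of "- X"] i' by simp_all
  have "(mat 1 - X) ** (cayley (- X) ** cayley X) ** (mat 1 + X) = ((mat 1 - X) ** cayley (- X)) ** (cayley X ** (mat 1 + X))"
    by (simp only: matrix_mul_assoc)
  also have "\<dots> = (mat 1 - X) ** mat 1 ** (mat 1 + X)"
    unfolding m cayley_mult[OF i] by (simp add: mat_distrib)
  finally have e: "(mat 1 - X) ** (cayley (- X) ** cayley X) ** (mat 1 + X) = (mat 1 - X) ** mat 1 ** (mat 1 + X)" .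
  have "cayley (- X) ** cayley X = mat 1"
  proof -
    have "matrix_inv (mat 1 - X) ** ((mat 1 - X) ** P ** (mat 1 + X)) ** matrix_inv (mat 1 + X) = P" for P
    proof -
      have "matrix_inv (mat 1 - X) ** ((mat 1 - X) ** P ** (mat 1 + X)) ** matrix_inv (mat 1 + X)
        = (matrix_inv (mat 1 - X) ** (mat 1 - X)) ** P ** ((mat 1 + X) ** matrix_inv (mat 1 + X))"
        by (simp only: matrix_mul_assoc)
      then show ?thesis by (simp add: matrix_inv_left[OF i'] matrix_inv_right[OF i])
    qed
    then show ?thesis using e by metis
  qed
  then have o: "orthogonal_matrix (cayley X)" by (simp add: orthogonal_matrix tc)
  have "transpose (mat 1 + X) = mat 1 - X" by (simp add: transpose_distrib sk)
  then have "det (mat 1 - X) = det (mat 1 + X)" using det_transpose by metis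
  then have "det (mat 1 + X) * det (cayley X) = det (mat 1 + X)"
    using cayley_mult(1)[OF i] det_mul by metis
  moreover have "det (mat 1 + X) \<noteq> 0" using i invertible_det_nz by blast
  ultimately show ?thesis using o by (simp add: rotation_matrix_def)
qed

text \<open>The Cayley transform, translated to \<open>g0\<close> by left multiplication. Its image
  is the whole space of skew matrices, since \<open>mat 1 + X\<close> is invertible for every skew
  \<open>X\<close>.\<close>

lemma charted_rotations: "charted (dim (skew_matrices :: (real^'n^'n) set)) (special_orthogonal_group :: (real^'n^'n) set)"
  unfolding charted_def
proof
  fix g0 :: "real^'n^'n" assume "g0 \<in> special_orthogonal_group"
  then have g0: "rotation_matrix g0" by (simp add: special_orthogonal_group_def)
  then have o: "orthogonal_matrix g0" "det g0 = 1" by (simp_all add: rotation_matrix_def)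
  let ?G = "special_orthogonal_group :: (real^'n^'n) set"
  define U where "U = {g \<in> ?G. invertible (mat 1 + transpose g0 ** g)}"
  define \<phi> where "\<phi> g = cayley (transpose g0 ** g)" for g
  have tg: "orthogonal_matrix (transpose g0)" using o by (simp add: orthogonal_matrix_def)
  have gg: "g0 ** (transpose g0 ** g) = g" for g
    using orthogonal_matrixD(2)[OF o(1)] by (simp add: matrix_mul_assoc)
  have gg': "transpose g0 ** (g0 ** X) = X" for X
    using orthogonal_matrixD(1)[OF o(1)] by (simp add: matrix_mul_assoc)
  have im: "\<phi> ` U = skew_matrices"
  proof
    show "\<phi> ` U \<subseteq> skew_matrices"
      using tg by (auto simp: U_def \<phi>_def special_orthogonal_group_def rotation_matrix_def intro!: cayley_skew orthogonal_matrix_mul)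
    show "skew_matrices \<subseteq> \<phi> ` U"
    proof
      fix X :: "real^'n^'n" assume X: "X \<in> skew_matrices"
      have i: "invertible (mat 1 + X)" by (rule skew_plus_one_invertible[OF X])
      have "rotation_matrix (g0 ** cayley X)"
        using cayley_rotation[OF X] o by (simp add: rotation_matrix_def orthogonal_matrix_mul det_mul)
      then have "g0 ** cayley X \<in> U"
        using cayley_cayley(1)[OF i] by (simp add: U_def special_orthogonal_group_def gg')
      moreover have "\<phi> (g0 ** cayley X) = X" using cayley_cayley(2)[OF i] by (simp add: \<phi>_def gg')
      ultimately show "X \<in> \<phi> ` U" by (metis image_eqI)
    qed
  qed
  have g0U: "g0 \<in> U"
  proof -
    have "mat 1 + transpose g0 ** g0 = 2 *\<^sub>R mat 1" using orthogonal_matrixD(1)[OF o(1)] by (simp add: scaleR_2)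
    moreover have "invertible (2 *\<^sub>R mat 1 :: real^'n^'n)"
      by (rule matrix_inv_scaleR(1)[OF matrix_inv_unique(1)[of "mat 1" "mat 1"]]) simp_all
    ultimately show ?thesis using g0 by (simp add: U_def special_orthogonal_group_def)
  qed
  have "chart_of ?G U skew_matrices \<phi>"
  proof (rule chart_ofI[where \<theta> = "\<lambda>X. g0 ** cayley X"])
    show "U \<noteq> {}" using g0U by blast
    show "openin (top_of_set ?G) U"
    proof -
      have "open ((\<lambda>g. mat 1 + transpose g0 ** g) -` {A. invertible A})"
        by (intro open_vimage open_invertible continuous_intros)
      moreover have "U = ?G \<inter> (\<lambda>g. mat 1 + transpose g0 ** g) -` {A. invertible A}" by (auto simp: U_def)
      ultimately show ?thesis using openin_open_Int by simp
    qed
    show "openin (top_of_set skew_matrices) (\<phi> ` U)" unfolding im by simp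
    show "smooth_on U \<phi>" unfolding \<phi>_def cayley_def by (intro smooth_on_intros) (simp add: U_def)
    show "smooth_on (\<phi> ` U) (\<lambda>X. g0 ** cayley X)"
      unfolding im cayley_def by (intro smooth_on_intros) (rule skew_plus_one_invertible)
    show "g0 ** cayley (\<phi> g) = g" if "g \<in> U" for g
      using that cayley_cayley(2)[of "transpose g0 ** g"] by (simp add: U_def \<phi>_def gg)
  qed (rule subspace_skew)
  then show "\<exists>U S \<phi>. chart_of ?G U S \<phi> \<and> g0 \<in> U \<and> dim S = dim (skew_matrices :: (real^'n^'n) set)"
    using g0U by blast
qed

section \<open>Local conjugations and normal form\<close>

lemma norm_vector_matrix_orthogonal:
  fixes Q :: "real^'n^'n"
  assumes "orthogonal_matrix Q" shows "norm (transpose Q *v x) = norm x"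
proof -
  have "(transpose Q *v x) \<bullet> (transpose Q *v x) = x \<bullet> (Q *v (transpose Q *v x))"
    by (simp only: matrix_vector_inner transpose_transpose)
  also have "\<dots> = x \<bullet> x"
    by (simp only: matrix_vector_mul_assoc orthogonal_matrixD(2)[OF assms] matrix_vector_mul_lid)
  finally show ?thesis by (simp add: norm_eq)
qed

lemma norm_matrix_mult_right_orthogonal:
  fixes X Q :: "real^'n^'n"
  assumes "orthogonal_matrix Q" shows "norm (X ** Q) = norm X"
proof -
  have row: "(X ** Q) $ i = transpose Q *v (X $ i)" for i
    by (simp add: vec_eq_iff matrix_matrix_mult_def matrix_vector_mult_def transpose_def mult.commute)
  have "norm ((X ** Q) $ i) = norm (X $ i)" for i
    unfolding row by (rule norm_vector_matrix_orthogonal[OF assms])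
  then show ?thesis by (simp add: norm_vec_def L2_set_def)
qed

lemma norm_transpose: "norm (transpose X) = norm X" for X :: "real^'n^'n"
proof -
  have "transpose X \<bullet> transpose X = X \<bullet> X"
    unfolding inner_vec_def by (simp add: transpose_def) (rule sum.swap)
  then show ?thesis by (simp add: norm_eq)
qed

lemma norm_matrix_mult_left_orthogonal:
  fixes X Q :: "real^'n^'n"
  assumes "orthogonal_matrix Q" shows "norm (Q ** X) = norm X"
proof -
  have "norm (Q ** X) = norm (transpose X ** transpose Q)" by (metis matrix_transpose_mul norm_transpose)
  also have "\<dots> = norm X"
    using norm_matrix_mult_right_orthogonal[of "transpose Q" "transpose X"] assms
    by (simp add: orthogonal_matrix_def norm_transpose)
  finally show ?thesis .
qed

lemma compact_ocs: "compact (ocs :: (real^'n^'n) set)"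
proof -
  have "norm A = norm (mat 1 :: real^'n^'n)" if "A \<in> ocs" for A :: "real^'n^'n"
    using norm_matrix_mult_left_orthogonal[of A "mat 1"] that by (simp add: ocs_eq)
  then have "bounded (ocs :: (real^'n^'n) set)" unfolding bounded_iff by (metis order_refl)
  moreover have "closed (ocs :: (real^'n^'n) set)"
  proof -
    have "continuous_on UNIV (transpose :: real^'n^'n \<Rightarrow> real^'n^'n)"
      by (rule linear_continuous_on) (simp add: linear_transpose linear_linear)
    then have "closed {A :: real^'n^'n. transpose A = - A}" "closed {A :: real^'n^'n. A ** A = - mat 1}"
      by (intro closed_Collect_eq continuous_intros; simp)+
    then show ?thesis unfolding ocs_def by (simp add: closed_Collect_conj)
  qed
  ultimately show ?thesis using compact_eq_bounded_closed by blast
qed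

text \<open>Squaring has derivative twice the identity map at \<open>mat 1\<close>, so it is locally
  invertible. The ball is recorded because transposition and conjugation by an orthogonal matrix
  preserve it: uniqueness of roots inside then transfers symmetries from a matrix to its
  root.\<close>

lemma matrix_square_root:
  obtains e :: real and V :: "(real^'n^'n) set" and r
  where "e > 0" "open V" "mat 1 \<in> V" "r (mat 1) = mat 1" "smooth_on V r"
    "\<forall>Y\<in>V. r Y \<in> ball (mat 1) e \<and> r Y ** r Y = Y"
    "\<forall>X\<in>ball (mat 1) e. \<forall>X'\<in>ball (mat 1) e. X ** X = X' ** X' \<longrightarrow> X = (X' :: real^'n^'n)"
    "\<forall>X\<in>ball (mat 1) e. invertible (X :: real^'n^'n)"
proof -
  let ?f = "\<lambda>X :: real^'n^'n. X ** X" and ?D = "\<lambda>H :: real^'n^'n. mat 1 ** H + H ** mat 1"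
  have C: "Cinf_on UNIV ?f"
    by (intro allI Ck_on_bilinear[OF open_UNIV bounded_bilinear_matrix_mult] Ck_on_linear) (simp_all add: linear_iff)
  have D: "(?f has_derivative ?D) (at (mat 1))"
    by (rule bounded_bilinear.FDERIV[OF bounded_bilinear_matrix_mult has_derivative_ident has_derivative_ident])
  have I: "inj ?D"
  proof (rule injI)
    fix x y :: "real^'n^'n" assume "mat 1 ** x + x ** mat 1 = mat 1 ** y + y ** mat 1"
    then have "2 *\<^sub>R x = 2 *\<^sub>R y" by (simp only: matrix_mul_lid matrix_mul_rid scaleR_2)
    then show "x = y" by simp
  qed
  obtain U V g where U: "open U" "U \<subseteq> UNIV" "mat 1 \<in> U" "open V" "homeomorphism U V ?f g" "Cinf_on V g"
    by (rule Cinf_local_inverse[OF open_UNIV C UNIV_I D I])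
  have "?f (mat 1) \<in> V" using U(3,5) unfolding homeomorphism_def by blast
  then have g1: "g (mat 1) = mat 1" "mat 1 \<in> V"
    using homeomorphism_apply1[OF U(5) U(3)] by simp_all
  have "open (U \<inter> {A. invertible A})" using U(1) open_invertible by blast
  moreover have "mat 1 \<in> U \<inter> {A :: real^'n^'n. invertible A}" using U(3) matrix_inv_unique(1)[of "mat 1" "mat 1"] by simp
  ultimately obtain e where e: "e > 0" "ball (mat 1) e \<subseteq> U \<inter> {A. invertible A}" using openE by blast
  define V' where "V' = V \<inter> g -` ball (mat 1) e"
  have "continuous_on V g" using U(5) by (simp add: homeomorphism_def)
  then have V': "open V'" unfolding V'_def using U(4) by (simp add: continuous_on_open_vimage Int_commute)
  show ?thesis
  proof
    show "e > 0" "open V'" "g (mat 1) = mat 1" by fact+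
    show "mat 1 \<in> V'" using g1 e(1) by (simp add: V'_def)
    show "smooth_on V' g" by (rule Cinf_imp_smooth_on[OF U(4,6)]) (simp add: V'_def)
    show "\<forall>Y\<in>V'. g Y \<in> ball (mat 1) e \<and> g Y ** g Y = Y"
      using homeomorphism_apply2[OF U(5)] by (simp add: V'_def)
    show "\<forall>X\<in>ball (mat 1) e. \<forall>X'\<in>ball (mat 1) e. X ** X = X' ** X' \<longrightarrow> X = (X' :: real^'n^'n)"
    proof (intro ballI impI)
      fix X X' :: "real^'n^'n" assume b: "X \<in> ball (mat 1) e" "X' \<in> ball (mat 1) e" "X ** X = X' ** X'"
      have X: "X \<in> U" "X' \<in> U" using subsetD[OF e(2) b(1)] subsetD[OF e(2) b(2)] by simp_all
      have "X = g (X ** X)" by (rule homeomorphism_apply1[OF U(5) X(1), symmetric])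
      also have "\<dots> = g (X' ** X')" by (rule arg_cong[OF b(3)])
      also have "\<dots> = X'" by (rule homeomorphism_apply1[OF U(5) X(2)])
      finally show "X = X'" .
    qed
    show "\<forall>X\<in>ball (mat 1) e. invertible (X :: real^'n^'n)" using e(2) by blast
  qed
qed

text \<open>The polar decomposition of \<open>(1 - A A0) / 2\<close> provides an orthogonal matrix conjugating
  \<open>A0\<close> into \<open>A\<close>; near \<open>A0\<close> it depends smoothly on \<open>A\<close>.\<close>

lemma local_conjugation:
  fixes A0 :: "real^'n^'n"
  assumes A0: "A0 \<in> ocs"
  obtains W s where "open W" "A0 \<in> W" "smooth_on (ocs \<inter> W) s" "s A0 = mat 1"
    "\<And>A. A \<in> ocs \<inter> W \<Longrightarrow> orthogonal_matrix (s A) \<and> s A ** A0 ** transpose (s A) = A"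
proof -
  obtain e :: real and V :: "(real^'n^'n) set" and r
    where r: "e > 0" "open V" "mat 1 \<in> V" "r (mat 1) = mat 1" "smooth_on V r"
    and rs: "\<forall>Y\<in>V. r Y \<in> ball (mat 1) e \<and> r Y ** r Y = Y"
    and ru: "\<forall>X\<in>ball (mat 1) e. \<forall>X'\<in>ball (mat 1) e. X ** X = X' ** X' \<longrightarrow> X = (X' :: real^'n^'n)"
    and ri: "\<forall>X\<in>ball (mat 1) e. invertible (X :: real^'n^'n)"
    by (rule matrix_square_root[where 'n = 'n])
  have uniq: "X = X'" if "X \<in> ball (mat 1) e" "X' \<in> ball (mat 1) e" "X ** X = X' ** X'" for X X' :: "real^'n^'n"
    using ru that by blast
  note t0 = ocsD(1)[OF A0] and sq0 = ocsD(2)[OF A0]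
  have sq0': "X ** A0 ** A0 = - X" for X
    unfolding matrix_mul_assoc[symmetric] sq0 by (simp add: mat_minus_right)
  have o0: "orthogonal_matrix A0" using A0 by (simp add: ocs_eq)
  \<comment> \<open>\<open>k A\<close> intertwines, \<open>A ** k A = k A ** A0\<close>, and is
    \<open>mat 1\<close> at \<open>A0\<close>, but it need not be orthogonal. On \<open>ocs\<close>,
    \<open>D A\<close> is \<open>transpose (k A) ** k A\<close>, so division by the root of
    \<open>D A\<close> makes \<open>k A\<close> orthogonal.\<close>
  define k where "k A = (1/2) *\<^sub>R (mat 1 - A ** A0)" for A
  define D where "D A = (1/4) *\<^sub>R (2 *\<^sub>R mat 1 - A ** A0 - A0 ** A)" for A
  define s where "s A = k A ** matrix_inv (r (D A))" for A
  define W where "W = D -` V"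
  have k0: "k A0 = mat 1" unfolding k_def sq0 by (simp add: scaleR_2[symmetric])
  have D0: "D A0 = mat 1"
  proof -
    have "2 *\<^sub>R mat 1 - - mat 1 - - mat 1 = 4 *\<^sub>R (mat 1 :: real^'n^'n)" by (simp add: vec_eq_iff)
    then show ?thesis unfolding D_def sq0 by simp
  qed
  have "continuous_on UNIV D" unfolding D_def by (intro continuous_intros)
  then have W: "open W" unfolding W_def using r(2) by (simp add: open_vimage)
  have A0W: "A0 \<in> W" using D0 r(3) by (simp add: W_def)
  have smD: "smooth_on X D" for X unfolding D_def by (intro smooth_on_intros)
  have smk: "smooth_on X k" for X unfolding k_def by (intro smooth_on_intros)
  have "smooth_on (ocs \<inter> W) (\<lambda>A. r (D A))"
    by (rule smooth_on_compose[OF smD r(5)]) (auto simp: W_def)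
  then have "smooth_on (ocs \<inter> W) s"
    unfolding s_def by (intro smooth_on_intros smk) (use rs ri in \<open>auto simp: W_def\<close>)
  moreover have "s A0 = mat 1"
    using matrix_inv_unique(2)[of "mat 1" "mat 1"] by (simp add: s_def k0 D0 r(4))
  moreover have "orthogonal_matrix (s A) \<and> s A ** A0 ** transpose (s A) = A" if A: "A \<in> ocs \<inter> W" for A
  proof -
    note t = ocsD(1)[of A] and sq = ocsD(2)[of A]
    have AA: "transpose A = - A" "A ** A = - mat 1" using A t sq by auto
    have sq': "X ** A ** A = - X" for X
      unfolding matrix_mul_assoc[symmetric] AA(2) by (simp add: mat_minus_right)
    define P where "P = r (D A)"
    have P: "P \<in> ball (mat 1) e" "P ** P = D A" using A rs by (auto simp: W_def P_def)
    have i: "invertible P" using ri P(1) by blast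
    have tD: "transpose (D A) = D A"
      unfolding D_def transpose_distrib matrix_transpose_mul AA t0
      by (simp add: mat_distrib algebra_simps)
    \<comment> \<open>\<open>D A\<close> is symmetric and the ball is invariant under transposition,
      so the transpose is a second root in the ball.\<close>
    have "transpose P = P"
    proof (rule uniq[OF _ P(1)])
      have "norm (transpose (mat 1 - P)) < e" unfolding norm_transpose using P(1) by (simp add: dist_norm)
      then show "transpose P \<in> ball (mat 1) e" by (simp add: dist_norm transpose_distrib)
      show "transpose P ** transpose P = P ** P"
        unfolding matrix_transpose_mul[symmetric] P(2) tD ..
    qed
    note tP = this
    have DA0: "D A ** A0 = A0 ** D A"
      unfolding D_def by (simp add: mat_distrib matrix_mul_assoc sq0 sq0' algebra_simps)
    \<comment> \<open>The left side is the conjugate of \<open>P\<close> by the orthogonal matrix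
      \<open>A0\<close>. It is another root of \<open>D A\<close> in the ball, as \<open>D A\<close>
      commutes with \<open>A0\<close>; hence the root commutes with \<open>A0\<close> too.\<close>
    have "- (A0 ** P ** A0) = P"
    proof (rule uniq[OF _ P(1)])
      have "A0 ** (mat 1 - P) ** A0 = - mat 1 - A0 ** P ** A0" by (simp add: mat_distrib sq0)
      then have "norm (- mat 1 - A0 ** P ** A0) = norm (mat 1 - P)"
        using norm_matrix_mult_left_orthogonal[OF o0] norm_matrix_mult_right_orthogonal[OF o0] by metis
      also have "- mat 1 - A0 ** P ** A0 = - (mat 1 - - (A0 ** P ** A0))" by simp
      finally show "- (A0 ** P ** A0) \<in> ball (mat 1) e" using P(1) unfolding mem_ball dist_norm norm_minus_cancel by simp
      have "- (A0 ** P ** A0) ** - (A0 ** P ** A0) = A0 ** P ** A0 ** A0 ** P ** A0"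
        by (simp add: mat_minus_left mat_minus_right matrix_mul_assoc)
      also have "\<dots> = - (A0 ** (P ** P) ** A0)"
        by (simp add: sq0' mat_minus_left matrix_mul_assoc)
      also have "\<dots> = P ** P"
        unfolding P(2) DA0[symmetric] sq0' by simp
      finally show "- (A0 ** P ** A0) ** - (A0 ** P ** A0) = P ** P" .
    qed
    then have "- (A0 ** P ** A0) ** A0 = P ** A0" by simp
    then have PA0: "A0 ** P = P ** A0" by (simp add: mat_minus_left sq0')
    have iPA0: "matrix_inv P ** A0 = A0 ** matrix_inv P"
    proof -
      have "matrix_inv P ** (A0 ** P) ** matrix_inv P = matrix_inv P ** (P ** A0) ** matrix_inv P" using PA0 by simp
      then show ?thesis
        by (metis i matrix_inv_left matrix_inv_right matrix_mul_assoc matrix_mul_lid matrix_mul_rid)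
    qed
    have tk: "transpose (k A) ** k A = D A"
    proof -
      have "transpose (k A) = (1/2) *\<^sub>R (mat 1 - A0 ** A)"
        unfolding k_def transpose_distrib matrix_transpose_mul AA t0 by (simp add: mat_distrib)
      moreover have "(mat 1 - A0 ** A) ** (mat 1 - A ** A0) = 2 *\<^sub>R mat 1 - A ** A0 - A0 ** A"
        by (simp add: mat_distrib matrix_mul_assoc sq' sq0 scaleR_2)
      ultimately show ?thesis by (simp add: k_def D_def mat_scaleR_left mat_scaleR_right)
    qed
    have Ak: "A ** k A = k A ** A0"
      unfolding k_def by (simp add: mat_distrib matrix_mul_assoc AA sq0')
    have ts: "transpose (s A) = matrix_inv P ** transpose (k A)"
      using transpose_matrix_inv(2)[OF i] tP by (simp add: s_def P_def[symmetric] matrix_transpose_mul)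
    have "transpose (s A) ** s A = matrix_inv P ** (transpose (k A) ** k A) ** matrix_inv P"
      unfolding ts by (simp add: s_def P_def[symmetric] matrix_mul_assoc)
    also have "\<dots> = (matrix_inv P ** P) ** (P ** matrix_inv P)"
      unfolding tk P(2)[symmetric] by (simp only: matrix_mul_assoc)
    finally have o: "orthogonal_matrix (s A)"
      by (simp add: orthogonal_matrix matrix_inv_left[OF i] matrix_inv_right[OF i])
    have "s A ** A0 = k A ** (matrix_inv P ** A0)" by (simp add: s_def P_def[symmetric] matrix_mul_assoc)
    also have "\<dots> = (k A ** A0) ** matrix_inv P" unfolding iPA0 by (simp only: matrix_mul_assoc)
    also have "\<dots> = A ** s A" unfolding Ak[symmetric] by (simp add: s_def P_def[symmetric] matrix_mul_assoc)
    finally have "s A ** A0 ** transpose (s A) = A ** (s A ** transpose (s A))" by (simp only: matrix_mul_assoc)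
    then show ?thesis using o orthogonal_matrixD(2)[OF o] by simp
  qed
  ultimately show ?thesis using that W A0W by blast
qed

section \<open>Block matrices and the normal form\<close>

lemma sum_UNIV_block:
  fixes g :: "'m::finite \<times> 2 \<Rightarrow> real"
  shows "(\<Sum>j\<in>UNIV. g j) = (\<Sum>i\<in>UNIV. g (i, 1) + g (i, 2))"
proof -
  have "(\<Sum>i\<in>UNIV. \<Sum>a\<in>{1, 2}. g (i, a)) = sum g (UNIV \<times> {1, 2})"
    by (subst sum.cartesian_product) simp
  then show ?thesis unfolding UNIV_block by simp
qed

lemma J_mult:
  fixes X :: "real^'p^('m::finite \<times> 2)"
  shows "(J ** X) $ (i, 1) $ c = X $ (i, 2) $ c" "(J ** X) $ (i, 2) $ c = - X $ (i, 1) $ c"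
proof -
  have "(J ** X) $ (i, a) $ c = E0 $ a $ 1 * X $ (i, 1) $ c + E0 $ a $ 2 * X $ (i, 2) $ c" for a
  proof -
    have "(J ** X) $ (i, a) $ c = (\<Sum>j\<in>UNIV. (J $ (i, a) $ (j, 1) * X $ (j, 1) $ c + J $ (i, a) $ (j, 2) * X $ (j, 2) $ c))"
      by (simp only: matrix_matrix_mult_def vec_lambda_beta sum_UNIV_block)
    also have "\<dots> = (\<Sum>j\<in>UNIV. if i = j then E0 $ a $ 1 * X $ (i, 1) $ c + E0 $ a $ 2 * X $ (i, 2) $ c else 0)"
      by (intro sum.cong refl) (simp add: J_entry)
    finally show ?thesis by simp
  qed
  then show "(J ** X) $ (i, 1) $ c = X $ (i, 2) $ c" "(J ** X) $ (i, 2) $ c = - X $ (i, 1) $ c"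
    by (simp_all only: E0_entries)
qed

lemma mult_J:
  fixes X :: "real^('m::finite \<times> 2)^'p"
  shows "(X ** J) $ r $ (j, 1) = - X $ r $ (j, 2)" "(X ** J) $ r $ (j, 2) = X $ r $ (j, 1)"
proof -
  have "(X ** J) $ r $ (j, a) = X $ r $ (j, 1) * E0 $ 1 $ a + X $ r $ (j, 2) * E0 $ 2 $ a" for a
  proof -
    have "(X ** J) $ r $ (j, a) = (\<Sum>i\<in>UNIV. (X $ r $ (i, 1) * J $ (i, 1) $ (j, a) + X $ r $ (i, 2) * J $ (i, 2) $ (j, a)))"
      by (simp only: matrix_matrix_mult_def vec_lambda_beta sum_UNIV_block)
    also have "\<dots> = (\<Sum>i\<in>UNIV. if i = j then X $ r $ (j, 1) * E0 $ 1 $ a + X $ r $ (j, 2) * E0 $ 2 $ a else 0)"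
      by (intro sum.cong refl) (simp add: J_entry)
    finally show ?thesis by simp
  qed
  then show "(X ** J) $ r $ (j, 1) = - X $ r $ (j, 2)" "(X ** J) $ r $ (j, 2) = X $ r $ (j, 1)"
    by (simp_all only: E0_entries)
qed

lemma block_cases: "(\<And>i. P (i, 1)) \<Longrightarrow> (\<And>i. P (i, 2)) \<Longrightarrow> P (j :: 'm \<times> 2)"
proof -
  assume *: "\<And>i. P (i, 1)" "\<And>i. P (i, 2)"
  obtain i a where j: "j = (i, a)" by (cases j)
  have "a = 1 \<or> a = 2" using exhaust_2 by blast
  then show ?thesis using * j by auto
qed

lemma block_matrix_eqI:
  fixes A B :: "'m::finite block_matrix"
  assumes "\<And>i j. A $ (i, 1) $ (j, 1) = B $ (i, 1) $ (j, 1)" "\<And>i j. A $ (i, 1) $ (j, 2) = B $ (i, 1) $ (j, 2)"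
    "\<And>i j. A $ (i, 2) $ (j, 1) = B $ (i, 2) $ (j, 1)" "\<And>i j. A $ (i, 2) $ (j, 2) = B $ (i, 2) $ (j, 2)"
  shows "A = B"
proof -
  have "A $ r $ c = B $ r $ c" for r c
    by (rule block_cases[where j = r]; rule block_cases[where j = c]) (use assms in blast)+
  then show ?thesis by (simp add: vec_eq_iff)
qed

lemma J_ocs: "J \<in> (ocs :: 'm::finite block_matrix set)"
proof -
  have "transpose J = (- J :: 'm block_matrix)"
    by (rule block_matrix_eqI) (auto simp: transpose_def J_entry E0_entries)
  moreover have "J ** J = (- mat 1 :: 'm block_matrix)"
    by (rule block_matrix_eqI) (auto simp: J_mult J_entry E0_entries mat_def)
  ultimately show ?thesis by (simp add: ocs_def)
qed

text \<open>An orthonormal family over the complex numbers defined by \<open>A\<close>, chosen one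
  vector at a time. The real span of the vectors chosen so far and of their images under
  \<open>A\<close> has dimension below \<open>2 * CARD('m)\<close>, so a unit vector orthogonal to
  it exists.\<close>

lemma orthonormal_complex_family:
  fixes A :: "'m::finite block_matrix"
  assumes A: "A \<in> ocs" and K: "finite K"
  shows "\<exists>x :: 'm \<Rightarrow> real^('m \<times> 2). (\<forall>i\<in>K. norm (x i) = 1) \<and> (\<forall>i\<in>K. \<forall>j\<in>K. i \<noteq> j \<longrightarrow> x i \<bullet> x j = 0) \<and>
    (\<forall>i\<in>K. \<forall>j\<in>K. x i \<bullet> (A *v x j) = 0)"
  using K
proof (induction K rule: finite_induct)
  case empty
  then show ?case by simp
next
  case (insert k K)
  note sk = inner_matrix_vector_skew[OF ocsD(1)[OF A]]
  have self: "u \<bullet> (A *v u) = 0" for u using sk[of u u] by (simp add: inner_commute)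
  obtain x :: "'m \<Rightarrow> real^('m \<times> 2)" where "(\<forall>i\<in>K. norm (x i) = 1) \<and>
      (\<forall>i\<in>K. \<forall>j\<in>K. i \<noteq> j \<longrightarrow> x i \<bullet> x j = 0) \<and> (\<forall>i\<in>K. \<forall>j\<in>K. x i \<bullet> (A *v x j) = 0)"
    using insert.IH by (rule exE)
  then have x: "\<And>i. i \<in> K \<Longrightarrow> norm (x i) = 1" "\<And>i j. i \<in> K \<Longrightarrow> j \<in> K \<Longrightarrow> i \<noteq> j \<Longrightarrow> x i \<bullet> x j = 0"
    "\<And>i j. i \<in> K \<Longrightarrow> j \<in> K \<Longrightarrow> x i \<bullet> (A *v x j) = 0"
    by simp_all
  let ?S = "x ` K \<union> (\<lambda>i. A *v x i) ` K"
  have "dim ?S \<le> card ?S" using insert.hyps(1) by (intro dim_le_card') auto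
  also have "\<dots> \<le> card K + card K"
    by (intro order_trans[OF card_Un_le] add_mono card_image_le insert.hyps(1))
  also have "\<dots> < 2 * CARD('m)"
  proof -
    have "K \<subset> UNIV" using insert.hyps(2) by blast
    then have "card K < CARD('m)" by (intro psubset_card_mono) auto
    then show ?thesis by simp
  qed
  also have "\<dots> = DIM(real^('m \<times> 2))" by simp
  finally obtain y where y: "y \<noteq> 0" "\<And>z. z \<in> span ?S \<Longrightarrow> orthogonal y z"
    using orthogonal_to_subspace_exists by metis
  define u where "u = y /\<^sub>R norm y"
  have u1: "norm u = 1" using y(1) by (simp add: u_def)
  have uS: "u \<bullet> z = 0" if "z \<in> ?S" for z
    using y(2)[OF span_base[OF that]] by (simp add: u_def orthogonal_def)
  have ux: "u \<bullet> x i = 0" "u \<bullet> (A *v x i) = 0" if "i \<in> K" for i using uS that by blast+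
  have xAu: "x i \<bullet> (A *v u) = 0" if "i \<in> K" for i
    using sk[of "x i" u] ux(2)[OF that] by (simp add: inner_commute)
  define x' where "x' = x(k := u)"
  have "(\<forall>i\<in>insert k K. norm (x' i) = 1) \<and> (\<forall>i\<in>insert k K. \<forall>j\<in>insert k K. i \<noteq> j \<longrightarrow> x' i \<bullet> x' j = 0) \<and>
    (\<forall>i\<in>insert k K. \<forall>j\<in>insert k K. x' i \<bullet> (A *v x' j) = 0)"
    using x ux xAu u1 self insert.hyps(2) by (auto simp: x'_def inner_commute)
  then show ?case by blast
qed

theorem ocs_normal_form:
  fixes A :: "'m::finite block_matrix"
  assumes A: "A \<in> ocs"
  obtains Q where "orthogonal_matrix Q" "A = Q ** J ** transpose Q"
proof -
  note sk = inner_matrix_vector_skew[OF ocsD(1)[OF A]]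
  have AA: "A *v (A *v v) = - v" for v
    using ocsD(2)[OF A] cstructs_UNIV A by (auto simp: cstructs_def)
  obtain x :: "'m \<Rightarrow> real^('m \<times> 2)" where "(\<forall>i\<in>UNIV. norm (x i) = 1) \<and>
      (\<forall>i\<in>UNIV. \<forall>j\<in>UNIV. i \<noteq> j \<longrightarrow> x i \<bullet> x j = 0) \<and> (\<forall>i\<in>UNIV. \<forall>j\<in>UNIV. x i \<bullet> (A *v x j) = 0)"
    using orthonormal_complex_family[OF A finite] by (rule exE)
  then have x: "\<And>i. norm (x i) = 1" "\<And>i j. i \<noteq> j \<Longrightarrow> x i \<bullet> x j = 0"
    "\<And>i j. x i \<bullet> (A *v x j) = 0"
    by simp_all
  \<comment> \<open>The minus sign follows \<open>E0\<close>, whose first column is minus the second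
    unit vector: \<open>A ** Q = Q ** J\<close> demands that the second column of a block be
    \<open>- (A *v x i)\<close>.\<close>
  define q where "q c = (if snd c = 1 then x (fst c) else - (A *v x (fst c)))" for c :: "'m \<times> 2"
  define Q where "Q = (\<chi> r c. q c $ r)"
  have col: "column c Q = q c" for c by (simp add: Q_def column_def vec_eq_iff)
  have Axx: "(A *v x i) \<bullet> (A *v x j) = x i \<bullet> x j" for i j by (simp add: sk AA)
  have inner: "q c \<bullet> q d = (if c = d then 1 else 0)" for c d
  proof -
    have nx: "x i \<bullet> x i = 1" for i using x(1) by (simp add: norm_eq_1)
    have Axx': "(A *v x i) \<bullet> x j = 0" for i j using x(3)[of j i] by (simp add: inner_commute)
    have "snd c = 1 \<or> snd c = 2" "snd d = 1 \<or> snd d = 2" using exhaust_2 by blast+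
    then show ?thesis
      by (cases c; cases d) (auto simp: q_def Axx Axx' x nx)
  qed
  have o: "orthogonal_matrix Q"
    unfolding orthogonal_matrix_orthonormal_columns col by (simp add: norm_eq_1 orthogonal_def inner)
  have AQ: "A ** Q = Q ** J"
  proof -
    have e: "(A ** Q) $ r $ c = (A *v q c) $ r" for r c
      by (simp add: matrix_matrix_mult_def matrix_vector_mult_def Q_def)
    have Aq: "A *v q (j, 1) = - q (j, 2)" "A *v q (j, 2) = q (j, 1)" for j
      by (simp_all add: q_def linear_neg[OF matrix_vector_mul_linear] AA)
    have "(A ** Q) $ r $ c = (Q ** J) $ r $ c" for r c
      by (rule block_cases[where j = c]) (simp_all only: e Aq mult_J, simp_all add: Q_def)
    then show ?thesis by (simp add: vec_eq_iff)
  qed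
  have "A = A ** (Q ** transpose Q)" using orthogonal_matrixD(2)[OF o] by simp
  also have "\<dots> = Q ** J ** transpose Q" by (simp only: matrix_mul_assoc AQ)
  finally show ?thesis using that o by blast
qed

lemma ocs_conj:
  fixes A R :: "real^'n^'n"
  assumes "A \<in> ocs" "orthogonal_matrix R" shows "R ** A ** transpose R \<in> ocs"
proof -
  have "transpose (R ** A ** transpose R) = - (R ** A ** transpose R)"
    by (simp add: matrix_transpose_mul ocsD(1)[OF assms(1)] mat_minus_left mat_minus_right matrix_mul_assoc)
  moreover have "R ** A ** transpose R ** (R ** A ** transpose R) = R ** A ** (transpose R ** R) ** A ** transpose R"
    by (simp only: matrix_mul_assoc)
  then have "R ** A ** transpose R ** (R ** A ** transpose R) = - mat 1"
    using assms by (simp add: orthogonal_matrix_def ocsD(2) mat_minus_left mat_minus_right flip: matrix_mul_assoc)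
      (simp add: ocsD(2) mat_minus_left mat_minus_right matrix_mul_assoc)
  ultimately show ?thesis by (simp add: ocs_def)
qed

section \<open>Dimension of the tangent spaces\<close>

lemma dim_anticomm_conj:
  fixes A Q :: "real^'n^'n"
  assumes Q: "orthogonal_matrix Q"
  shows "dim (anticomm (Q ** A ** transpose Q)) = dim (anticomm A)"
proof -
  define c where "c R X = R ** X ** transpose R" for R X :: "real^'n^'n"
  have lin: "linear (c R)" for R
    unfolding c_def by (rule linear_compose[OF linear_matrix_mult_right linear_matrix_mult_left, unfolded o_def])
  have cc: "c R X ** c R Y = c R (X ** Y)" if "orthogonal_matrix R" for R X Y
  proof -
    have "c R X ** c R Y = R ** X ** (transpose R ** R) ** Y ** transpose R" by (simp only: c_def matrix_mul_assoc)
    then show ?thesis using orthogonal_matrixD(1)[OF that] by (simp add: c_def matrix_mul_assoc)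
  qed
  have im: "c R X \<in> anticomm (c R A)" if "X \<in> anticomm A" "orthogonal_matrix R" for R X A
  proof -
    have "transpose (c R X) = - c R X"
      using that(1) by (simp add: c_def anticomm_def skew_matrices_def matrix_transpose_mul mat_minus_left mat_minus_right matrix_mul_assoc)
    moreover have "c R X ** c R A = - (c R A ** c R X)"
      unfolding cc[OF that(2)] linear_neg[OF lin, symmetric] using that(1) by (simp add: anticomm_def)
    ultimately show ?thesis by (simp add: anticomm_def skew_matrices_def)
  qed
  have tQ: "orthogonal_matrix (transpose Q)" using Q by (simp add: orthogonal_matrix_def)
  have inv: "c Q (c (transpose Q) X) = X" "c (transpose Q) (c Q X) = X" for X
  proof -
    have "c Q (c (transpose Q) X) = (Q ** transpose Q) ** X ** (Q ** transpose Q)"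
      "c (transpose Q) (c Q X) = (transpose Q ** Q) ** X ** (transpose Q ** Q)"
      by (simp_all only: c_def matrix_mul_assoc transpose_transpose)
    then show "c Q (c (transpose Q) X) = X" "c (transpose Q) (c Q X) = X"
      using orthogonal_matrixD[OF Q] by simp_all
  qed
  have "c Q ` anticomm A = anticomm (c Q A)"
  proof
    show "c Q ` anticomm A \<subseteq> anticomm (c Q A)" using im Q by blast
    show "anticomm (c Q A) \<subseteq> c Q ` anticomm A"
    proof
      fix X assume "X \<in> anticomm (c Q A)"
      then have "c (transpose Q) X \<in> anticomm A" using im[OF _ tQ, of X "c Q A"] by (simp add: inv)
      then show "X \<in> c Q ` anticomm A" using inv(1) by (metis image_eqI)
    qed
  qed
  moreover have "dim (c Q ` anticomm A) = dim (anticomm A)"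
    by (rule dim_image_eq[OF lin]) (rule inj_on_inverseI[of _ "c (transpose Q)"], rule inv)
  ultimately show ?thesis by (simp add: c_def)
qed

lemma dim_zero_diagonal:
  "dim {c :: real^'m^'m. \<forall>i. c $ i $ i = 0} = CARD('m::finite) * (CARD('m) - 1)"
proof -
  let ?P = "SIGMA i:UNIV. UNIV - {i :: 'm}"
  let ?b = "\<lambda>(i, j). axis i (axis j 1) :: real^'m^'m"
  have inj: "inj ?b" by (rule injI) (auto simp: axis_eq_axis)
  have B: "(Basis :: (real^'m^'m) set) = range ?b"
    unfolding Basis_vec_def by (auto simp: image_iff)
  have ip: "c \<bullet> ?b (i, j) = c $ i $ j" for c :: "real^'m^'m" and i j
    by (simp add: inner_axis)
  have "(\<forall>i. c $ i $ i = 0) \<longleftrightarrow> (\<forall>b\<in>Basis. b \<notin> ?b ` ?P \<longrightarrow> c \<bullet> b = 0)" for c :: "real^'m^'m"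
  proof
    assume d: "\<forall>i. c $ i $ i = 0"
    show "\<forall>b\<in>Basis. b \<notin> ?b ` ?P \<longrightarrow> c \<bullet> b = 0"
    proof (intro ballI impI)
      fix x assume x: "x \<in> (Basis :: (real^'m^'m) set)" "x \<notin> ?b ` ?P"
      then obtain q where q: "x = ?b q" unfolding B by blast
      then have "q \<notin> ?P" using x(2) by blast
      then have "q = (fst q, fst q)" by (cases q) auto
      then show "c \<bullet> x = 0" using q ip[of c "fst q" "fst q"] d by metis
    qed
  next
    assume d: "\<forall>b\<in>Basis. b \<notin> ?b ` ?P \<longrightarrow> c \<bullet> b = 0"
    show "\<forall>i. c $ i $ i = 0"
    proof
      fix i
      have "?b (i, i) \<notin> ?b ` ?P" unfolding inj_image_mem_iff[OF inj] by simp
      then have "c \<bullet> ?b (i, i) = 0" using d unfolding B by blast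
      then show "c $ i $ i = 0" unfolding ip .
    qed
  qed
  then have E1: "{c :: real^'m^'m. \<forall>i. c $ i $ i = 0} = {c. \<forall>b\<in>Basis. b \<notin> ?b ` ?P \<longrightarrow> c \<bullet> b = 0}"
    by (rule Collect_cong)
  have E2: "dim {c :: real^'m^'m. \<forall>b\<in>Basis. b \<notin> ?b ` ?P \<longrightarrow> c \<bullet> b = 0} = card (?b ` ?P)"
    by (rule dim_substandard) (subst B, rule image_mono, rule subset_UNIV)
  have E3: "card (?b ` ?P) = card ?P" by (rule card_image[OF inj_on_subset[OF inj subset_UNIV]])
  have E4: "card ?P = CARD('m) * (CARD('m) - 1)" by (simp add: card_SigmaI)
  show ?thesis unfolding E1 E2 E3 E4 ..
qed

text \<open>The matrices anticommuting with \<open>J\<close> consist of blocks \<open>((a, b), (b, -a))\<close> with \<open>a\<close> and \<open>b\<close> skew in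
  the block indices. Storing \<open>a\<close> above and \<open>b\<close> below the diagonal turns the pair into an arbitrary
  matrix with zero diagonal.\<close>

lemma dim_anticomm_J: "dim (anticomm (J :: 'm::finite block_matrix)) = CARD('m) * (CARD('m) - 1)"
proof -
  \<comment> \<open>An arbitrary linear order on the blocks, to give meaning to above and below the
    diagonal.\<close>
  obtain f :: "'m \<Rightarrow> nat" where f: "inj f" using finite_imp_inj_to_nat_seg[of "UNIV :: 'm set"] by auto
  define a where "a c i j = (if f i < f j then c $ i $ j else if f j < f i then - c $ j $ i else 0)"
    for c :: "real^'m^'m" and i j
  define b where "b c i j = (if f j < f i then c $ i $ j else if f i < f j then - c $ j $ i else 0)"
    for c :: "real^'m^'m" and i j
  define h where "h c = ((\<chi> r s. if snd r = 1 then (if snd s = 1 then a c (fst r) (fst s) else b c (fst r) (fst s))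
      else (if snd s = 1 then b c (fst r) (fst s) else - a c (fst r) (fst s))) :: 'm block_matrix)" for c :: "real^'m^'m"
  define Z where "Z = {c :: real^'m^'m. \<forall>i. c $ i $ i = 0}"
  have h_simps: "h c $ (i, 1) $ (j, 1) = a c i j" "h c $ (i, 1) $ (j, 2) = b c i j"
    "h c $ (i, 2) $ (j, 1) = b c i j" "h c $ (i, 2) $ (j, 2) = - a c i j" for c i j
    by (simp_all add: h_def)
  have lin: "linear h"
    by (rule linearI; rule block_matrix_eqI) (simp_all add: h_simps a_def b_def)
  have ff: "f i < f j \<or> f j < f i" if "i \<noteq> j" for i j using f that by (metis injD linorder_neqE_nat)
  have a_skew: "a c i j = - a c j i" and b_skew: "b c i j = - b c j i" for c i j
    by (auto simp: a_def b_def)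
  have inj: "inj_on h (span Z)"
  proof -
    have "subspace Z" by (simp add: subspace_def Z_def)
    moreover have "c = 0" if "c \<in> Z" "h c = 0" for c
    proof -
      have ab: "a c i j = 0" "b c i j = 0" for i j
        using h_simps(1,2)[of c i j] that(2) by simp_all
      have "c $ i $ j = 0" for i j
      proof (cases "i = j")
        case False
        then show ?thesis using ff[OF False] ab[of i j] by (auto simp: a_def b_def)
      qed (use that in \<open>simp add: Z_def\<close>)
      then show ?thesis by (simp add: vec_eq_iff)
    qed
    ultimately show ?thesis using lin by (simp add: span_eq_iff[THEN iffD2] linear_inj_on_iff_eq_0)
  qed
  have "h ` Z = anticomm J"
  proof
    show "h ` Z \<subseteq> anticomm J"
    proof (rule image_subsetI)
      fix c assume "c \<in> Z"
      have "transpose (h c) = - h c"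
      proof (rule block_matrix_eqI)
        have tr: "transpose (h c) $ r $ s = h c $ s $ r" for r s
          by (simp add: transpose_def)
        fix i j
        show "transpose (h c) $ (i, 1) $ (j, 1) = (- h c) $ (i, 1) $ (j, 1)"
          unfolding tr vector_uminus_component h_simps by (rule a_skew)
        show "transpose (h c) $ (i, 1) $ (j, 2) = (- h c) $ (i, 1) $ (j, 2)"
          unfolding tr vector_uminus_component h_simps by (rule b_skew)
        show "transpose (h c) $ (i, 2) $ (j, 1) = (- h c) $ (i, 2) $ (j, 1)"
          unfolding tr vector_uminus_component h_simps by (rule b_skew)
        show "transpose (h c) $ (i, 2) $ (j, 2) = (- h c) $ (i, 2) $ (j, 2)"
          unfolding tr vector_uminus_component h_simps using a_skew[of c j i] by simp
      qed
      moreover have "h c ** J = - (J ** h c)"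
        by (rule block_matrix_eqI) (simp_all add: J_mult mult_J h_simps)
      ultimately show "h c \<in> anticomm J" by (simp add: anticomm_def skew_matrices_def)
    qed
    show "anticomm J \<subseteq> h ` Z"
    proof
      fix W :: "'m block_matrix" assume W: "W \<in> anticomm J"
      then have t: "transpose W = - W" and wJ: "W ** J = - (J ** W)"
        by (simp_all add: anticomm_def skew_matrices_def)
      have sk: "W $ r $ c = - W $ c $ r" for r c
        using arg_cong[OF t, of "\<lambda>M. M $ c $ r"] by (simp add: transpose_def)
      have ac: "(W ** J) $ r $ c = - (J ** W) $ r $ c" for r c
        unfolding wJ by simp
      \<comment> \<open>Comparing entries of \<open>W ** J\<close> and \<open>- (J ** W)\<close>
        expresses the lower half of each block by its upper half.\<close>
      have w1: "W $ (i, 2) $ (j, 1) = W $ (i, 1) $ (j, 2)" for i j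
        using ac[of "(i, 1)" "(j, 1)"] by (simp add: J_mult mult_J)
      have w2: "W $ (i, 2) $ (j, 2) = - W $ (i, 1) $ (j, 1)" for i j
        using ac[of "(i, 1)" "(j, 2)"] by (simp add: J_mult mult_J)
      define c where "c = (\<chi> i j. if f i < f j then W $ (i, 1) $ (j, 1) else if f j < f i then W $ (i, 1) $ (j, 2) else 0)"
      have aW: "a c i j = W $ (i, 1) $ (j, 1)" for i j
      proof (cases "i = j")
        case True
        then show ?thesis using sk[of "(i, 1)" "(i, 1)"] by (simp add: a_def)
      next
        case False
        then show ?thesis using ff[OF False] sk[of "(i, 1)" "(j, 1)"] by (auto simp: a_def c_def)
      qed
      have bW: "b c i j = W $ (i, 1) $ (j, 2)" for i j
      proof (cases "i = j")
        case True
        then show ?thesis using sk[of "(i, 1)" "(i, 2)"] w1[of i i] by (simp add: b_def)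
      next
        case False
        then show ?thesis using ff[OF False] sk[of "(i, 1)" "(j, 2)"] w1[of j i] by (auto simp: b_def c_def)
      qed
      have "W = h c"
        by (rule block_matrix_eqI) (simp_all add: h_simps aW bW w1 w2)
      moreover have "c \<in> Z" by (simp add: Z_def c_def)
      ultimately show "W \<in> h ` Z" by blast
    qed
  qed
  then have "dim (anticomm (J :: 'm block_matrix)) = dim Z"
    using dim_image_eq[OF lin inj] by simp
  then show ?thesis unfolding Z_def dim_zero_diagonal .
qed

lemma dim_anticomm:
  fixes A :: "'m::finite block_matrix"
  assumes "A \<in> ocs" shows "dim (anticomm A) = CARD('m) * (CARD('m) - 1)"
  using ocs_normal_form[OF assms] dim_anticomm_conj dim_anticomm_J by metis

section \<open>The components\<close>

definition conj_mat :: "real^'n^'n \<Rightarrow> real^'n^'n \<Rightarrow> real^'n^'n" where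
  "conj_mat Q X = Q ** X ** transpose Q"

lemma conj_mat_conj_mat: "conj_mat P (conj_mat Q X) = conj_mat (P ** Q) X"
  by (simp only: conj_mat_def matrix_transpose_mul matrix_mul_assoc)

lemma conj_mat_id: "conj_mat (mat 1) X = X"
  by (simp add: conj_mat_def)

lemma orthogonal_transpose: "orthogonal_matrix Q \<Longrightarrow> orthogonal_matrix (transpose Q)" for Q :: "real^'n^'n"
  by (simp add: orthogonal_matrix_def)

lemma pfaffian_conj_mat: "pfaffian (conj_mat Q A) = det Q * pfaffian A"
  by (simp add: conj_mat_def pfaffian_conj)

lemma pfaffian_ocs:
  fixes A :: "'m::finite block_matrix"
  assumes "A \<in> ocs" shows "pfaffian A = 1 \<or> pfaffian A = -1"
proof -
  obtain Q where "orthogonal_matrix Q" "A = Q ** J ** transpose Q" using ocs_normal_form[OF assms] .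
  then show ?thesis using det_orthogonal_matrix[of Q] by (auto simp: pfaffian_conj pfaffian_J)
qed

text \<open>Inside the orthogonal group it is the stabiliser of \<open>J\<close> under conjugation,
  hence the group whose cosets are the fibres of the orbit map.\<close>

lemma unitary_group_iff: "Q \<in> unitary_group \<longleftrightarrow> conj_mat Q J = J \<and> orthogonal_matrix Q"
  by (simp add: unitary_group_def symplectic_group_def conj_mat_def)

lemma unitary_group_mult: "u \<in> unitary_group \<Longrightarrow> v \<in> unitary_group \<Longrightarrow> u ** v \<in> unitary_group"
  by (simp add: unitary_group_iff orthogonal_matrix_mul flip: conj_mat_conj_mat)

lemma unitary_group_transpose:
  assumes "u \<in> unitary_group" shows "transpose u \<in> unitary_group"
proof -
  have u: "conj_mat u J = J" "orthogonal_matrix u" using assms by (simp_all add: unitary_group_iff)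
  have "conj_mat (transpose u) J = conj_mat (transpose u) (conj_mat u J)" unfolding u(1) ..
  also have "\<dots> = J" unfolding conj_mat_conj_mat orthogonal_matrixD(1)[OF u(2)] by (rule conj_mat_id)
  finally show ?thesis using u(2) by (simp add: unitary_group_iff orthogonal_transpose)
qed

lemma left_coset_unitary_eq:
  fixes g h :: "'m::finite block_matrix"
  assumes g: "orthogonal_matrix g" and h: "orthogonal_matrix h"
  shows "left_coset unitary_group g = left_coset unitary_group h \<longleftrightarrow> transpose g ** h \<in> unitary_group"
proof
  assume eq: "left_coset unitary_group g = left_coset unitary_group h"
  have "mat 1 \<in> (unitary_group :: 'm block_matrix set)"
    by (simp add: unitary_group_iff conj_mat_id orthogonal_matrix_id)
  then have "h ** mat 1 \<in> left_coset unitary_group h" unfolding left_coset_def by (rule imageI)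
  then obtain u where u: "u \<in> unitary_group" "h = g ** u" unfolding eq[symmetric] by (auto simp: left_coset_def)
  then have "transpose g ** h = (transpose g ** g) ** u" by (simp only: matrix_mul_assoc)
  then show "transpose g ** h \<in> unitary_group" using u(1) orthogonal_matrixD(1)[OF g] by simp
next
  assume u: "transpose g ** h \<in> unitary_group"
  let ?u = "transpose g ** h"
  have hg: "h = g ** ?u" using orthogonal_matrixD(2)[OF g] by (simp add: matrix_mul_assoc)
  have gh: "g = h ** transpose ?u"
    using orthogonal_matrixD(2)[OF h] by (simp add: matrix_transpose_mul matrix_mul_assoc)
  have sub: "left_coset unitary_group (a ** u) \<subseteq> left_coset unitary_group a"
    if "u \<in> unitary_group" for a u :: "'m block_matrix"
    using unitary_group_mult[OF that] by (auto simp: left_coset_def simp flip: matrix_mul_assoc)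
  show "left_coset unitary_group g = left_coset unitary_group h"
    using sub[OF u, of g] sub[OF unitary_group_transpose[OF u], of h] hg gh by simp
qed

text \<open>Labelling a component by an orthogonal matrix instead of a sign treats both signs at
  once and supplies the base point \<open>conj_mat R J\<close>.\<close>

definition signed_ocs :: "'m::finite block_matrix \<Rightarrow> 'm block_matrix set" where
  "signed_ocs R = {A \<in> ocs. pfaffian A = det R}"

lemma openin_signed_ocs:
  fixes R :: "'m::finite block_matrix"
  assumes "orthogonal_matrix R"
  shows "openin (top_of_set ocs) (signed_ocs R)"
proof -
  have d: "det R = 1 \<or> det R = -1" by (rule det_orthogonal_matrix[OF assms])
  \<comment> \<open>On \<open>ocs\<close> the Pfaffian takes only the values 1 and -1, so equality
    with \<open>det R\<close> is the open condition of having the same sign.\<close>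
  have "signed_ocs R = ocs \<inter> (\<lambda>A. pfaffian A * det R) -` {0<..}"
    using d pfaffian_ocs by (fastforce simp: signed_ocs_def)
  moreover have "open ((\<lambda>A :: 'm block_matrix. pfaffian A * det R) -` {0<..})"
    by (intro open_vimage continuous_intros continuous_on_pfaffian)
  ultimately show ?thesis using openin_open_Int by simp
qed

lemma conj_mat_ocs: "A \<in> ocs \<Longrightarrow> orthogonal_matrix R \<Longrightarrow> conj_mat R A \<in> ocs"
  unfolding conj_mat_def by (rule ocs_conj)

lemma submanifold_block_ocs:
  "submanifold skew_matrices (CARD('m) * (CARD('m) - 1)) (ocs :: 'm::finite block_matrix set)"
  by (rule submanifold_ocs) (rule dim_anticomm)

lemma submanifold_signed_ocs:
  fixes R :: "'m::finite block_matrix"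
  assumes "orthogonal_matrix R"
  shows "submanifold skew_matrices (CARD('m) * (CARD('m) - 1)) (signed_ocs R)"
  by (rule submanifold_open_subset[OF submanifold_block_ocs openin_signed_ocs[OF assms]])

text \<open>Rotations act on the base point through \<open>R ** g\<close>, so by
  \<open>pfaffian_conj\<close> every value has Pfaffian \<open>det R\<close>; the normal form shows
  that all such matrices occur. Sections come from \<open>local_conjugation\<close> at the given
  point.\<close>

lemma homogeneous_fibration_signed_ocs:
  fixes R :: "'m::finite block_matrix"
  assumes R: "orthogonal_matrix R"
  shows "homogeneous_fibration special_orthogonal_group unitary_group (\<lambda>g. conj_mat (R ** g) J) (signed_ocs R)
    (dim (skew_matrices :: 'm block_matrix set)) (CARD('m) * (CARD('m) - 1))"
proof
  let ?p = "\<lambda>g. conj_mat (R ** g) (J :: 'm block_matrix)"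
  let ?SO = "special_orthogonal_group :: 'm block_matrix set"
  have SO: "g \<in> ?SO \<longleftrightarrow> orthogonal_matrix g \<and> det g = 1" for g
    by (simp add: special_orthogonal_group_def rotation_matrix_def)
  have dR: "det R * det R = 1" using det_orthogonal_matrix[OF R] by auto
  have p_mem: "?p g \<in> signed_ocs R" if "g \<in> ?SO" for g
    using that R by (simp add: SO signed_ocs_def conj_mat_ocs J_ocs orthogonal_matrix_mul pfaffian_conj_mat pfaffian_J det_mul)
  show "?p ` ?SO = signed_ocs R"
  proof
    show "?p ` ?SO \<subseteq> signed_ocs R" using p_mem by blast
    show "signed_ocs R \<subseteq> ?p ` ?SO"
    proof
      fix A assume A: "A \<in> signed_ocs R"
      then obtain Q where Q: "orthogonal_matrix Q" "A = Q ** J ** transpose Q"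
        using ocs_normal_form[of A] by (auto simp: signed_ocs_def)
      have "det Q = det R" using A Q(2) by (simp add: signed_ocs_def pfaffian_conj pfaffian_J)
      then have "transpose R ** Q \<in> ?SO"
        using Q(1) R dR by (simp add: SO orthogonal_matrix_mul orthogonal_transpose det_mul det_transpose)
      moreover have "R ** (transpose R ** Q) = Q"
        using orthogonal_matrixD(2)[OF R] by (simp add: matrix_mul_assoc)
      then have "A = ?p (transpose R ** Q)" using Q(2) by (simp add: conj_mat_def)
      ultimately show "A \<in> ?p ` ?SO" by blast
    qed
  qed
  show "?p g = ?p h \<longleftrightarrow> left_coset unitary_group g = left_coset unitary_group h" if gh: "g \<in> ?SO" "h \<in> ?SO" for g h
  proof -
    have o: "orthogonal_matrix g" "orthogonal_matrix h" using gh SO by auto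
    have og: "orthogonal_matrix (R ** g)" using o(1) R by (simp add: orthogonal_matrix_mul)
    have e: "transpose (R ** g) ** (R ** h) = transpose g ** h"
    proof -
      have "transpose (R ** g) ** (R ** h) = transpose g ** (transpose R ** R) ** h"
        by (simp only: matrix_transpose_mul matrix_mul_assoc)
      then show ?thesis using orthogonal_matrixD(1)[OF R] by simp
    qed
    have "?p g = ?p h \<longleftrightarrow> conj_mat (transpose g ** h) J = (J :: 'm block_matrix)"
    proof
      assume "?p g = ?p h"
      then have "conj_mat (transpose (R ** g)) (?p g) = conj_mat (transpose (R ** g)) (?p h)" by simp
      then show "conj_mat (transpose g ** h) J = (J :: 'm block_matrix)"
        unfolding conj_mat_conj_mat orthogonal_matrixD(1)[OF og] e conj_mat_id by simp
    next
      assume "conj_mat (transpose g ** h) J = (J :: 'm block_matrix)"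
      then have "?p g = conj_mat (R ** g) (conj_mat (transpose g ** h) J)" by simp
      also have "\<dots> = conj_mat (R ** (g ** transpose g) ** h) J"
        unfolding conj_mat_conj_mat by (simp only: matrix_mul_assoc)
      finally show "?p g = ?p h" using orthogonal_matrixD(2)[OF o(1)] by simp
    qed
    also have "\<dots> \<longleftrightarrow> transpose g ** h \<in> unitary_group"
      using o by (simp add: unitary_group_iff orthogonal_matrix_mul orthogonal_transpose)
    finally show ?thesis unfolding left_coset_unitary_eq[OF o] .
  qed
  show "smooth_on ?SO ?p" unfolding conj_mat_def by (intro smooth_on_intros)
  show "charted (dim (skew_matrices :: 'm block_matrix set)) ?SO" by (rule charted_rotations)
  show "charted (CARD('m) * (CARD('m) - 1)) (signed_ocs R)"
    by (rule submanifold_imp_charted[OF submanifold_signed_ocs[OF R]])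
  show "\<exists>W s. openin (top_of_set (signed_ocs R)) W \<and> ?p x \<in> W \<and> smooth_on W s \<and> s (?p x) = x \<and>
      (\<forall>A\<in>W. s A \<in> ?SO \<and> ?p (s A) = A)" if x: "x \<in> ?SO" for x
  proof -
    have A0: "?p x \<in> signed_ocs R" by (rule p_mem[OF x])
    then have "?p x \<in> ocs" by (simp add: signed_ocs_def)
    then obtain W s where W: "open W" "?p x \<in> W" "smooth_on (ocs \<inter> W) s" "s (?p x) = mat 1"
      and s: "\<And>A. A \<in> ocs \<inter> W \<Longrightarrow> orthogonal_matrix (s A) \<and> s A ** ?p x ** transpose (s A) = A"
      using local_conjugation by metis
    \<comment> \<open>Chosen so that \<open>R ** t A = s A ** (R ** x)\<close>: conjugation by
      \<open>s A\<close> moves the base value \<open>?p x\<close> to \<open>A\<close>, and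
      \<open>t\<close> returns \<open>x\<close> at this value.\<close>
    define t where "t A = transpose R ** s A ** R ** x" for A
    have Rt: "R ** t A = s A ** (R ** x)" for A
    proof -
      have "R ** t A = (R ** transpose R) ** s A ** R ** x" by (simp only: t_def matrix_mul_assoc)
      then show ?thesis using orthogonal_matrixD(2)[OF R] by (simp add: matrix_mul_assoc)
    qed
    have "t A \<in> ?SO \<and> ?p (t A) = A" if A: "A \<in> signed_ocs R \<inter> W" for A
    proof
      have sA: "orthogonal_matrix (s A)" "conj_mat (s A) (?p x) = A"
        using s[of A] A by (auto simp: signed_ocs_def conj_mat_def)
      show pt: "?p (t A) = A" unfolding Rt conj_mat_conj_mat[symmetric] using sA(2) by (simp add: conj_mat_conj_mat)
      \<comment> \<open>Both \<open>A\<close> and \<open>?p x\<close> have Pfaffian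
        \<open>det R\<close>, which forces \<open>det (s A) = 1\<close>, so \<open>t A\<close> is a
        rotation.\<close>
      have "det R = pfaffian (conj_mat (s A) (?p x))" unfolding sA(2) using A by (simp add: signed_ocs_def)
      also have "\<dots> = det (s A) * pfaffian (?p x)" by (rule pfaffian_conj_mat)
      also have "pfaffian (?p x) = det R" using A0 by (simp add: signed_ocs_def)
      finally have "det (s A) * det R = det R" by simp
      then have "det (s A) = 1" using dR by auto
      then show "t A \<in> ?SO"
        using sA(1) R x dR by (simp add: SO t_def orthogonal_matrix_mul orthogonal_transpose det_mul det_transpose)
    qed
    moreover have "t (?p x) = x"
    proof -
      have "t (?p x) = (transpose R ** R) ** x" unfolding t_def W(4) by (simp add: matrix_mul_assoc)
      then show ?thesis using orthogonal_matrixD(1)[OF R] by simp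
    qed
    moreover have "smooth_on (signed_ocs R \<inter> W) t"
      unfolding t_def
      by (intro smooth_on_intros smooth_on_subset[OF W(3)]) (auto simp: signed_ocs_def)
    moreover have "openin (top_of_set (signed_ocs R)) (signed_ocs R \<inter> W)" using W(1) by (rule openin_open_Int)
    ultimately show ?thesis using A0 W(2) by blast
  qed
qed

lemma orthogonal_det_minus_one: "\<exists>R :: real^'n^'n. orthogonal_matrix R \<and> det R = -1"
proof -
  fix k :: 'n
  define R where "R = refl_mat (axis k 1 :: real^'n)"
  have a: "axis k (1::real) \<bullet> axis k 1 = 1" by (simp add: inner_axis_axis)
  have "axis k (1::real) \<noteq> 0" by simp
  then have "orthogonal_matrix R"
    using refl_mat_square[of "axis k 1"] by (simp add: R_def orthogonal_matrix transpose_refl_mat)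
  moreover have e: "R $ i $ j = (if i = j then (if i = k then -1 else 1) else 0)" for i j
    unfolding R_def refl_mat_def a outer_def by (simp add: mat_def axis_def)
  have "det R = (\<Prod>i\<in>UNIV. R $ i $ i)" by (rule det_diagonal) (simp add: e)
  then have "det R = -1" by (simp add: e)
  ultimately show ?thesis by blast
qed

text \<open>The connected pieces from the induction each lie in one of the two open sets cut out by
  the Pfaffian. Both of these are nonempty, so the two decompositions coincide.\<close>

lemma components_block_ocs:
  fixes R R' :: "'m::finite block_matrix"
  assumes R: "orthogonal_matrix R" "det R = 1" and R': "orthogonal_matrix R'" "det R' = -1"
  shows "components (ocs :: 'm block_matrix set) = {signed_ocs R, signed_ocs R'}"
    "simply_connected (signed_ocs R)" "simply_connected (signed_ocs R')"
proof -
  have "dim (UNIV :: (real^('m \<times> 2)) set) = 2 * (CARD('m) - 1) + 2"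
  proof -
    obtain n where "CARD('m) = Suc n" using zero_less_card_finite gr0_conv_Suc by blast
    then show ?thesis by simp
  qed
  then have "two_sc_pieces (ocs :: 'm block_matrix set)"
    using two_sc_pieces_cstructs[OF subspace_UNIV] unfolding cstructs_UNIV by blast
  then obtain E1 E2 where E: "(ocs :: 'm block_matrix set) = E1 \<union> E2" "E1 \<inter> E2 = {}" "E1 \<noteq> {}" "E2 \<noteq> {}"
    "openin (top_of_set ocs) E1" "openin (top_of_set ocs) E2" "simply_connected E1" "simply_connected E2"
    unfolding two_sc_pieces_def by blast
  note conn = E(7,8)[THEN simply_connected_imp_connected]
  have cov: "ocs = signed_ocs R \<union> signed_ocs R'" and dis: "signed_ocs R \<inter> signed_ocs R' = {}"
    using pfaffian_ocs R R' by (auto simp: signed_ocs_def)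
  have o: "openin (top_of_set ocs) (signed_ocs R)" "openin (top_of_set ocs) (signed_ocs R')"
    using openin_signed_ocs R R' by blast+
  have ne: "signed_ocs R \<noteq> {}" "signed_ocs R' \<noteq> {}"
    using conj_mat_ocs[OF J_ocs R(1)] conj_mat_ocs[OF J_ocs R'(1)]
    by (auto simp: signed_ocs_def pfaffian_conj_mat pfaffian_J)
  have sub: "E1 \<subseteq> signed_ocs R \<union> signed_ocs R'" "E2 \<subseteq> signed_ocs R \<union> signed_ocs R'"
    unfolding cov[symmetric] E(1) by simp_all
  have "E1 \<subseteq> signed_ocs R \<or> E1 \<subseteq> signed_ocs R'" "E2 \<subseteq> signed_ocs R \<or> E2 \<subseteq> signed_ocs R'"
    by (rule connected_subset_open_partition[OF conn(1) sub(1) dis o]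
        connected_subset_open_partition[OF conn(2) sub(2) dis o])+
  then have "(E1 = signed_ocs R \<and> E2 = signed_ocs R') \<or> (E1 = signed_ocs R' \<and> E2 = signed_ocs R)"
    using E(2) cov[unfolded E(1)] dis ne by blast
  moreover have "components ocs = {E1, E2}"
    by (rule components_two_pieces[OF E(1-6) conn])
  ultimately show "components (ocs :: 'm block_matrix set) = {signed_ocs R, signed_ocs R'}"
    "simply_connected (signed_ocs R)" "simply_connected (signed_ocs R')"
    using E(7,8) by (auto simp: insert_commute)
qed

section \<open>The cases of one and of two blocks\<close>

lemma openin_slice_dom:
  assumes "N \<subseteq> ocs" shows "openin (top_of_set N) (N \<inter> slice_dom A)"
proof -
  have "open ((\<lambda>B. B + A) -` {X. invertible X})"
    by (intro open_vimage open_invertible continuous_intros)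
  moreover have "N \<inter> slice_dom A = N \<inter> (\<lambda>B. B + A) -` {X. invertible X}"
    using assms ocsD(3) by (auto simp: slice_dom_def)
  ultimately show ?thesis using openin_open_Int by simp
qed

lemma clopen_in_connected:
  assumes "connected N" "T \<subseteq> N" "T \<noteq> {}" "closed T" "\<And>A. A \<in> T \<Longrightarrow> \<exists>U. openin (top_of_set N) U \<and> A \<in> U \<and> U \<subseteq> T"
  shows "T = N"
proof -
  have "openin (top_of_set N) T" by (subst openin_subopen) (use assms(5) in blast)
  moreover have "closedin (top_of_set N) T" using assms(2,4) by (rule closed_subset)
  ultimately show ?thesis using assms(1,3) unfolding connected_clopen by blast
qed

text \<open>The tangent space is zero, so the injective map \<open>slice A\<close> takes a single
  value on the part of \<open>ocs\<close> in its domain; the points are isolated.\<close>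

lemma connected_ocs_singleton:
  fixes N :: "'m::finite block_matrix set"
  assumes "CARD('m) = 1" "connected N" "N \<subseteq> ocs" "N \<noteq> {}"
  shows "\<exists>A. N = {A}"
proof -
  obtain A where A: "A \<in> N" using assms(4) by blast
  then have Ao: "A \<in> ocs" using assms(3) by blast
  have "anticomm A = {0}"
    using dim_anticomm[OF Ao] assms(1) subspace_0[OF subspace_anticomm[of A]] by auto
  then have "slice A B = slice A A" if "B \<in> ocs" "B \<in> slice_dom A" for B
    using slice_anticomm[OF Ao that] slice_anticomm[OF Ao Ao slice_dom_self[OF Ao]] by simp
  then have "B = A" if "B \<in> N \<inter> slice_dom A" for B
    using slice_props(3)[OF ocsD(3)[OF Ao]] slice_dom_self[OF Ao] that assms(3) by (metis IntE subsetD)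
  then have "{A} = N"
    using openin_slice_dom[OF assms(3), of A] A slice_dom_self[OF Ao]
    by (intro clopen_in_connected[OF assms(2)]) auto
  then show ?thesis by blast
qed

text \<open>For \<open>J\<close> the witness is a tensor product: the quarter turn \<open>s\<close>
  of the two blocks with \<open>d\<close>, the diagonal matrix of 1 and -1, which anticommutes with
  \<open>E0\<close>. The normal form transports it to \<open>A\<close>.\<close>

lemma ocs_anticomm_exists:
  fixes A :: "'m::finite block_matrix"
  assumes c: "CARD('m) = 2" and A: "A \<in> ocs"
  obtains K where "K \<in> ocs" "K ** A = - (A ** K)"
proof -
  obtain a b :: 'm where ab: "UNIV = {a, b}" "a \<noteq> b" using c by (auto simp: card_2_iff)
  define d :: "2 \<Rightarrow> 2 \<Rightarrow> real" where "d r s = (if r = s then (if r = 1 then 1 else -1) else 0)" for r s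
  have d: "d 1 1 = 1" "d 1 2 = 0" "d 2 1 = 0" "d 2 2 = -1" by (simp_all add: d_def)
  define s :: "'m \<Rightarrow> 'm \<Rightarrow> real" where "s i j = (if i = j then 0 else if i = a then 1 else -1)" for i j
  have ss: "s i j = - s j i" for i j using ab(1) by (cases "i = a"; cases "j = a") (auto simp: s_def)
  have s2: "(\<Sum>k\<in>UNIV. s i k * s k j) = (if i = j then -1 else 0)" for i j
  proof -
    have "i = a \<or> i = b" "j = a \<or> j = b" using ab(1) by blast+
    then show ?thesis unfolding ab(1) using ab(2) by (auto simp: s_def)
  qed
  define K0 where "K0 = ((\<chi> r c. s (fst r) (fst c) * d (snd r) (snd c)) :: 'm block_matrix)"
  have K0: "K0 $ (i, p) $ (j, q) = s i j * d p q" for i j p q by (simp add: K0_def)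
  have "transpose K0 = - K0"
  proof (rule block_matrix_eqI)
    have tr: "transpose K0 $ r $ c = K0 $ c $ r" for r c by (simp add: transpose_def)
    fix i j
    show "transpose K0 $ (i, 1) $ (j, 1) = (- K0) $ (i, 1) $ (j, 1)"
      "transpose K0 $ (i, 1) $ (j, 2) = (- K0) $ (i, 1) $ (j, 2)"
      "transpose K0 $ (i, 2) $ (j, 1) = (- K0) $ (i, 2) $ (j, 1)"
      "transpose K0 $ (i, 2) $ (j, 2) = (- K0) $ (i, 2) $ (j, 2)"
      unfolding tr vector_uminus_component K0 d using ss[of i j] by simp_all
  qed
  moreover have "K0 ** K0 = - mat 1"
  proof (rule block_matrix_eqI)
    have e: "(K0 ** K0) $ (i, p) $ (j, q) = (d p 1 * d 1 q + d p 2 * d 2 q) * (\<Sum>k\<in>UNIV. s i k * s k j)" for i j p q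
      unfolding matrix_matrix_mult_def vec_lambda_beta sum_UNIV_block K0 sum_distrib_left
      by (intro sum.cong refl) (simp add: algebra_simps)
    fix i j
    show "(K0 ** K0) $ (i, 1) $ (j, 1) = (- mat 1 :: 'm block_matrix) $ (i, 1) $ (j, 1)"
      "(K0 ** K0) $ (i, 1) $ (j, 2) = (- mat 1 :: 'm block_matrix) $ (i, 1) $ (j, 2)"
      "(K0 ** K0) $ (i, 2) $ (j, 1) = (- mat 1 :: 'm block_matrix) $ (i, 2) $ (j, 1)"
      "(K0 ** K0) $ (i, 2) $ (j, 2) = (- mat 1 :: 'm block_matrix) $ (i, 2) $ (j, 2)"
      unfolding e s2 d by (simp_all add: mat_def)
  qed
  ultimately have K0o: "K0 \<in> ocs" by (simp add: ocs_def)
  have K0J: "K0 ** J = - (J ** K0)"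
    by (rule block_matrix_eqI) (simp_all add: J_mult mult_J K0 d)
  obtain Q where Q: "orthogonal_matrix Q" "A = Q ** J ** transpose Q" using ocs_normal_form[OF A] .
  have mm: "conj_mat Q X ** conj_mat Q Y = conj_mat Q (X ** Y)" for X Y
  proof -
    have "conj_mat Q X ** conj_mat Q Y = Q ** X ** (transpose Q ** Q) ** Y ** transpose Q"
      by (simp only: conj_mat_def matrix_mul_assoc)
    then show ?thesis using orthogonal_matrixD(1)[OF Q(1)] by (simp add: conj_mat_def matrix_mul_assoc)
  qed
  have AQ: "A = conj_mat Q J" using Q(2) by (simp add: conj_mat_def)
  have "conj_mat Q K0 ** A = - (A ** conj_mat Q K0)"
    unfolding AQ mm K0J by (simp add: conj_mat_def mat_minus_left mat_minus_right)
  then show ?thesis using that conj_mat_ocs[OF K0o Q(1)] by blast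
qed

text \<open>\<open>A0\<close>, \<open>K\<close> and their product satisfy the quaternion relations,
  so \<open>L\<close> embeds the unit sphere in \<open>ocs\<close>. Its image is compact, hence
  closed; it is open because \<open>slice\<close> charts at its points do not leave the range of
  \<open>L\<close>.\<close>

lemma sphere_component:
  fixes N :: "'m::finite block_matrix set"
  assumes c: "CARD('m) = 2" and N: "N \<in> components ocs" and ch: "charted 2 N"
  shows "diffeomorphic (submanifold_structure N) (submanifold_structure (sphere (0::real^3) 1))"
proof -
  have No: "N \<subseteq> ocs" using N by (rule in_components_subset)
  obtain A0 where A0N: "A0 \<in> N" using N in_components_nonempty by blast
  then have A0: "A0 \<in> ocs" using No by blast
  obtain K where K: "K \<in> ocs" "K ** A0 = - (A0 ** K)" using ocs_anticomm_exists[OF c A0] .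
  define K2 where "K2 = A0 ** K"
  have pr: "A0 ** A0 = - mat 1" "K ** K = - mat 1" "A0 ** K = K2" "K ** A0 = - K2"
    using ocsD(2)[OF A0] ocsD(2)[OF K(1)] K(2) by (simp_all add: K2_def)
  have pr2: "A0 ** K2 = - K" "K2 ** K = - A0"
    unfolding K2_def by (simp add: matrix_mul_assoc pr(1) mat_minus_left)
      (simp add: pr(2) mat_minus_right flip: matrix_mul_assoc)
  have pr3: "K2 ** A0 = K"
  proof -
    have "K2 ** A0 = A0 ** (K ** A0)" by (simp add: K2_def matrix_mul_assoc)
    then show ?thesis unfolding pr(4) by (simp add: mat_minus_right pr2)
  qed
  have pr4: "K ** K2 = A0"
  proof -
    have "K ** K2 = (K ** A0) ** K" by (simp add: K2_def matrix_mul_assoc)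
    then show ?thesis unfolding pr(4) by (simp add: mat_minus_left pr2)
  qed
  have pr5: "K2 ** K2 = - mat 1"
  proof -
    have "K2 ** K2 = (K2 ** A0) ** K" by (simp add: K2_def matrix_mul_assoc)
    then show ?thesis unfolding pr3 pr(2) .
  qed
  have tK2: "transpose K2 = - K2"
    unfolding K2_def matrix_transpose_mul ocsD(1)[OF A0] ocsD(1)[OF K(1)] mat_minus_left mat_minus_right K(2) by simp
  define L where "L x = x $ 1 *\<^sub>R A0 + x $ 2 *\<^sub>R K + x $ 3 *\<^sub>R K2" for x :: "real^3"
  have lin: "linear L" by (rule linearI) (simp_all add: L_def algebra_simps)
  have Lsk: "transpose (L x) = - L x" for x
    unfolding L_def transpose_distrib ocsD(1)[OF A0] ocsD(1)[OF K(1)] tK2 by simp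
  \<comment> \<open>The Clifford relation: it yields both the square of \<open>L x\<close> and, for
    orthogonal vectors, anticommutation.\<close>
  have Lxy: "L x ** L y + L y ** L x = (- 2 * (x \<bullet> y)) *\<^sub>R mat 1" for x y
  proof -
    have i: "x \<bullet> y = x $ 1 * y $ 1 + x $ 2 * y $ 2 + x $ 3 * y $ 3" by (simp add: inner_vec_def sum_3)
    have "L x ** L y = - (x $ 1 * y $ 1 + x $ 2 * y $ 2 + x $ 3 * y $ 3) *\<^sub>R mat 1
        + (x $ 2 * y $ 3 - x $ 3 * y $ 2) *\<^sub>R A0 + (x $ 3 * y $ 1 - x $ 1 * y $ 3) *\<^sub>R K
        + (x $ 1 * y $ 2 - x $ 2 * y $ 1) *\<^sub>R K2" for x y
      unfolding L_def by (simp add: mat_distrib pr pr2 pr3 pr4 pr5 algebra_simps)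
    note e = this
    show ?thesis unfolding e[of x y] e[of y x] i
      by (simp add: vec_eq_iff) (simp add: algebra_simps)
  qed
  have Lxx: "L x ** L x = - (x \<bullet> x) *\<^sub>R mat 1" for x
  proof -
    have "2 *\<^sub>R (L x ** L x) = 2 *\<^sub>R (- (x \<bullet> x) *\<^sub>R mat 1)" using Lxy[of x x] by (simp only: scaleR_2[symmetric] scaleR_scaleR) simp
    then show ?thesis by (simp only: scaleR_cancel_left) simp
  qed
  have m1: "r *\<^sub>R mat 1 = (s *\<^sub>R mat 1 :: 'm block_matrix) \<Longrightarrow> r = s" for r s
  proof -
    assume "r *\<^sub>R mat 1 = (s *\<^sub>R mat 1 :: 'm block_matrix)"
    moreover have "(mat 1 :: 'm block_matrix) \<noteq> 0" by (simp add: vec_eq_iff mat_def)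
    ultimately show "r = s" by simp
  qed
  have L0: "x = 0" if "L x = 0" for x
  proof -
    have "(- (x \<bullet> x)) *\<^sub>R mat 1 = (0 *\<^sub>R mat 1 :: 'm block_matrix)" using Lxx[of x] that by simp
    then have "- (x \<bullet> x) = 0" by (rule m1)
    then show "x = 0" by simp
  qed
  have inj: "inj L" using L0 by (simp add: linear_injective_0[OF lin])
  let ?S = "sphere (0::real^3) 1"
  have Lo: "L x \<in> ocs \<longleftrightarrow> norm x = 1" for x
  proof -
    have "L x \<in> ocs \<longleftrightarrow> (- (x \<bullet> x)) *\<^sub>R mat 1 = ((- 1) *\<^sub>R mat 1 :: 'm block_matrix)"
      using Lsk[of x] Lxx[of x] by (simp add: ocs_def)
    also have "\<dots> \<longleftrightarrow> x \<bullet> x = 1" using m1[of "- (x \<bullet> x)" "-1"] by auto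
    finally show ?thesis by (simp add: norm_eq_1)
  qed
  have contL: "continuous_on X L" for X using lin by (simp add: linear_continuous_on linear_linear)
  have LS: "L ` ?S \<subseteq> N"
  proof (rule components_maximal[OF N])
    have "connected ?S" by (rule connected_sphere) simp
    then show "connected (L ` ?S)" by (rule connected_continuous_image[OF contL])
    show "L ` ?S \<subseteq> ocs"
    proof (rule image_subsetI)
      fix x assume "x \<in> ?S"
      then have "norm x = 1" by simp
      then show "L x \<in> ocs" unfolding Lo .
    qed
    have "L (axis 1 1) = A0" by (simp add: L_def axis_def)
    moreover have "axis 1 1 \<in> ?S" by (simp add: norm_eq_1 inner_axis_axis)
    ultimately show "N \<inter> L ` ?S \<noteq> {}" using A0N by (metis IntI empty_iff image_eqI)
  qed
  have "L ` ?S = N"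
  proof (rule clopen_in_connected[OF in_components_connected[OF N] LS])
    show "L ` ?S \<noteq> {}" by simp
    show "closed (L ` ?S)" by (intro compact_imp_closed compact_continuous_image contL compact_sphere)
    fix A1 assume "A1 \<in> L ` ?S"
    then obtain x0 where x0: "norm x0 = 1" "A1 = L x0" by auto
    have A1: "A1 \<in> ocs" "A1 \<in> N"
      using x0 Lo[of x0] LS \<open>A1 \<in> L ` ?S\<close> by blast+
    have x00: "x0 \<bullet> x0 = 1" using x0(1) by (simp add: norm_eq_1)
    let ?P = "{y. x0 \<bullet> y = 0}"
    have sP: "subspace ?P" by (simp add: subspace_def inner_add_right)
    have "x0 \<noteq> 0" using x0(1) by auto
    then have dP: "dim ?P = 2" by (simp add: dim_hyperplane)
    \<comment> \<open>The images of vectors orthogonal to \<open>x0\<close> anticommute with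
      \<open>A1\<close>, and both spaces have dimension 2.\<close>
    have "L ` ?P = anticomm A1"
    proof (rule subspace_dim_equal)
      show "subspace (L ` ?P)" using lin sP by (rule linear_subspace_image)
      show "subspace (anticomm A1)" by (rule subspace_anticomm)
      show "L ` ?P \<subseteq> anticomm A1"
      proof (rule image_subsetI)
        fix y assume "y \<in> ?P"
        then have "L y ** L x0 + L x0 ** L y = 0" using Lxy[of y x0] by (simp add: inner_commute)
        then show "L y \<in> anticomm A1" using Lsk[of y] by (simp add: anticomm_def skew_matrices_def x0(2) eq_neg_iff_add_eq_0)
      qed
      have "dim (L ` ?P) = dim ?P"
        by (rule dim_image_eq[OF lin]) (rule inj_on_subset[OF inj subset_UNIV])
      then show "dim (anticomm A1) \<le> dim (L ` ?P)" using dim_anticomm[OF A1(1)] c dP by simp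
    qed
    note an = this
    have "A \<in> L ` ?S" if A: "A \<in> N \<inter> slice_dom A1" for A
    proof -
      have Ao: "A \<in> ocs" using A No by blast
      have "slice A1 A \<in> anticomm A1" using slice_anticomm[OF A1(1) Ao] A by blast
      then obtain y where y: "x0 \<bullet> y = 0" "slice A1 A = L y" using an by blast
      have "A = unslice A1 (L y)" using slice_props(3)[OF ocsD(3)[OF A1(1)], of A] A y(2) by simp
      also have "\<dots> = 2 *\<^sub>R matrix_inv (L (y - x0)) - L x0" by (simp add: unslice_def x0(2) linear_diff[OF lin])
      \<comment> \<open>By \<open>Lxx\<close> the inverse of \<open>L z\<close> is a multiple of
        \<open>L z\<close>, so \<open>unslice\<close> takes values in the range of
        \<open>L\<close>.\<close>
      also have "matrix_inv (L (y - x0)) = (- (1 / ((y - x0) \<bullet> (y - x0)))) *\<^sub>R L (y - x0)"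
      proof (rule matrix_inv_unique(2))
        have "y - x0 \<noteq> 0" using y(1) x00 by auto
        then have "(y - x0) \<bullet> (y - x0) \<noteq> 0" by simp
        then show "L (y - x0) ** ((- (1 / ((y - x0) \<bullet> (y - x0)))) *\<^sub>R L (y - x0)) = mat 1"
          unfolding mat_scaleR_right Lxx by simp
      qed
      finally have "A = L (2 *\<^sub>R ((- (1 / ((y - x0) \<bullet> (y - x0)))) *\<^sub>R (y - x0)) - x0)"
        by (simp only: linear_diff[OF lin] linear_scale[OF lin])
      then obtain z where z: "A = L z" by blast
      then have "norm z = 1" using Ao Lo[of z] by simp
      then show ?thesis unfolding z by (intro imageI) simp
    qed
    then show "\<exists>U. openin (top_of_set N) U \<and> A1 \<in> U \<and> U \<subseteq> L ` ?S"
      using openin_slice_dom[OF No, of A1] A1 slice_dom_self[OF A1(1)] by blast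
  qed
  note LN = this
  obtain G where G: "linear G" "G \<circ> L = id" using linear_injective_left_inverse[OF lin inj] by blast
  have GL: "G (L x) = x" for x using G(2) by (metis comp_apply id_apply)
  show ?thesis
  proof (rule charted_diffeomorphic[OF ch])
    show "2 \<le> DIM(real^3)" by simp
    show "smooth_on N G" by (rule smooth_on_linear[OF G(1)])
    show "smooth_on ?S L" by (rule smooth_on_linear[OF lin])
    show "G ` N = ?S" unfolding LN[symmetric] image_image GL by simp
    show "L (G A) = A" if "A \<in> N" for A using that unfolding LN[symmetric] by (auto simp: GL)
  qed
qed

theorem proposition3p2:
  fixes M M_plus M_minus :: "'m::finite block_matrix set"
    and SO_mod_U :: "('m block_matrix set, 'm block_matrix) smooth_mfd"
    and \<mu> :: nat
  assumes "\<mu> = CARD('m)"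
    and "M = {A \<in> skew_matrices. orthogonal_matrix A}"
    and "M_plus = {A \<in> M. pfaffian A = 1}"
    and "M_minus = {A \<in> M. pfaffian A = -1}"
    and "SO_mod_U = homogeneous_space special_orthogonal_group unitary_group"
  shows "submanifold skew_matrices (\<mu> * (\<mu> - 1)) M \<and> compact M \<and>
         components M = {M_plus, M_minus} \<and>
         (\<forall>N\<in>{M_plus, M_minus}.
            submanifold skew_matrices (\<mu> * (\<mu> - 1)) N \<and> simply_connected N \<and>
            diffeomorphic (submanifold_structure N) SO_mod_U \<and>
            (\<mu> = 1 \<longrightarrow> (\<exists>A. N = {A})) \<and>
            (\<mu> = 2 \<longrightarrow> diffeomorphic (submanifold_structure N)
                         (submanifold_structure (sphere (0::real^3) 1))))"
proof -
  have M: "M = ocs" unfolding assms(2) ocs_eq ..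
  obtain R' :: "'m block_matrix" where R': "orthogonal_matrix R'" "det R' = -1"
    using orthogonal_det_minus_one by blast
  have R: "orthogonal_matrix (mat 1 :: 'm block_matrix)" "det (mat 1 :: 'm block_matrix) = 1"
    by (simp_all add: orthogonal_matrix_id)
  have pm: "M_plus = signed_ocs (mat 1)" "M_minus = signed_ocs R'"
    \<comment> \<open>The component with Pfaffian 1 is labelled by the identity, the other one by a
      reflection.\<close>
    unfolding assms(3,4) M signed_ocs_def R R' by simp_all
  note comp = components_block_ocs[OF R R']
  have main: "submanifold skew_matrices (\<mu> * (\<mu> - 1)) N \<and> simply_connected N \<and>
      diffeomorphic (submanifold_structure N) SO_mod_U \<and> (\<mu> = 1 \<longrightarrow> (\<exists>A. N = {A})) \<and>
      (\<mu> = 2 \<longrightarrow> diffeomorphic (submanifold_structure N) (submanifold_structure (sphere (0::real^3) 1)))"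
    if N: "N = signed_ocs Q" and Q: "orthogonal_matrix Q" and cN: "N \<in> components ocs" and sc: "simply_connected N"
    for N and Q :: "'m block_matrix"
  proof -
    have sub: "submanifold skew_matrices (\<mu> * (\<mu> - 1)) N"
      unfolding N assms(1) by (rule submanifold_signed_ocs[OF Q])
    interpret homogeneous_fibration special_orthogonal_group unitary_group "\<lambda>g. conj_mat (Q ** g) J" "signed_ocs Q"
      "dim (skew_matrices :: 'm block_matrix set)" "CARD('m) * (CARD('m) - 1)"
      by (rule homogeneous_fibration_signed_ocs[OF Q])
    have "diffeomorphic (submanifold_structure N) SO_mod_U"
      unfolding N assms(5) by (rule diffeomorphic_homogeneous_space)
    moreover have "\<exists>A. N = {A}" if "\<mu> = 1"
      using connected_ocs_singleton[OF _ in_components_connected[OF cN] in_components_subset[OF cN] in_components_nonempty[OF cN]]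
        that assms(1) by simp
    moreover have "diffeomorphic (submanifold_structure N) (submanifold_structure (sphere (0::real^3) 1))" if "\<mu> = 2"
      by (rule sphere_component[OF _ cN]) (use submanifold_imp_charted[OF sub] that assms(1) in simp_all)
    ultimately show ?thesis using sub sc by blast
  qed
  have "submanifold skew_matrices (\<mu> * (\<mu> - 1)) M"
    unfolding M assms(1) by (rule submanifold_block_ocs)
  moreover have "compact M" unfolding M by (rule compact_ocs)
  moreover have "components M = {M_plus, M_minus}" unfolding M pm by (rule comp(1))
  ultimately show ?thesis
    using main[OF pm(1) R(1)] main[OF pm(2) R'(1)] comp unfolding pm by blast
qed

end
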